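(* Let $I$ be a regular proper ideal in a Noetherian ring $R$, let $(V,N)$ be a Rees valuation ring of $I$, and assume that $IV=N^k$. Let $(W,Q)$ be the Rees valuation ring of $uR[u,tI]$ that corresponds to $V$, and let $h$ be an arbitrary positive integer. Then $U=W[u^{1/k}]'$ and $D=W[u^{1/(hk)}]'=U[(u^{1/k})^{1/h}]'$ are DVRs that are finite free integral extension domains of $W$; the maximal ideal of $U$ (resp., $D$) is $P=u^{1/k}U$ (resp., $M=u^{1/(hk)}D$); the ramification index of $D$ relative to $U$ (resp., of $U$ relative to $W$) is equal to $h$ (resp., $1$); $[D:U]=h$ and $[U:W]=k$; and $D/M\cong U/P$ and $[(U/P):(W/Q)]=k$. Therefore $W$ and $U$ (resp., $W$ and $D$; $U$ and $D$) satisfy the Fundamental Equality with no splitting. Also, $U$ (resp., $D$) is an Itoh $(k)$-valuation ring (resp., Itoh $(hk)$-valuation ring) of $I$.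
   Context: Rings are commutative with $1\neq 0$. $A'$ denotes the integral closure of a ring $A$ in its total quotient ring. An ideal is regular if it contains a regular element (nonzerodivisor). Rees valuation rings. Let $I$ be a regular proper ideal in a Noetherian ring $R$, generated by regular elements $b_1,\dots,b_g$. For each $i$ let $C_i=R[I/b_i]$ (a subring of the total quotient ring of $R$). For each (necessarily height one) associated prime $p$ of $b_iC_i'$ let $z$ be the unique minimal prime of $C_i'$ contained in $p$; then $(C_i'/z)_{(p/z)}$ is a DVR. The set of all DVRs so obtained is the set of Rees valuation rings of $I$; it does not depend on the choice of generators. $t$ is an indeterminate, $u=1/t$, $\mathbf R=R[u,tI]\subseteq R[u,t]$. Roots $u^{1/m}$ are taken compatibly, $(u^{1/(hm)})^h=u^{1/m}$, in an algebraic closure of the quotient field of $W$ where relevant, and $t^{1/m}=1/u^{1/m}$. If $V=(R[I/b_i]'/z)_{(p/z)}$ is a Rees valuation ring of $I$ with maximal ideal $N$, the corresponding Rees valuation ring of $u\mathbf R$ is $W=V[t\overline{b_i}]_{NV[t\overline{b_i}]}$, where $\overline{b_i}=b_i+z$, with maximal ideal $Q=NW$. If $F$ is the quotient field of $V$, then $W$ has quotient field $F(u)$. For a positive integer $m$, let $\mathbf T_m=R[u,tI,u^{1/m}]'\cap R[u^{1/m},t^{1/m}]$. The Itoh $(m)$-valuation rings of $I$ are the DVRs $(\mathbf T_m/z)_{(p/z)}$, where $p$ runs over the (height one) associated primes of $u^{1/m}\mathbf T_m$ and $z$ is the unique minimal prime of $\mathbf T_m$ contained in $p$. If $(W,Q)\le(V^*,N^*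 )$ are DVRs with $V^*$ a localization of an integral extension domain of $W$, the ramification index of $V^*$ relative to $W$ is the $r$ with $QV^*=(N^* )^r$. $[S:A]$ denotes the degree of the quotient field of $S$ over that of $A$. DVRs $(V,N)$ and $(V_1,N_1)$, where the quotient field $E$ of $V_1$ is a finite extension of the quotient field $F$ of $V$, satisfy the Fundamental Equality with no splitting if $V_1$ is the only valuation ring of $E$ that extends $V$ and $[E:F]=e_1f_1$, where $NV_1=N_1^{e_1}$ and $f_1=[(V_1/N_1):(V/N)]$. *)

theory Defs
  imports
    "HOL-Algebra.Algebraic_Closure_Type"
    "HOL-Algebra.Ideal_Product"
    "HOL-Algebra.Generated_Rings"
begin

section \<open>Subrings of an ambient ring, as rings\<close>

text \<open>
  The ambient rings and fields are types; their subrings are sets.  \<open>ring_on A\<close> is the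
  HOL-Algebra structure carried by such a set.
\<close>

abbreviation ring_on :: "'a::comm_ring_1 set \<Rightarrow> 'a ring" where
  "ring_on A \<equiv> ring_of_type_algebra \<lparr>carrier := A\<rparr>"

abbreviation ring_gen :: "'a::comm_ring_1 set \<Rightarrow> 'a set" where
  "ring_gen S \<equiv> generate_ring ring_of_type_algebra S"

definition regular_in :: "'a::comm_ring_1 set \<Rightarrow> 'a \<Rightarrow> bool" where
  "regular_in A b \<longleftrightarrow> b \<in> A \<and> (\<forall>x\<in>A. x * b = 0 \<longrightarrow> x = 0)"

section \<open>The total quotient ring of a ring\<close>

definition tqr_rel :: "'a::comm_ring_1 \<times> 'a \<Rightarrow> 'a \<times> 'a \<Rightarrow> bool" where
  "tqr_rel x y \<longleftrightarrow> regular_in UNIV (snd x) \<and> regular_in UNIV (snd y) \<and>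
     fst x * snd y = fst y * snd x"

lemma regular_UNIV_one: "regular_in UNIV (1::'a::comm_ring_1)"
  by (simp add: regular_in_def)

lemma regular_UNIV_mult:
  fixes a b :: "'a::comm_ring_1"
  assumes "regular_in UNIV a" "regular_in UNIV b"
  shows "regular_in UNIV (a * b)"
  using assms unfolding regular_in_def by (metis UNIV_I mult.assoc)

lemma regular_UNIV_cancel:
  fixes a b c :: "'a::comm_ring_1"
  assumes "regular_in UNIV c" "a * c = b * c"
  shows "a = b"
proof -
  have "(a - b) * c = 0" using assms(2) by (simp add: algebra_simps)
  then have "a - b = 0" using assms(1) unfolding regular_in_def by blast
  then show ?thesis by simp
qed

quotient_type (overloaded) 'a tqr = "'a::comm_ring_1 \<times> 'a" / partial: tqr_rel
proof (rule part_equivpI)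
  show "\<exists>x::'a \<times> 'a. tqr_rel x x"
    by (rule exI[of _ "(0, 1)"]) (simp add: tqr_rel_def regular_UNIV_one)
  show "symp (tqr_rel :: 'a \<times> 'a \<Rightarrow> _)"
    by (auto simp: symp_def tqr_rel_def)
  show "transp (tqr_rel :: 'a \<times> 'a \<Rightarrow> _)"
  proof (rule transpI)
    fix x y z :: "'a \<times> 'a"
    assume xy: "tqr_rel x y" and yz: "tqr_rel y z"
    have "(fst x * snd z) * snd y = (fst x * snd y) * snd z" by (simp add: ac_simps)
    also have "\<dots> = (fst y * snd z) * snd x" using xy by (simp add: tqr_rel_def ac_simps)
    also have "\<dots> = (fst z * snd x) * snd y" using yz by (simp add: tqr_rel_def ac_simps)
    finally have "fst x * snd z = fst z * snd x"
      using xy regular_UNIV_cancel unfolding tqr_rel_def by blast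
    with xy yz show "tqr_rel x z" by (simp add: tqr_rel_def)
  qed
qed

text \<open>\<open>Tqr a b\<close> is the fraction \<open>a / b\<close>; it is used for regular \<open>b\<close> only (and is \<open>0\<close> otherwise).\<close>

lift_definition Tqr :: "'a::comm_ring_1 \<Rightarrow> 'a \<Rightarrow> 'a tqr"
  is "\<lambda>a b. if regular_in UNIV b then (a, b) else (0, 1)"
  by (simp add: tqr_rel_def regular_UNIV_one)

instantiation tqr :: (comm_ring_1) comm_ring_1
begin

lift_definition zero_tqr :: "'a tqr" is "(0, 1)"
  by (simp add: tqr_rel_def regular_UNIV_one)

lift_definition one_tqr :: "'a tqr" is "(1, 1)"
  by (simp add: tqr_rel_def regular_UNIV_one)

lift_definition plus_tqr :: "'a tqr \<Rightarrow> 'a tqr \<Rightarrow> 'a tqr"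
  is "\<lambda>x y. (fst x * snd y + fst y * snd x, snd x * snd y)"
proof -
  fix x x' y y' :: "'a \<times> 'a"
  assume x: "tqr_rel x x'" and y: "tqr_rel y y'"
  have "(fst x * snd y + fst y * snd x) * (snd x' * snd y') =
        (fst x * snd x') * (snd y * snd y') + (fst y * snd y') * (snd x * snd x')"
    by (simp add: algebra_simps)
  also have "\<dots> = (fst x' * snd x) * (snd y * snd y') + (fst y' * snd y) * (snd x * snd x')"
    using x y by (simp add: tqr_rel_def)
  also have "\<dots> = (fst x' * snd y' + fst y' * snd x') * (snd x * snd y)"
    by (simp add: algebra_simps)
  finally show "tqr_rel (fst x * snd y + fst y * snd x, snd x * snd y)
                        (fst x' * snd y' + fst y' * snd x', snd x' * snd y')"
    using x y by (simp add: tqr_rel_def regular_UNIV_mult)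
qed

lift_definition times_tqr :: "'a tqr \<Rightarrow> 'a tqr \<Rightarrow> 'a tqr"
  is "\<lambda>x y. (fst x * fst y, snd x * snd y)"
proof -
  fix x x' y y' :: "'a \<times> 'a"
  assume x: "tqr_rel x x'" and y: "tqr_rel y y'"
  have "(fst x * fst y) * (snd x' * snd y') = (fst x * snd x') * (fst y * snd y')"
    by (simp add: ac_simps)
  also have "\<dots> = (fst x' * snd x) * (fst y' * snd y)"
    using x y by (simp add: tqr_rel_def)
  finally have "(fst x * fst y) * (snd x' * snd y') = (fst x' * fst y') * (snd x * snd y)"
    by (simp add: ac_simps)
  then show "tqr_rel (fst x * fst y, snd x * snd y) (fst x' * fst y', snd x' * snd y')"
    using x y by (simp add: tqr_rel_def regular_UNIV_mult)
qed

lift_definition uminus_tqr :: "'a tqr \<Rightarrow> 'a tqr" is "\<lambda>x. (- fst x, snd x)"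
  by (simp add: tqr_rel_def)

definition minus_tqr :: "'a tqr \<Rightarrow> 'a tqr \<Rightarrow> 'a tqr" where
  "minus_tqr x y = x + (- y)"

instance
proof
  fix a b c :: "'a tqr"
  show "a * b * c = a * (b * c)"
    by transfer (simp add: tqr_rel_def regular_UNIV_mult algebra_simps)
  show "a * b = b * a"
    by transfer (simp add: tqr_rel_def regular_UNIV_mult algebra_simps)
  show "1 * a = a"
    by transfer (simp add: tqr_rel_def)
  show "a + b + c = a + (b + c)"
    by transfer (simp add: tqr_rel_def regular_UNIV_mult algebra_simps)
  show "a + b = b + a"
    by transfer (simp add: tqr_rel_def regular_UNIV_mult algebra_simps)
  show "0 + a = a"
    by transfer (simp add: tqr_rel_def)
  show "- a + a = 0"
    by transfer (simp add: tqr_rel_def regular_UNIV_mult regular_UNIV_one)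
  show "a - b = a + - b"
    by (simp add: minus_tqr_def)
  show "(a + b) * c = a * c + b * c"
    by transfer (simp add: tqr_rel_def regular_UNIV_mult algebra_simps)
  show "(0::'a tqr) \<noteq> 1"
    by transfer (simp add: tqr_rel_def)
qed

end

section \<open>Integral closure\<close>

text \<open>
  \<open>tot_quot A\<close> realizes the total quotient ring of a subring \<open>A\<close> inside an ambient ring in
  which all regular elements of \<open>A\<close> are units.  This is so in every use below: the ambient ring
  is a field, or \<open>'r tqr\<close> with \<open>A\<close> containing \<open>'r\<close>, or \<open>'r poly tqr\<close> with \<open>A\<close> containing \<open>'r poly\<close>.
  For a subring of a field it is the quotient field.
\<close>

definition tot_quot :: "'a::comm_ring_1 set \<Rightarrow> 'a set" where
  "tot_quot A = {x. \<exists>a\<in>A. \<exists>b. regular_in A b \<and> x * b = a}"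

definition integral_over :: "'a::comm_ring_1 set \<Rightarrow> 'a \<Rightarrow> bool" where
  "integral_over A x \<longleftrightarrow>
     (\<exists>f::'a poly. Polynomial.lead_coeff f = 1 \<and> (\<forall>i. Polynomial.coeff f i \<in> A) \<and> poly f x = 0)"

definition int_closure :: "'a::comm_ring_1 set \<Rightarrow> 'a set" where
  "int_closure A = {x \<in> tot_quot A. integral_over A x}"

section \<open>Primes and discrete valuation rings\<close>

definition associated_prime :: "'a::comm_ring_1 set \<Rightarrow> 'a set \<Rightarrow> 'a set \<Rightarrow> bool" where
  "associated_prime A J p \<longleftrightarrow>
     primeideal p (ring_on A) \<and> (\<exists>x\<in>A. p = {y \<in> A. y * x \<in> J})"

definition minimal_prime :: "'a::comm_ring_1 set \<Rightarrow> 'a set \<Rightarrow> bool" where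
  "minimal_prime A z \<longleftrightarrow>
     primeideal z (ring_on A) \<and> (\<forall>q. primeideal q (ring_on A) \<and> q \<subseteq> z \<longrightarrow> q = z)"

definition unique_minimal_prime_in :: "'a::comm_ring_1 set \<Rightarrow> 'a set \<Rightarrow> 'a set \<Rightarrow> bool" where
  "unique_minimal_prime_in A p z \<longleftrightarrow>
     minimal_prime A z \<and> z \<subseteq> p \<and> (\<forall>z'. minimal_prime A z' \<and> z' \<subseteq> p \<longrightarrow> z' = z)"

definition dvr :: "'a::comm_ring_1 set \<Rightarrow> 'a set \<Rightarrow> bool" where
  "dvr V N \<longleftrightarrow> principal_domain (ring_on V) \<and> maximalideal N (ring_on V) \<and> N \<noteq> {0} \<and>
     (\<forall>N'. maximalideal N' (ring_on V) \<longrightarrow> N' = N)"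

text \<open>
  \<open>residue_localization A p z \<phi> V\<close>: the homomorphism \<open>\<phi>\<close> from \<open>A\<close> to a field has kernel \<open>z\<close>, hence
  identifies \<open>A/z\<close> with a subring of that field, and \<open>V\<close> is the localization of \<open>A/z\<close> at \<open>p/z\<close>
  inside its quotient field.
\<close>

definition residue_localization ::
  "'a::comm_ring_1 set \<Rightarrow> 'a set \<Rightarrow> 'a set \<Rightarrow> ('a \<Rightarrow> 'l::field) \<Rightarrow> 'l set \<Rightarrow> bool" where
  "residue_localization A p z \<phi> V \<longleftrightarrow>
     \<phi> \<in> ring_hom (ring_on A) ring_of_type_algebra \<and>
     a_kernel (ring_on A) (ring_of_type_algebra :: 'l ring) \<phi> = z \<and>
     V = {\<phi> x / \<phi> y | x y. x \<in> A \<and> y \<in> A - p}"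

definition localization_at :: "'l::field set \<Rightarrow> 'l set \<Rightarrow> 'l set" where
  "localization_at A p = {x / y | x y. x \<in> A \<and> y \<in> A - p}"

section \<open>Rees valuation rings\<close>

text \<open>\<open>R[I/b]\<close> for the ring \<open>R = UNIV :: 'r set\<close>\<close>

definition blowup_ring :: "'r::comm_ring_1 set \<Rightarrow> 'r \<Rightarrow> 'r tqr set" where
  "blowup_ring I b = ring_gen (range (\<lambda>r. Tqr r 1) \<union> (\<lambda>a. Tqr a b) ` I)"

text \<open>
  \<open>V\<close> is a Rees valuation ring of \<open>I\<close> arising from the regular generator \<open>b\<close> of \<open>I\<close>, realized in the
  field \<open>'l\<close> through the residue homomorphism \<open>\<phi>\<close> from \<open>R[I/b]'\<close>.
\<close>

definition rees_valuation_ring ::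
  "'r::comm_ring_1 set \<Rightarrow> 'r \<Rightarrow> ('r tqr \<Rightarrow> 'l::field) \<Rightarrow> 'l set \<Rightarrow> 'l set \<Rightarrow> bool" where
  "rees_valuation_ring I b \<phi> V N \<longleftrightarrow>
     (\<exists>B. finite B \<and> b \<in> B \<and> (\<forall>c\<in>B. regular_in UNIV c) \<and>
          I = genideal (ring_of_type_algebra :: 'r ring) B) \<and>
     (\<exists>p z. associated_prime (int_closure (blowup_ring I b))
               (cgenideal (ring_on (int_closure (blowup_ring I b))) (Tqr b 1)) p \<and>
            unique_minimal_prime_in (int_closure (blowup_ring I b)) p z \<and>
            residue_localization (int_closure (blowup_ring I b)) p z \<phi> V) \<and>
     dvr V N"

text \<open>
  The ring \<open>W = V[t \<beta>]\<close> localized at \<open>N V[t \<beta>]\<close>, where \<open>t = 1/u\<close> and \<open>\<beta>\<close> is the residue of \<open>b\<close>.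
\<close>

definition rees_extension :: "'l::field set \<Rightarrow> 'l set \<Rightarrow> 'l \<Rightarrow> 'l \<Rightarrow> 'l set" where
  "rees_extension V N \<beta> u =
     localization_at (ring_gen (V \<union> {inverse u * \<beta>}))
       (genideal (ring_on (ring_gen (V \<union> {inverse u * \<beta>}))) N)"

section \<open>Itoh valuation rings\<close>

text \<open>
  All rings here are subrings of the total quotient ring of the polynomial ring \<open>R[X]\<close>, whose
  indeterminate \<open>X\<close> plays the role of \<open>u\<^sup>1\<^sup>/\<^sup>m\<close>; thus \<open>u = X^m\<close> and \<open>t = 1/X^m\<close>.
\<close>

definition tconst :: "'r::comm_ring_1 \<Rightarrow> 'r poly tqr" where
  "tconst r = Tqr [:r:] 1"

definition uroot :: "'r::comm_ring_1 poly tqr" where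
  "uroot = Tqr [:0, 1:] 1"

definition troot :: "'r::comm_ring_1 poly tqr" where
  "troot = Tqr 1 [:0, 1:]"

definition itoh_ring :: "'r::comm_ring_1 set \<Rightarrow> nat \<Rightarrow> 'r poly tqr set" where
  "itoh_ring I m =
     int_closure (ring_gen (range tconst \<union> {uroot ^ m} \<union> (\<lambda>a. troot ^ m * tconst a) ` I \<union> {uroot}))
     \<inter> ring_gen (range tconst \<union> {uroot, troot})"

text \<open>
  \<open>A\<close> is an Itoh \<open>(m)\<close>-valuation ring of \<open>I\<close> inside the field \<open>'l\<close>: the residue homomorphism \<open>\<psi>\<close> is
  required to extend the given structure map \<open>\<theta>\<close> of \<open>R\<close> and to send \<open>u\<^sup>1\<^sup>/\<^sup>m\<close> to the chosen root \<open>s\<close>.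
\<close>

definition itoh_valuation_ring ::
  "'r::comm_ring_1 set \<Rightarrow> nat \<Rightarrow> ('r \<Rightarrow> 'l::field) \<Rightarrow> 'l \<Rightarrow> 'l set \<Rightarrow> bool" where
  "itoh_valuation_ring I m \<theta> s A \<longleftrightarrow>
     (\<exists>p z \<psi>. associated_prime (itoh_ring I m) (cgenideal (ring_on (itoh_ring I m)) uroot) p \<and>
        unique_minimal_prime_in (itoh_ring I m) p z \<and>
        residue_localization (itoh_ring I m) p z \<psi> A \<and>
        (\<forall>r. \<psi> (tconst r) = \<theta> r) \<and> \<psi> uroot = s) \<and>
     (\<exists>M. dvr A M)"

section \<open>Extensions of discrete valuation rings\<close>

text \<open>\<open>[S : A] = n\<close>, the degree of quotient fields\<close>

definition has_degree :: "'l::field set \<Rightarrow> 'l set \<Rightarrow> nat \<Rightarrow> bool" where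
  "has_degree A S n \<longleftrightarrow> ring.dimension ring_of_type_algebra n (tot_quot A) (tot_quot S)"

definition has_ramification_index :: "'l::field set \<Rightarrow> 'l set \<Rightarrow> 'l set \<Rightarrow> nat \<Rightarrow> bool" where
  "has_ramification_index Q S M r \<longleftrightarrow>
     genideal (ring_on S) Q = M [^]\<^bsub>ideals_set (ring_on S)\<^esub> r"

text \<open>\<open>[(S/M) : (A/Q)] = n\<close>, where \<open>A/Q\<close> is identified with the image of \<open>A\<close> in \<open>S/M\<close>\<close>

definition has_residue_degree ::
  "'l::field set \<Rightarrow> 'l set \<Rightarrow> 'l set \<Rightarrow> 'l set \<Rightarrow> nat \<Rightarrow> bool" where
  "has_residue_degree A Q S M n \<longleftrightarrow>
     Q = A \<inter> M \<and>
     ring.dimension (ring_on S Quot M) n ((\<lambda>a. M +>\<^bsub>ring_on S\<^esub> a) ` A) (carrier (ring_on S Quot M))"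

definition finite_free_extension :: "'l::field set \<Rightarrow> 'l set \<Rightarrow> bool" where
  "finite_free_extension A S \<longleftrightarrow>
     subring A (ring_on S) \<and>
     (\<exists>B \<subseteq> S. finite B \<and> (\<forall>x\<in>S. \<exists>!c. c \<in> B \<rightarrow>\<^sub>E A \<and> x = (\<Sum>b\<in>B. c b * b)))"

definition integral_extension_domain :: "'l::field set \<Rightarrow> 'l set \<Rightarrow> bool" where
  "integral_extension_domain A S \<longleftrightarrow>
     subring A (ring_on S) \<and> domain (ring_on S) \<and> (\<forall>x\<in>S. integral_over A x)"

definition valuation_ring_of :: "'l::field set \<Rightarrow> 'l set \<Rightarrow> bool" where
  "valuation_ring_of E A \<longleftrightarrow>
     subring A (ring_on E) \<and> (\<forall>x\<in>E. x \<noteq> 0 \<longrightarrow> x \<in> A \<or> inverse x \<in> A)"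

definition fundamental_equality_no_splitting ::
  "'l::field set \<Rightarrow> 'l set \<Rightarrow> 'l set \<Rightarrow> 'l set \<Rightarrow> bool" where
  "fundamental_equality_no_splitting V N V1 N1 \<longleftrightarrow>
     dvr V N \<and> dvr V1 N1 \<and> tot_quot V \<subseteq> tot_quot V1 \<and>
     (\<forall>A. valuation_ring_of (tot_quot V1) A \<and> A \<inter> tot_quot V = V \<longleftrightarrow> A = V1) \<and>
     (\<exists>e f. has_degree V V1 (e * f) \<and> has_ramification_index N V1 N1 e \<and>
            has_residue_degree V N V1 N1 f)"

end

(*
Let v be the valuation of V, F its quotient field, s = u^(1/(hk)) and w the monomial valuation
w (sum a_i s^i) = min (h v(a_i) + i) on F(s).  Since v(b) = k, the element b/u has value 0 and the ring
W is the valuation ring of w on F(u); likewise U and D are the valuation rings of w on F(s^h) and F(s).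
For a uniformizer pi of V, the powers s^l, divided by suitable powers of pi, form a basis in which w is
computed coefficientwise; it is therefore a module basis of the valuation rings, and ramification index,
residue degree and uniqueness of the extension can be read off.

For the Itoh property (m = hk), let T be the Itoh ring, psi : T -> F(s) the evaluation X = u^(1/m) -> s and p
the centre of D on T.  There is f in T of value 0 such that every Laurent polynomial of nonnegative
value is carried into T by a power of f: this yields T_p / ker = D, and that every prime inside p
contains the kernel.  The prime p is associated to X T since p = (X T : f^L) for large L; this holds
for a fixed L because T consists of the elements that are almost integral over a Noetherian ring,
where the f-torsion modulo X is killed by a fixed power.
*)

theory Submission
  imports Defs
begin

section \<open>Subrings as sets\<close>

text \<open>\<open>R\<close> need not be reduced and neither \<open>C' = R[I/b]'\<close> nor
  \<open>T\<close> need be Noetherian, so primary decomposition is not at hand for them. Two devices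
  replace it. An element of the unique minimal prime below a prime is killed, up to a power, by a
  factor outside that prime. And integrality is traded for almost integrality, a statement about
  fixed denominators to which the Noetherian ring below applies. The element \<open>f\<close>
  originates in the assumption that \<open>p\<^sub>0\<close> is associated to \<open>bC'\<close>. A
  witness \<open>x\<^sub>0\<close> with \<open>p\<^sub>0 = (bC' : x\<^sub>0)\<close> must have value
  k - 1, so multiplication by \<open>x\<^sub>0 / b\<close> lowers values by exactly one and, as long
  as the value is positive, does not lead out of \<open>C'\<close>. Hence
  \<open>y = x\<^sub>0 ^ k / b ^ (k - 1)\<close> has value 0, and once \<open>y\<close> is inverted,
  divisibility by powers of b in \<open>C'\<close> is decided by the value. A multiple of
  \<open>y\<close> whose only denominators are powers of b, times powers of b/u, is
  \<open>f\<close>. The factor h in front of v makes all values integral: s gets value 1 and u =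
  s^(hk) the value hk of b.\<close>

locale subring_set =
  fixes A :: "'a::comm_ring_1 set"
  assumes one_mem: "1 \<in> A"
    and diff_mem: "x \<in> A \<Longrightarrow> y \<in> A \<Longrightarrow> x - y \<in> A"
    and mult_mem: "x \<in> A \<Longrightarrow> y \<in> A \<Longrightarrow> x * y \<in> A"
begin

lemma zero_mem: "0 \<in> A"
  using diff_mem[OF one_mem one_mem] by simp

lemma uminus_mem: "x \<in> A \<Longrightarrow> - x \<in> A"
  using diff_mem[OF zero_mem] by force

lemma add_mem: "x \<in> A \<Longrightarrow> y \<in> A \<Longrightarrow> x + y \<in> A"
  using diff_mem[OF _ uminus_mem] by force

lemma power_mem: "x \<in> A \<Longrightarrow> x ^ n \<in> A"
  by (induction n) (auto intro: one_mem mult_mem)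

lemma sum_mem: "(\<And>i. i \<in> S \<Longrightarrow> f i \<in> A) \<Longrightarrow> sum f S \<in> A"
  by (induction S rule: infinite_finite_induct) (auto intro: zero_mem add_mem)

lemma of_nat_mem: "of_nat n \<in> A"
  by (induction n) (auto intro: zero_mem one_mem add_mem)

lemmas mems = one_mem zero_mem diff_mem mult_mem uminus_mem add_mem power_mem

end

lemma type_ring_simps [simp]:
  "carrier ring_of_type_algebra = UNIV"
  "monoid.mult ring_of_type_algebra = (*)"
  "monoid.one ring_of_type_algebra = 1"
  "ring.zero ring_of_type_algebra = 0"
  "ring.add ring_of_type_algebra = (+)"
  by (simp_all add: ring_of_type_algebra_def fun_eq_iff)

lemma type_ring_pow [simp]: "x [^]\<^bsub>ring_of_type_algebra\<^esub> (n::nat) = x ^ n"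
  by (induction n) (simp_all add: nat_pow_def power_commutes)

lemma type_ring_a_inv [simp]: "\<ominus>\<^bsub>ring_of_type_algebra\<^esub> (x::'a::comm_ring_1) = - x"
  using abelian_group.minus_equality[OF ring.is_abelian_group[OF ring_from_type_algebra], of "- x" x]
  by simp

lemma cring_ring_on:
  assumes "subring_set A" shows "cring (ring_on A)"
proof -
  interpret subring_set A by fact
  show ?thesis
  proof (rule cringI)
    show "abelian_group (ring_on A)"
    proof (rule abelian_groupI)
      fix x assume "x \<in> carrier (ring_on A)"
      then show "\<exists>y\<in>carrier (ring_on A). y \<oplus>\<^bsub>ring_on A\<^esub> x = \<zero>\<^bsub>ring_on A\<^esub>"
        by (intro bexI[of _ "- x"]) (auto intro: mems)
    qed (auto intro: mems simp: ac_simps)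
    show "Group.comm_monoid (ring_on A)"
      by (rule comm_monoidI) (auto intro: mems simp: ac_simps)
  qed (auto simp: algebra_simps)
qed

lemma subring_set_of_cring:
  assumes "cring (ring_on A)" shows "subring_set A"
proof -
  interpret cring "ring_on A" by fact
  have um: "- x \<in> A" if x: "x \<in> A" for x
  proof -
    have "\<ominus>\<^bsub>ring_on A\<^esub> x \<in> A" "x + \<ominus>\<^bsub>ring_on A\<^esub> x = 0"
      using a_inv_closed[of x] r_neg[of x] x by simp_all
    then show ?thesis by (metis add.inverse_unique)
  qed
  show ?thesis
  proof
    show "1 \<in> A" using one_closed by simp
    fix x y assume x: "x \<in> A" and y: "y \<in> A"
    show "x * y \<in> A" using m_closed[of x y] x y by simp
    have "x + - y \<in> A" using a_closed[of x "- y"] um[OF y] x by simp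
    then show "x - y \<in> A" by simp
  qed
qed

lemma domain_ring_on:
  assumes "subring_set (A::'a::field set)" shows "domain (ring_on A)"
proof -
  interpret cring "ring_on A" by (rule cring_ring_on[OF assms])
  show ?thesis by unfold_locales auto
qed

lemma subring_ring_on:
  assumes "subring_set A" "subring_set S" "A \<subseteq> S" shows "subring A (ring_on S)"
proof -
  interpret A: subring_set A by fact
  interpret cring "ring_on S" by (rule cring_ring_on[OF assms(2)])
  have inv: "\<ominus>\<^bsub>ring_on S\<^esub> x = - x" if "x \<in> A" for x
  proof -
    have "x \<in> S" "- x \<in> S" using that assms(3) A.uminus_mem by auto
    then show ?thesis using minus_equality[of "- x" x] by simp
  qed
  show ?thesis
    by (rule subringI) (use assms(3) in \<open>auto simp: inv intro: A.mems\<close>)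
qed

lemma subring_set_of_subring:
  assumes "subring A (ring_on S)" "subring_set S" shows "subring_set A"
proof -
  interpret cring "ring_on S" by (rule cring_ring_on[OF assms(2)])
  interpret S: subring_set S by fact
  have sub: "A \<subseteq> S" using subringE(1)[OF assms(1)] by simp
  have um: "- x \<in> A" if x: "x \<in> A" for x
  proof -
    have "- x \<in> S" using x sub S.uminus_mem by auto
    then have "\<ominus>\<^bsub>ring_on S\<^esub> x = - x" using minus_equality[of "- x" x] x sub by auto
    then show ?thesis using subringE(5)[OF assms(1) x] by simp
  qed
  show ?thesis
  proof
    show "1 \<in> A" using subringE(3)[OF assms(1)] by simp
    fix x y assume x: "x \<in> A" and y: "y \<in> A"
    show "x * y \<in> A" using subringE(6)[OF assms(1) x y] by simp
    have "x + - y \<in> A" using subringE(7)[OF assms(1) x um[OF y]] by simp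
    then show "x - y \<in> A" by simp
  qed
qed

text \<open>Closure under negation comes from \<open>- x = (- 1) * x\<close> with
  \<open>- 1 \<in> A\<close>. This is the bridge from the additive subgroups of HOL-Algebra to
  type-class arithmetic; concrete ideals below are verified through it.\<close>

lemma ideal_ring_on_iff:
  assumes "subring_set A"
  shows "ideal J (ring_on A) \<longleftrightarrow>
    J \<subseteq> A \<and> 0 \<in> J \<and> (\<forall>x\<in>J. \<forall>y\<in>J. x + y \<in> J) \<and> (\<forall>a\<in>A. \<forall>x\<in>J. a * x \<in> J)"
proof
  interpret subring_set A by fact
  interpret R: cring "ring_on A" by (rule cring_ring_on[OF assms])
  {
    assume "ideal J (ring_on A)"
    then interpret J: ideal J "ring_on A" .
    show "J \<subseteq> A \<and> 0 \<in> J \<and> (\<forall>x\<in>J. \<forall>y\<in>J. x + y \<in> J) \<and> (\<forall>a\<in>A. \<forall>x\<in>J. a * x \<in> J)"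
      using J.a_subset additive_subgroup.zero_closed[OF J.is_additive_subgroup]
        additive_subgroup.a_closed[OF J.is_additive_subgroup] J.I_l_closed by auto
  next
    assume J: "J \<subseteq> A \<and> 0 \<in> J \<and> (\<forall>x\<in>J. \<forall>y\<in>J. x + y \<in> J) \<and> (\<forall>a\<in>A. \<forall>x\<in>J. a * x \<in> J)"
    have um: "- x \<in> J" if "x \<in> J" for x
    proof -
      have "(- 1) * x \<in> J" using J that uminus_mem[OF one_mem] by blast
      then show ?thesis by simp
    qed
    have inv: "\<ominus>\<^bsub>ring_on A\<^esub> x = - x" if "x \<in> J" for x
      using R.minus_equality[of "- x" x] J um that by auto
    show "ideal J (ring_on A)"
    proof (rule idealI)
      show "subgroup J (add_monoid (ring_on A))"
        by (rule R.add.subgroupI) (use J um inv in \<open>auto simp: a_inv_def[symmetric]\<close>)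
      fix a x assume "a \<in> J" "x \<in> carrier (ring_on A)"
      then show "x \<otimes>\<^bsub>ring_on A\<^esub> a \<in> J" "a \<otimes>\<^bsub>ring_on A\<^esub> x \<in> J"
        using J by (auto simp: mult.commute[of a x])
    qed (rule R.ring_axioms)
  }
qed

lemma idealD_ring_on:
  assumes "ideal J (ring_on A)"
  shows "x \<in> J \<Longrightarrow> x \<in> A" "0 \<in> J" "x \<in> J \<Longrightarrow> y \<in> J \<Longrightarrow> x + y \<in> J"
    "a \<in> A \<Longrightarrow> x \<in> J \<Longrightarrow> a * x \<in> J"
proof -
  interpret J: ideal J "ring_on A" by fact
  show "x \<in> J \<Longrightarrow> x \<in> A" "0 \<in> J" "x \<in> J \<Longrightarrow> y \<in> J \<Longrightarrow> x + y \<in> J"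
    "a \<in> A \<Longrightarrow> x \<in> J \<Longrightarrow> a * x \<in> J"
    using J.a_subset additive_subgroup.zero_closed[OF J.is_additive_subgroup]
        additive_subgroup.a_closed[OF J.is_additive_subgroup] J.I_l_closed by auto
qed

lemma primeideal_ring_on_iff:
  assumes "subring_set A"
  shows "primeideal p (ring_on A) \<longleftrightarrow>
    ideal p (ring_on A) \<and> 1 \<notin> p \<and> (\<forall>x\<in>A. \<forall>y\<in>A. x * y \<in> p \<longrightarrow> x \<in> p \<or> y \<in> p)"
proof
  interpret subring_set A by fact
  interpret R: cring "ring_on A" by (rule cring_ring_on[OF assms])
  {
    assume "primeideal p (ring_on A)"
    then interpret p: primeideal p "ring_on A" .
    have "1 \<notin> p"
    proof
      assume "1 \<in> p"
      then have "A \<subseteq> p" using p.I_l_closed[of 1] by auto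
      then show False using p.a_subset p.I_notcarr by auto
    qed
    then show "ideal p (ring_on A) \<and> 1 \<notin> p \<and> (\<forall>x\<in>A. \<forall>y\<in>A. x * y \<in> p \<longrightarrow> x \<in> p \<or> y \<in> p)"
      using p.I_prime p.is_ideal by auto
  next
    assume p: "ideal p (ring_on A) \<and> 1 \<notin> p \<and> (\<forall>x\<in>A. \<forall>y\<in>A. x * y \<in> p \<longrightarrow> x \<in> p \<or> y \<in> p)"
    show "primeideal p (ring_on A)"
      by (rule primeidealI) (use p R.cring_axioms one_mem in auto)
  }
qed

lemma primeideal_subring_set:
  assumes "primeideal p (ring_on A)" shows "subring_set A"
proof -
  interpret p: primeideal p "ring_on A" by fact
  show ?thesis by (rule subring_set_of_cring[OF p.is_cring])
qed

lemma primeidealD_ring_on: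
  assumes "primeideal p (ring_on A)"
  shows "ideal p (ring_on A)" "1 \<notin> p" "x \<in> A \<Longrightarrow> y \<in> A \<Longrightarrow> x * y \<in> p \<Longrightarrow> x \<in> p \<or> y \<in> p"
    "x \<in> A \<Longrightarrow> x ^ n \<in> p \<Longrightarrow> x \<in> p"
proof -
  have A: "subring_set A" by (rule primeideal_subring_set[OF assms])
  interpret subring_set A by fact
  show "ideal p (ring_on A)" "1 \<notin> p" and P: "\<And>x y. x \<in> A \<Longrightarrow> y \<in> A \<Longrightarrow> x * y \<in> p \<Longrightarrow> x \<in> p \<or> y \<in> p"
    using assms unfolding primeideal_ring_on_iff[OF A] by auto
  show "x \<in> p" if "x \<in> A" "x ^ n \<in> p"
    using that(2) by (induction n) (use \<open>1 \<notin> p\<close> P that(1) power_mem in auto)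
qed

lemma cgenideal_ring_on: "cgenideal (ring_on A) a = {x * a | x. x \<in> A}"
  by (simp add: cgenideal_def)

lemma subring_set_ring_gen: "subring_set (ring_gen S)"
proof
  fix x y :: 'a assume "x \<in> ring_gen S" "y \<in> ring_gen S"
  then have "x + (- y) \<in> ring_gen S" "x * y \<in> ring_gen S"
    using generate_ring.eng_add[of x ring_of_type_algebra S "- y"] generate_ring.a_inv[of y ring_of_type_algebra S]
      generate_ring.eng_mult[of x ring_of_type_algebra S y] by auto
  then show "x - y \<in> ring_gen S" "x * y \<in> ring_gen S" by auto
qed (use generate_ring.one[of ring_of_type_algebra S] in simp)

lemma ring_gen_incl: "x \<in> S \<Longrightarrow> x \<in> ring_gen S"
  by (rule generate_ring.incl)

lemma ring_gen_least:
  assumes "subring_set A" "S \<subseteq> A" shows "ring_gen S \<subseteq> A"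
proof
  interpret subring_set A by fact
  fix x assume "x \<in> ring_gen S"
  then show "x \<in> A"
    by induction (use assms(2) in \<open>auto intro: mems\<close>)
qed

lemma ring_gen_mono: "S \<subseteq> S' \<Longrightarrow> ring_gen S \<subseteq> ring_gen S'"
  by (rule ring_gen_least[OF subring_set_ring_gen]) (auto intro: ring_gen_incl)

text \<open>The memberships in the inductive cases serve predicates about a map that is additive and
  multiplicative on part of the ambient ring only, as in \<open>psi_A\<close>.\<close>

lemma ring_gen_induct [consumes 1, case_names one incl uminus add mult]:
  assumes "x \<in> ring_gen S" "P 1" "\<And>x. x \<in> S \<Longrightarrow> P x" "\<And>x. x \<in> ring_gen S \<Longrightarrow> P x \<Longrightarrow> P (- x)"
    "\<And>x y. x \<in> ring_gen S \<Longrightarrow> y \<in> ring_gen S \<Longrightarrow> P x \<Longrightarrow> P y \<Longrightarrow> P (x + y)"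
    "\<And>x y. x \<in> ring_gen S \<Longrightarrow> y \<in> ring_gen S \<Longrightarrow> P x \<Longrightarrow> P y \<Longrightarrow> P (x * y)"
  shows "P x"
  using assms(1) by (induction rule: generate_ring.induct) (use assms in auto)

section \<open>Integral elements\<close>

text \<open>In this form an integral equation can be multiplied, substituted into and cancelled
  without polynomial arithmetic. The case n = 0 would read 1 = 0, so it never arises.\<close>

lemma integral_over_iff:
  assumes "subring_set A"
  shows "integral_over A x \<longleftrightarrow> (\<exists>n c. (\<forall>i<n. c i \<in> A) \<and> x ^ n = (\<Sum>i<n. c i * x ^ i))"
proof
  interpret subring_set A by fact
  assume "integral_over A x"
  then obtain f where f: "Polynomial.lead_coeff f = 1" "\<forall>i. Polynomial.coeff f i \<in> A" "poly f x = 0"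
    unfolding integral_over_def by blast
  let ?n = "Polynomial.degree f"
  have "0 = (\<Sum>i\<le>?n. Polynomial.coeff f i * x ^ i)" using f(3) by (simp add: poly_altdef)
  also have "\<dots> = x ^ ?n + (\<Sum>i<?n. Polynomial.coeff f i * x ^ i)"
    using f(1) by (simp add: lessThan_Suc_atMost[symmetric] add.commute)
  finally have "x ^ ?n = (\<Sum>i<?n. - Polynomial.coeff f i * x ^ i)"
    by (simp add: sum_negf eq_neg_iff_add_eq_0)
  then show "\<exists>n c. (\<forall>i<n. c i \<in> A) \<and> x ^ n = (\<Sum>i<n. c i * x ^ i)"
    using f(2) uminus_mem by (intro exI[of _ ?n] exI[of _ "\<lambda>i. - Polynomial.coeff f i"]) auto
next
  interpret subring_set A by fact
  assume "\<exists>n c. (\<forall>i<n. c i \<in> A) \<and> x ^ n = (\<Sum>i<n. c i * x ^ i)"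
  then obtain n c where c: "\<forall>i<n. c i \<in> A" "x ^ n = (\<Sum>i<n. c i * x ^ i)" by blast
  define g where "g = (\<Sum>i<n. Polynomial.monom (c i) i)"
  have cg: "Polynomial.coeff g j = (if j < n then c j else 0)" for j
    by (simp add: g_def Polynomial.coeff_sum)
  define f where "f = Polynomial.monom 1 n - g"
  have cf: "Polynomial.coeff f j = (if j = n then 1 else 0) - (if j < n then c j else 0)" for j
    by (simp add: f_def cg)
  have "Polynomial.degree f = n"
    by (rule antisym[OF Polynomial.degree_le Polynomial.le_degree]) (auto simp: cf)
  then have "Polynomial.lead_coeff f = 1" by (simp add: cf)
  moreover have "\<forall>j. Polynomial.coeff f j \<in> A" using c(1) by (auto simp: cf intro: mems)
  moreover have "poly f x = 0" by (simp add: f_def g_def poly_sum poly_monom c(2))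
  ultimately show "integral_over A x" unfolding integral_over_def by blast
qed

lemma integral_over_mono: "A \<subseteq> B \<Longrightarrow> integral_over A x \<Longrightarrow> integral_over B x"
  unfolding integral_over_def by blast

lemma integral_over_mem:
  assumes "subring_set A" "x \<in> A" shows "integral_over A x"
  unfolding integral_over_iff[OF assms(1)]
  by (rule exI[of _ 1], rule exI[of _ "\<lambda>_. x"]) (simp add: assms(2))

text \<open>An equation for \<open>x ^ m\<close> is an equation for x whose coefficients sit at the
  multiples of m; \<open>d\<close> pads with zeros in between.\<close>

lemma integral_over_of_power:
  assumes "subring_set A" "integral_over A (x ^ m)" "m > 0" shows "integral_over A x"
proof -
  interpret subring_set A by fact
  obtain n c where c: "\<forall>i<n. c i \<in> A" "(x ^ m) ^ n = (\<Sum>i<n. c i * (x ^ m) ^ i)"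
    using assms(2) unfolding integral_over_iff[OF assms(1)] by blast
  define d where "d j = (if m dvd j then c (j div m) else 0)" for j
  have "x ^ (m * n) = (\<Sum>i<n. c i * (x ^ m) ^ i)" by (simp add: c(2) power_mult)
  also have "\<dots> = (\<Sum>j\<in>(\<lambda>i. m * i) ` {..<n}. d j * x ^ j)"
    using assms(3) by (subst sum.reindex) (auto simp: inj_on_def d_def power_mult)
  also have "\<dots> = (\<Sum>j<m * n. d j * x ^ j)"
    using assms(3) by (intro sum.mono_neutral_left) (auto simp: d_def elim!: dvdE)
  finally show ?thesis
    unfolding integral_over_iff[OF assms(1)]
    by (intro exI[of _ "m * n"] exI[of _ d]) (use c(1) assms(3) zero_mem in \<open>auto simp: d_def elim!: dvdE\<close>)
qed

text \<open>The equation is \<open>x ^ n = 0\<close> itself. It puts all nilpotents of the total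
  quotient ring into \<open>C'\<close>, which is how rings that are not reduced are dealt
  with.\<close>

lemma integral_over_of_nilpotent:
  assumes "subring_set A" "x ^ n = 0" shows "integral_over A x"
proof -
  interpret subring_set A by fact
  show ?thesis
    unfolding integral_over_iff[OF assms(1)]
    by (intro exI[of _ n] exI[of _ "\<lambda>_. 0"]) (simp add: assms(2) zero_mem)
qed

section \<open>Discrete valuations\<close>

locale subfield_set = subring_set F for F :: "'l::field set" +
  assumes inverse_mem: "x \<in> F \<Longrightarrow> inverse x \<in> F"
begin

lemma divide_mem: "x \<in> F \<Longrightarrow> y \<in> F \<Longrightarrow> x / y \<in> F"
  by (simp add: divide_inverse mult_mem inverse_mem)

lemma powi_mem: "x \<in> F \<Longrightarrow> x powi n \<in> F"
  by (auto simp: power_int_def intro: power_mem inverse_mem)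

lemma subfield: "subfield F (ring_of_type_algebra :: 'l ring)"
proof -
  interpret R: Ring.field "ring_of_type_algebra :: 'l ring" by (rule field_from_type_algebra)
  have "subring F (ring_on UNIV)"
    by (rule subring_ring_on) (unfold_locales, auto)
  moreover have "ring_on UNIV = (ring_of_type_algebra :: 'l ring)"
    by (simp add: ring_of_type_algebra_def)
  ultimately have "subring F (ring_of_type_algebra :: 'l ring)" by simp
  then show ?thesis
  proof (rule R.subfieldI'[OF _ ])
    fix k assume k: "k \<in> F - {\<zero>\<^bsub>ring_of_type_algebra\<^esub>}"
    then have "inv\<^bsub>ring_of_type_algebra\<^esub> k = inverse k"
      by (intro R.inv_char) auto
    then show "inv\<^bsub>ring_of_type_algebra\<^esub> k \<in> F" using k inverse_mem by auto
  qed
qed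

end

section \<open>Total quotient rings inside a field\<close>

lemma regular_in_field: "subring_set (A::'l::field set) \<Longrightarrow> regular_in A b \<longleftrightarrow> b \<in> A \<and> b \<noteq> 0"
  unfolding regular_in_def using subring_set.one_mem[of A] by fastforce

lemma tot_quot_eq_fractions:
  assumes "subring_set (A::'l::field set)"
  shows "tot_quot A = {a / b | a b. a \<in> A \<and> b \<in> A \<and> b \<noteq> 0}"
proof -
  have "x * b = a \<longleftrightarrow> x = a / b" if "b \<noteq> 0" for x a b :: 'l using that by (auto simp: field_simps)
  then show ?thesis unfolding tot_quot_def regular_in_field[OF assms] by blast
qed

lemma subfield_set_tot_quot:
  assumes "subring_set (A::'l::field set)"
  shows "subfield_set (tot_quot A)"
proof -
  interpret subring_set A by fact
  note eq = tot_quot_eq_fractions[OF assms]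
  show ?thesis
  proof
    show "1 \<in> tot_quot A" unfolding eq using one_mem by (auto intro!: exI[of _ 1])
    show "x - y \<in> tot_quot A" "x * y \<in> tot_quot A" if xy: "x \<in> tot_quot A" "y \<in> tot_quot A" for x y
    proof -
      obtain a b c d where *: "x = a / b" "y = c / d" "a \<in> A" "b \<in> A" "c \<in> A" "d \<in> A" "b \<noteq> 0" "d \<noteq> 0"
        using xy unfolding eq by blast
      have "x - y = (a * d - c * b) / (b * d)" "x * y = (a * c) / (b * d)"
        using * by (simp_all add: field_simps)
      moreover have "a * d - c * b \<in> A" "a * c \<in> A" "b * d \<in> A" "b * d \<noteq> 0"
        using * by (auto intro: mems)
      ultimately show "x - y \<in> tot_quot A" "x * y \<in> tot_quot A" unfolding eq by blast+
    qed
    show "inverse x \<in> tot_quot A" if x: "x \<in> tot_quot A" for x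
    proof -
      obtain a b where *: "x = a / b" "a \<in> A" "b \<in> A" "b \<noteq> 0" using x unfolding eq by blast
      show ?thesis
      proof (cases "a = 0")
        case True
        then have "inverse x = 0 / 1" "(0::'l) \<in> A" "(1::'l) \<in> A" "(1::'l) \<noteq> 0"
          using * zero_mem one_mem by auto
        then show ?thesis unfolding eq by blast
      next
        case False
        then show ?thesis unfolding eq using * by auto
      qed
    qed
  qed
qed

lemma tot_quot_incl:
  assumes "subring_set (A::'l::field set)" shows "A \<subseteq> tot_quot A"
proof
  fix x assume "x \<in> A"
  then have "x = x / 1" "x \<in> A" "(1::'l) \<in> A" "(1::'l) \<noteq> 0" using subring_set.one_mem[OF assms] by auto
  then show "x \<in> tot_quot A" unfolding tot_quot_eq_fractions[OF assms] by blast
qed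

lemma tot_quot_least:
  assumes "subring_set (A::'l::field set)" "subfield_set F" "A \<subseteq> F" shows "tot_quot A \<subseteq> F"
  unfolding tot_quot_eq_fractions[OF assms(1)] using subfield_set.divide_mem[OF assms(2)] assms(3) by blast

lemma tot_quot_mono:
  assumes "subring_set (A::'l::field set)" "subring_set B" "A \<subseteq> B" shows "tot_quot A \<subseteq> tot_quot B"
  using tot_quot_least[OF assms(1) subfield_set_tot_quot[OF assms(2)]] tot_quot_incl[OF assms(2)] assms(3) by blast

section \<open>Valued fields with integer values\<close>

locale valued_field = subfield_set F for F :: "'l::field set" +
  fixes v :: "'l \<Rightarrow> int"
  assumes v_mult: "x \<in> F \<Longrightarrow> y \<in> F \<Longrightarrow> x \<noteq> 0 \<Longrightarrow> y \<noteq> 0 \<Longrightarrow> v (x * y) = v x + v y"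
    and v_add: "x \<in> F \<Longrightarrow> y \<in> F \<Longrightarrow> x \<noteq> 0 \<Longrightarrow> y \<noteq> 0 \<Longrightarrow> x + y \<noteq> 0 \<Longrightarrow> min (v x) (v y) \<le> v (x + y)"
begin

text \<open>The fractional ideal of elements of value at least m; \<open>level 0\<close> is the
  valuation ring. Values stay in \<open>int\<close>, with \<open>v 0\<close> arbitrary, so zero is
  put in by hand here and excluded in the laws of the locale.\<close>

definition level :: "int \<Rightarrow> 'l set" where
  "level m = {x \<in> F. x = 0 \<or> m \<le> v x}"

lemma v_one: "v 1 = 0"
  using v_mult[of 1 1] one_mem by simp

lemma v_minus_one: "v (- 1) = 0"
  using v_mult[of "- 1" "- 1"] v_one one_mem uminus_mem by simp

lemma v_uminus: "x \<in> F \<Longrightarrow> v (- x) = v x"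
  using v_mult[of "- 1" x] v_minus_one one_mem uminus_mem by (cases "x = 0") auto

lemma v_inverse: "x \<in> F \<Longrightarrow> x \<noteq> 0 \<Longrightarrow> v (inverse x) = - v x"
  using v_mult[of x "inverse x"] v_one inverse_mem by simp

lemma v_divide: "x \<in> F \<Longrightarrow> y \<in> F \<Longrightarrow> x \<noteq> 0 \<Longrightarrow> y \<noteq> 0 \<Longrightarrow> v (x / y) = v x - v y"
  using v_mult[of x "inverse y"] v_inverse inverse_mem by (simp add: divide_inverse)

lemma v_power: "x \<in> F \<Longrightarrow> x \<noteq> 0 \<Longrightarrow> v (x ^ n) = int n * v x"
  by (induction n) (simp_all add: v_one v_mult power_mem algebra_simps)

lemma v_powi: "x \<in> F \<Longrightarrow> x \<noteq> 0 \<Longrightarrow> v (x powi n) = n * v x"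
  by (cases "n \<ge> 0") (simp_all add: power_int_def v_power v_inverse inverse_mem)

lemma levelI: "x \<in> F \<Longrightarrow> (x \<noteq> 0 \<Longrightarrow> m \<le> v x) \<Longrightarrow> x \<in> level m"
  by (auto simp: level_def)

lemma level_mem: "x \<in> level m \<Longrightarrow> x \<in> F"
  by (simp add: level_def)

lemma level_v: "x \<in> level m \<Longrightarrow> x \<noteq> 0 \<Longrightarrow> m \<le> v x"
  by (simp add: level_def)

lemma zero_level: "0 \<in> level m"
  by (simp add: level_def zero_mem)

lemma level_antimono: "m \<le> n \<Longrightarrow> level n \<subseteq> level m"
  by (auto simp: level_def)

lemma level_add: "x \<in> level m \<Longrightarrow> y \<in> level m \<Longrightarrow> x + y \<in> level m"
  using v_add[of x y] by (cases "x = 0 \<or> y = 0 \<or> x + y = 0") (auto simp: level_def add_mem zero_mem)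

lemma level_uminus: "x \<in> level m \<Longrightarrow> - x \<in> level m"
  by (auto simp: level_def v_uminus uminus_mem)

lemma level_diff: "x \<in> level m \<Longrightarrow> y \<in> level m \<Longrightarrow> x - y \<in> level m"
  using level_add[OF _ level_uminus] by force

lemma level_mult: "x \<in> level m \<Longrightarrow> y \<in> level n \<Longrightarrow> x * y \<in> level (m + n)"
  by (cases "x = 0 \<or> y = 0") (auto simp: level_def v_mult mult_mem zero_mem)

lemma level_power: "x \<in> level m \<Longrightarrow> x ^ n \<in> level (int n * m)"
  by (cases "x = 0"; cases "n = 0")
    (auto simp: level_def v_power v_one power_mem zero_mem one_mem mult_left_mono)

lemma level_sum: "(\<And>i. i \<in> S \<Longrightarrow> f i \<in> level m) \<Longrightarrow> sum f S \<in> level m"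
  by (induction S rule: infinite_finite_induct) (auto intro: zero_level level_add)

lemma level_all: "(\<And>m. x \<in> level m) \<Longrightarrow> x = 0"
  using level_v[of x "v x + 1"] by force

lemma level_scale: "a \<in> F \<Longrightarrow> a \<noteq> 0 \<Longrightarrow> a * x \<in> level m \<longleftrightarrow> x \<in> level (m - v a)"
proof
  assume a: "a \<in> F" "a \<noteq> 0"
  { assume "a * x \<in> level m"
    then have "inverse a * (a * x) \<in> level (- v a + m)"
      using a by (intro level_mult[OF levelI]) (auto simp: v_inverse inverse_mem)
    then show "x \<in> level (m - v a)" using a by (simp add: mult.assoc[symmetric]) }
  { assume "x \<in> level (m - v a)"
    then have "a * x \<in> level (v a + (m - v a))" using a by (intro level_mult[OF levelI]) auto
    then show "a * x \<in> level m" by simp }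
qed

text \<open>If the sum vanished or had a larger value, then x, the difference of the sum and y,
  would lie in \<open>level (v x + 1)\<close>.\<close>

lemma v_add_strict:
  assumes "x \<in> F" "x \<noteq> 0" "y \<in> level (v x + 1)"
  shows "x + y \<noteq> 0" "v (x + y) = v x"
proof -
  show nz: "x + y \<noteq> 0"
  proof
    assume "x + y = 0"
    then have "x = - y" by (simp add: eq_neg_iff_add_eq_0)
    then have "x \<in> level (v x + 1)" using level_uminus[OF assms(3)] by simp
    then show False using assms(2) level_v by fastforce
  qed
  have xy: "x + y \<in> F" using assms level_mem add_mem by blast
  have "x + y \<in> level (v x)"
    using assms level_antimono[of "v x" "v x + 1"] by (intro level_add) (auto intro: levelI)
  then have "v x \<le> v (x + y)" using nz level_v by blast
  moreover have "v (x + y) \<le> v x"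
  proof (rule ccontr)
    assume "\<not> ?thesis"
    then have "x + y \<in> level (v x + 1)" using xy by (intro levelI) auto
    then have "x + y - y \<in> level (v x + 1)" using assms(3) level_diff by blast
    then show False using assms(2) level_v by fastforce
  qed
  ultimately show "v (x + y) = v x" by simp
qed

lemma subring_level: "subring_set (level 0)"
proof
  show "1 \<in> level 0" by (rule levelI) (auto simp: one_mem v_one)
  show "x * y \<in> level 0" if "x \<in> level 0" "y \<in> level 0" for x y
    using level_mult[OF that] by simp
qed (rule level_diff)

sublocale O: subring_set "level 0"
  by (rule subring_level)

lemma level0_or_inverse: "x \<in> F \<Longrightarrow> x \<in> level 0 \<or> inverse x \<in> level 0"
  by (cases "x = 0") (auto simp: level_def v_inverse inverse_mem)

lemma tot_quot_level: "tot_quot (level 0) = F"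
proof -
  have "x \<in> tot_quot (level 0)" if "x \<in> F" for x
    using level0_or_inverse[OF that]
  proof
    assume "x \<in> level 0"
    then show ?thesis using tot_quot_incl[OF subring_level] by auto
  next
    assume "inverse x \<in> level 0"
    then have "inverse (inverse x) \<in> tot_quot (level 0)"
      using tot_quot_incl[OF subring_level] subfield_set.inverse_mem[OF subfield_set_tot_quot[OF subring_level]] by blast
    then show ?thesis by simp
  qed
  moreover have "tot_quot (level 0) \<subseteq> F"
    by (rule tot_quot_least[OF subring_level subfield_set_axioms]) (auto simp: level_def)
  ultimately show ?thesis by blast
qed

end

section \<open>Discrete valuations and the ideals of their rings\<close>

locale disc_val = valued_field F v for F :: "'l::field set" and v :: "'l \<Rightarrow> int" +
  fixes \<pi> :: 'l
  assumes unif_mem: "\<pi> \<in> F" and unif_nz: "\<pi> \<noteq> 0" and v_unif: "v \<pi> = 1"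
begin

lemma v_unif_powi: "v (\<pi> powi n) = n"
  by (simp add: v_powi unif_mem unif_nz v_unif)

lemma ideal_level: "m \<ge> 0 \<Longrightarrow> ideal (level m) (ring_on (level 0))"
  unfolding ideal_ring_on_iff[OF subring_level]
  using level_antimono[of 0 m] level_mult[of _ 0 _ m] by (auto intro: zero_level level_add)

lemma level_subset_ideal:
  assumes "ideal J (ring_on (level 0))" "a \<in> J" "a \<noteq> 0" shows "level (v a) \<subseteq> J"
proof
  fix x assume x: "x \<in> level (v a)"
  have a: "a \<in> level 0" using idealD_ring_on(1)[OF assms(1,2)] .
  have "inverse a * x \<in> level (- v a + v a)"
    using x a assms(3) by (intro level_mult[OF levelI]) (auto simp: v_inverse inverse_mem level_mem)
  then have "(inverse a * x) * a \<in> J" using idealD_ring_on(4)[OF assms(1) _ assms(2)] by simp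
  moreover have "(inverse a * x) * a = x" using assms(3) by (simp add: field_simps)
  ultimately show "x \<in> J" by simp
qed

text \<open>One element of least value generates everything, so S may be any set attaining its
  bound: the image of I, the ideal N inside W, or the maximal ideal of a smaller ring.\<close>

lemma level_eq_genideal:
  assumes "a \<in> S" "a \<noteq> 0" "v a = m" "S \<subseteq> level m" "m \<ge> 0"
  shows "genideal (ring_on (level 0)) S = level m"
proof
  interpret R: cring "ring_on (level 0)" by (rule cring_ring_on[OF subring_level])
  have S: "S \<subseteq> carrier (ring_on (level 0))" using assms(4,5) level_antimono by fastforce
  show "genideal (ring_on (level 0)) S \<subseteq> level m"
    by (rule R.genideal_minimal) (use assms ideal_level in auto)
  have "a \<in> genideal (ring_on (level 0)) S" using R.genideal_self[OF S] assms(1) by blast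
  then show "level m \<subseteq> genideal (ring_on (level 0)) S"
    using level_subset_ideal[OF R.genideal_ideal[OF S] _ assms(2)] assms(3) by simp
qed

lemma level_eq_cgenideal:
  assumes "a \<in> level 0" "a \<noteq> 0"
  shows "cgenideal (ring_on (level 0)) a = level (v a)"
proof -
  interpret R: cring "ring_on (level 0)" by (rule cring_ring_on[OF subring_level])
  show ?thesis
    using R.cgenideal_eq_genideal[of a] level_eq_genideal[of a "{a}" "v a"] assms level_v[of a 0]
    by (simp add: levelI level_mem)
qed

lemma ideal_eq_level:
  assumes "ideal J (ring_on (level 0))" "J \<noteq> {0}"
  obtains a where "a \<in> J" "a \<noteq> 0" "J = level (v a)"
proof -
  have "\<exists>a. a \<in> J \<and> a \<noteq> 0" using assms idealD_ring_on(2)[OF assms(1)] by auto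
  \<comment> \<open>Values on \<open>level 0\<close> are nonnegative, so minimizing
    \<open>nat (v a)\<close> minimizes \<open>v a\<close>.\<close>
  then obtain a where a: "a \<in> J \<and> a \<noteq> 0" and min: "\<And>y. y \<in> J \<and> y \<noteq> 0 \<Longrightarrow> nat (v a) \<le> nat (v y)"
    using ex_has_least_nat[of "\<lambda>a. a \<in> J \<and> a \<noteq> 0" _ "\<lambda>a. nat (v a)"] by blast
  have "y \<in> level (v a)" if "y \<in> J" for y
    using min[of y] that a level_v[OF idealD_ring_on(1)[OF assms(1)]] level_mem[OF idealD_ring_on(1)[OF assms(1) that]]
    by (intro levelI) fastforce+
  then have "J = level (v a)" using level_subset_ideal[OF assms(1)] a by blast
  then show thesis using that a by blast
qed

lemma level_eq_iff: "level m \<subseteq> level n \<longleftrightarrow> n \<le> m"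
proof
  assume "level m \<subseteq> level n"
  moreover have "\<pi> powi m \<in> level m" by (rule levelI) (auto simp: v_unif_powi powi_mem unif_mem)
  ultimately have "\<pi> powi m \<in> level n" by blast
  then show "n \<le> m" using level_v unif_nz v_unif_powi by (metis power_int_eq_0_iff)
qed (rule level_antimono)

lemma principal_domain_level: "principal_domain (ring_on (level 0))"
proof -
  interpret domain "ring_on (level 0)" by (rule domain_ring_on[OF subring_level])
  show ?thesis
  proof
    fix J assume J: "ideal J (ring_on (level 0))"
    show "\<exists>a\<in>carrier (ring_on (level 0)). J = cgenideal (ring_on (level 0)) a"
    proof (cases "J = {0}")
      case True
      have "cgenideal (ring_on (level 0)) 0 = {0}"
        using zero_level by (auto simp: cgenideal_ring_on)
      then show ?thesis using True zero_level by auto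
    next
      case False
      then obtain a where "a \<in> J" "a \<noteq> 0" "J = level (v a)" using ideal_eq_level[OF J] by blast
      then show ?thesis using level_eq_cgenideal idealD_ring_on(1)[OF J] by auto
    qed
  qed
qed

text \<open>Nonzero ideals are levels, and no level lies strictly between \<open>level 1\<close> and
  \<open>level 0\<close>. The equivalence contains the uniqueness demanded by
  \<open>dvr\<close>.\<close>

lemma maximalideal_level_iff: "maximalideal N (ring_on (level 0)) \<longleftrightarrow> N = level 1"
proof
  have max: "J = level 1 \<or> J = level 0" if J: "ideal J (ring_on (level 0))" "level 1 \<subseteq> J" for J
  proof -
    have "\<pi> \<in> level 1" by (rule levelI) (auto simp: unif_mem v_unif)
    then have "J \<noteq> {0}" using J unif_nz by auto
    then obtain a where a: "a \<in> J" "a \<noteq> 0" "J = level (v a)" using ideal_eq_level[OF J(1)] by blast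
    moreover have "v a \<le> 1" using J(2) a(3) level_eq_iff by simp
    moreover have "0 \<le> v a" using idealD_ring_on(1)[OF J(1) a(1)] a(2) level_v by blast
    ultimately have "v a = 0 \<or> v a = 1" by linarith
    then show ?thesis using a(3) by metis
  qed
  have ne: "level 0 \<noteq> level 1" using level_eq_iff[of 0 1] by auto
  show "maximalideal N (ring_on (level 0))" if "N = level 1"
    unfolding that by (rule maximalidealI) (use ideal_level max ne in auto)
  assume "maximalideal N (ring_on (level 0))"
  then interpret N: maximalideal N "ring_on (level 0)" .
  have "N \<subseteq> level 1"
  proof (cases "N = {0}")
    case False
    then obtain a where a: "a \<in> N" "a \<noteq> 0" "N = level (v a)" using ideal_eq_level[OF N.is_ideal] by blast
    have "v a \<noteq> 0" using N.I_notcarr a(3) by auto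
    moreover have "0 \<le> v a" using idealD_ring_on(1)[OF N.is_ideal a(1)] a(2) level_v by blast
    ultimately show ?thesis using a(3) level_eq_iff by simp
  qed (simp add: zero_level)
  then show "N = level 1" using N.I_maximal[OF ideal_level[of 1]] ne level_antimono[of 0 1] by auto
qed

lemma dvr_level: "dvr (level 0) (level 1)"
proof -
  have "\<pi> \<in> level 1" by (rule levelI) (auto simp: unif_mem v_unif)
  then have "level 1 \<noteq> {0}" using unif_nz by auto
  then show ?thesis
    unfolding dvr_def maximalideal_level_iff using principal_domain_level by simp
qed

lemma level_ideal_pow: "level 1 [^]\<^bsub>ideals_set (ring_on (level 0))\<^esub> (n::nat) = level (int n)"
proof (induction n)
  case 0
  show ?case by (simp add: ideals_set_def nat_pow_def)
next
  case (Suc n)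
  interpret R: cring "ring_on (level 0)" by (rule cring_ring_on[OF subring_level])
  have "ideal_prod (ring_on (level 0)) (level (int n)) (level 1) = level (int n + 1)" (is "?P = _")
  proof
    show "?P \<subseteq> level (int n + 1)"
    proof
      fix x assume "x \<in> ?P"
      then show "x \<in> level (int n + 1)"
        by induction (auto intro: level_mult level_add)
    qed
    have id: "ideal ?P (ring_on (level 0))"
      by (rule R.ideal_prod_is_ideal) (auto intro: ideal_level)
    have pi1: "\<pi> \<in> level 1" by (rule levelI) (auto simp: unif_mem v_unif)
    then have "\<pi> ^ n \<in> level (int n)" using level_power[of \<pi> 1 n] by simp
    then have "\<pi> ^ n * \<pi> \<in> ?P"
      using pi1 ideal_prod.prod[of "\<pi> ^ n" "level (int n)" \<pi> "level 1" "ring_on (level 0)"] by simp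
    moreover have "v (\<pi> ^ n * \<pi>) = int n + 1"
      by (simp add: v_mult v_power v_unif unif_mem unif_nz power_mem)
    ultimately show "level (int n + 1) \<subseteq> ?P"
      using level_subset_ideal[OF id] unif_nz by (metis mult_eq_0_iff power_eq_0_iff)
  qed
  then show ?case using Suc by (simp add: ideals_set_def nat_pow_def add.commute)
qed

text \<open>If x had negative value, \<open>x ^ n\<close> would have smaller value than every term
  \<open>c i * x ^ i\<close> with i < n, so the equation could not hold.\<close>

lemma integral_over_level:
  assumes "subring_set A" "integral_over A x" "A \<subseteq> level 0" "x \<in> F"
  shows "x \<in> level 0"
proof (rule levelI[OF assms(4)], rule ccontr)
  assume x: "x \<noteq> 0" "\<not> 0 \<le> v x"
  obtain n c where c: "\<forall>i<n. c i \<in> A" "x ^ n = (\<Sum>i<n. c i * x ^ i)"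
    using assms(2) unfolding integral_over_iff[OF assms(1)] by blast
  have "c i * x ^ i \<in> level (int n * v x + 1)" if "i < n" for i
  proof -
    have "int n * v x + 1 \<le> 0 + int i * v x"
    proof -
      have "(int n - int i) * v x \<le> (int n - int i) * (- 1)"
        using that x(2) by (intro mult_left_mono) auto
      then show ?thesis using that by (simp add: algebra_simps)
    qed
    moreover have "c i * x ^ i \<in> level (0 + int i * v x)"
      using c(1) that assms(3,4) by (intro level_mult level_power) (auto intro: levelI)
    ultimately show ?thesis using level_antimono by blast
  qed
  then have "x ^ n \<in> level (int n * v x + 1)" unfolding c(2) by (intro level_sum) auto
  then show False using level_v[of "x ^ n" "int n * v x + 1"] x assms(4) by (simp add: v_power)
qed

end

text \<open>\<open>dvr\<close> speaks of ideals only. The valuation is the exponent n in x = \<pi>^n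
  e with a unit e, where \<pi> generates N; that n exists and is unique is what has to be extracted
  from the principal ideals.\<close>

theorem dvr_disc_val:
  fixes V N :: "'l::field set"
  assumes "dvr V N"
  obtains v \<pi> where "disc_val (tot_quot V) v \<pi>" "V = valued_field.level (tot_quot V) v 0"
    "N = valued_field.level (tot_quot V) v 1"
proof -
  interpret R: principal_domain "ring_on V" using assms by (simp add: dvr_def)
  have sub: "subring_set V" by (rule subring_set_of_cring[OF R.is_cring])
  interpret V: subring_set V by fact
  interpret F: subfield_set "tot_quot V" by (rule subfield_set_tot_quot[OF sub])
  have N: "maximalideal N (ring_on V)" "N \<noteq> {0}" "\<And>N'. maximalideal N' (ring_on V) \<Longrightarrow> N' = N"
    using assms by (auto simp: dvr_def)
  interpret N: maximalideal N "ring_on V" by (rule N(1))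
  obtain \<pi> where pi: "\<pi> \<in> V" "N = cgenideal (ring_on V) \<pi>" using R.exists_gen[OF N.is_ideal] by auto
  have Npi: "N = {x * \<pi> | x. x \<in> V}" using pi cgenideal_ring_on by simp
  have pinz: "\<pi> \<noteq> 0" using N(2) Npi V.zero_mem by auto
  have one_N: "1 \<notin> N"
  proof
    assume "1 \<in> N"
    then have "V \<subseteq> N" using idealD_ring_on(4)[OF N.is_ideal, of _ 1] by auto
    then show False using N.I_notcarr N.a_subset by auto
  qed
  \<comment> \<open>A nonunit has an irreducible divisor, which generates a maximal ideal; the only
    one is N.\<close>
  have unit: "x \<in> N \<or> inverse x \<in> V" if x: "x \<in> V" "x \<noteq> 0" for x
  proof (cases "x \<in> Units (ring_on V)")
    case True
    then obtain y where y: "y \<in> V" "x * y = 1" by (auto simp: Units_def)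
    then have "inverse x = y" by (simp add: inverse_unique)
    then show ?thesis using y by simp
  next
    case False
    have "x \<in> carrier (ring_on V) - {\<zero>\<^bsub>ring_on V\<^esub>}" using x by simp
    from R.exists_irreducible_divisor[OF this False]
    obtain p where p: "p \<in> carrier (ring_on V)" "ring_irreducible\<^bsub>ring_on V\<^esub> p" "p divides\<^bsub>ring_on V\<^esub> x"
      by metis
    have "cgenideal (ring_on V) p = N" using N(3) R.irreducible_imp_maximalideal p by blast
    moreover obtain c where "c \<in> V" "x = p * c" using p(3) by (auto simp: factor_def)
    ultimately show ?thesis by (auto simp: cgenideal_ring_on mult.commute)
  qed
  have piV: "inverse \<pi> \<notin> V"
  proof
    assume "inverse \<pi> \<in> V"
    then have "inverse \<pi> * \<pi> \<in> N" unfolding Npi by blast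
    then show False using one_N pinz by simp
  qed
  define is_unit where "is_unit e \<longleftrightarrow> e \<in> V \<and> inverse e \<in> V \<and> e \<noteq> 0" for e
  have fac: "\<exists>n e. is_unit e \<and> x = \<pi> ^ n * e" if x: "x \<in> V" "x \<noteq> 0" for x
  proof (rule ccontr)
    assume no: "\<not> ?thesis"
    have step: "x / \<pi> ^ n \<in> V" for n
    proof (induction n)
      case 0
      show ?case using x by simp
    next
      case (Suc n)
      have "\<not> is_unit (x / \<pi> ^ n)"
        using no pinz by (metis nonzero_mult_div_cancel_left power_not_zero times_divide_eq_right)
      then have "inverse (x / \<pi> ^ n) \<notin> V" using Suc x pinz by (auto simp: is_unit_def)
      then have "x / \<pi> ^ n \<in> N" using unit[OF Suc] x pinz by auto
      then obtain y where "y \<in> V" "x / \<pi> ^ n = y * \<pi>" using Npi by blast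
      then show ?case using pinz by (simp add: field_simps)
    qed
    \<comment> \<open>With no factorization, x would be divisible by every power of \<pi>. The
      principal ideals generated by \<open>x / \<pi> ^ n\<close> ascend, and a generator of their
      union \<open>J\<close> lies at some stage n; comparing it with stage n + 1 gives
      \<open>inverse \<pi> \<in> V\<close>.\<close>
    define J where "J = {z * (x / \<pi> ^ n) | z n. z \<in> V}"
    have low: "\<exists>z'\<in>V. z * (x / \<pi> ^ n) = z' * (x / \<pi> ^ (n + m))" if "z \<in> V" for z n m
      using that pinz pi(1) by (intro bexI[of _ "z * \<pi> ^ m"]) (auto simp: power_add field_simps intro: V.mems)
    have "ideal J (ring_on V)"
      unfolding ideal_ring_on_iff[OF sub]
    proof (intro conjI ballI)
      show "J \<subseteq> V" using V.mult_mem[OF _ step] by (auto simp: J_def simp del: times_divide_eq_right)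
      show "0 \<in> J" using V.zero_mem by (force simp: J_def)
      fix y assume "y \<in> J"
      then obtain z n where z: "z \<in> V" "y = z * (x / \<pi> ^ n)" by (auto simp: J_def)
      { fix a assume "a \<in> V"
        then show "a * y \<in> J" using z V.mult_mem
          by (auto simp: J_def mult.assoc[symmetric] simp del: times_divide_eq_right intro!: exI[of _ "a * z"] exI[of _ n]) }
      { fix y' assume "y' \<in> J"
        then obtain z' m where z': "z' \<in> V" "y' = z' * (x / \<pi> ^ m)" by (auto simp: J_def)
        obtain a where a: "a \<in> V" "y = a * (x / \<pi> ^ (n + m))" using low[OF z(1)] z(2) by blast
        obtain a' where a': "a' \<in> V" "y' = a' * (x / \<pi> ^ (n + m))" using low[OF z'(1), of m n] z'(2) by (auto simp: add.commute)
        have "y + y' = (a + a') * (x / \<pi> ^ (n + m))" using a(2) a'(2) by (simp only: distrib_right)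
        then show "y + y' \<in> J" using a a' V.add_mem unfolding J_def by blast }
    qed
    from R.exists_gen[OF this] obtain g where "g \<in> V" "J = cgenideal (ring_on V) g" by auto
    then have g: "g \<in> V" "J = {w * g | w. w \<in> V}" by (simp_all add: cgenideal_ring_on)
    have "1 * g \<in> J" using g V.one_mem by blast
    then obtain z n where z: "z \<in> V" "g = z * (x / \<pi> ^ n)" by (auto simp: J_def)
    have "1 * (x / \<pi> ^ Suc n) \<in> J" using V.one_mem unfolding J_def by blast
    then obtain a where a: "a \<in> V" "x / \<pi> ^ Suc n = a * g" using g by auto
    have "inverse \<pi> = a * z" using a z x pinz by (simp add: field_simps)
    then show False using piV a z V.mult_mem by simp
  qed
  have unitD: "is_unit e \<Longrightarrow> e \<in> V" "is_unit e \<Longrightarrow> inverse e \<in> V" "is_unit e \<Longrightarrow> e \<noteq> 0" for e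
    by (auto simp: is_unit_def)
  have unit_mult: "is_unit (e * e')" "is_unit (inverse e)" if "is_unit e" "is_unit e'" for e e'
    using that by (auto simp: is_unit_def intro: V.mult_mem)
  have powV: "n \<ge> 0 \<Longrightarrow> \<pi> powi n \<in> V" for n using pi(1) by (auto simp: power_int_def intro: V.power_mem)
  \<comment> \<open>Uniqueness of the exponent: from a power of \<pi> that is a unit with nonzero
    exponent, \<open>inverse \<pi>\<close> is obtained as a product of elements of V.\<close>
  have unit_pow: "n = 0" if "is_unit (\<pi> powi n)" for n
  proof (rule ccontr)
    assume "n \<noteq> 0"
    then consider "n > 0" | "n < 0" by linarith
    then show False
    proof cases
      case 1
      have "inverse \<pi> = \<pi> powi (n - 1) * inverse (\<pi> powi n)" using pinz by (simp add: power_int_diff field_simps)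
      then show False using that powV[of "n - 1"] 1 piV V.mult_mem by (metis diff_ge_0_iff_ge int_one_le_iff_zero_less is_unit_def)
    next
      case 2
      have "inverse \<pi> = \<pi> powi (- n - 1) * \<pi> powi n" using pinz by (simp add: power_int_add[symmetric] power_int_minus)
      then show False using that powV[of "- n - 1"] 2 piV V.mult_mem by (metis diff_ge_0_iff_ge int_one_le_iff_zero_less is_unit_def neg_0_less_iff_less)
    qed
  qed
  have facF: "\<exists>n e. is_unit e \<and> x = \<pi> powi n * e" if x: "x \<in> tot_quot V" "x \<noteq> 0" for x
  proof -
    obtain a b where ab: "a \<in> V" "b \<in> V" "b \<noteq> 0" "x = a / b" using x unfolding tot_quot_eq_fractions[OF sub] by blast
    obtain n e where e: "is_unit e" "a = \<pi> ^ n * e" using fac[of a] ab x by auto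
    obtain m e' where e': "is_unit e'" "b = \<pi> ^ m * e'" using fac[of b] ab by auto
    have "x = \<pi> powi (int n - int m) * (e * inverse e')"
      using e e' ab pinz by (simp add: power_int_diff field_simps)
    then show ?thesis using unit_mult e e' by blast
  qed
  define v where "v x = (THE n. \<exists>e. is_unit e \<and> x = \<pi> powi n * e)" for x
  have v_eq: "v (\<pi> powi n * e) = n" if "is_unit e" for n e
    unfolding v_def
  proof (rule the_equality)
    show "\<exists>e'. is_unit e' \<and> \<pi> powi n * e = \<pi> powi n * e'" using that by blast
    fix m assume "\<exists>e'. is_unit e' \<and> \<pi> powi n * e = \<pi> powi m * e'"
    then obtain e' where e': "is_unit e'" "\<pi> powi n * e = \<pi> powi m * e'" by blast
    have "\<pi> powi (m - n) = e * inverse e'"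
      using e' that pinz unitD(3) by (simp add: power_int_diff field_simps)
    then have "is_unit (\<pi> powi (m - n))" using unit_mult that e'(1) by simp
    then show "m = n" using unit_pow by force
  qed
  have vV: "v x \<ge> 0 \<longleftrightarrow> x \<in> V" if x: "x \<in> tot_quot V" "x \<noteq> 0" for x
  proof -
    obtain n e where e: "is_unit e" "x = \<pi> powi n * e" using facF[OF x] by blast
    show ?thesis
    proof
      assume "v x \<ge> 0"
      then show "x \<in> V" using e v_eq powV V.mult_mem unitD by metis
    next
      assume "x \<in> V"
      then obtain m e' where e': "is_unit e'" "x = \<pi> ^ m * e'" using fac x by blast
      then have "x = \<pi> powi int m * e'" by simp
      then show "v x \<ge> 0" using v_eq e'(1) by (metis of_nat_0_le_iff)
    qed
  qed
  have vm: "v (x * y) = v x + v y" if xy: "x \<in> tot_quot V" "y \<in> tot_quot V" "x \<noteq> 0" "y \<noteq> 0" for x y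
  proof -
    obtain n e where e: "is_unit e" "x = \<pi> powi n * e" using facF xy by blast
    obtain m e' where e': "is_unit e'" "y = \<pi> powi m * e'" using facF xy by blast
    have "x * y = \<pi> powi (n + m) * (e * e')" using e e' pinz by (simp add: power_int_add)
    then show ?thesis using v_eq e e' unit_mult by metis
  qed
  have vpow: "v (\<pi> powi n) = n" for n
  proof -
    have "is_unit 1" using V.one_mem by (simp add: is_unit_def)
    then show ?thesis using v_eq[of 1 n] by simp
  qed
  have piF: "\<pi> \<in> tot_quot V" using tot_quot_incl[OF sub] pi(1) by blast
  have "disc_val (tot_quot V) v \<pi>"
  proof
    show "v (x * y) = v x + v y" if xy: "x \<in> tot_quot V" "y \<in> tot_quot V" "x \<noteq> 0" "y \<noteq> 0" for x y
      using vm[OF that] .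
    show "v \<pi> = 1" using vpow[of 1] by simp
    fix x y assume xy: "x \<in> tot_quot V" "y \<in> tot_quot V" "x \<noteq> 0" "y \<noteq> 0" "x + y \<noteq> 0"
    \<comment> \<open>Dividing both summands by \<pi>^m moves them into V, where closure under
      addition is the ultrametric inequality.\<close>
    define m where "m = min (v x) (v y)"
    have q: "v (z * \<pi> powi (- m)) = v z - m" "z * \<pi> powi (- m) \<in> tot_quot V"
      if "z \<in> tot_quot V" "z \<noteq> 0" for z
      using vm[of z "\<pi> powi (- m)"] vpow that F.powi_mem[OF piF] F.mult_mem pinz by auto
    have "x * \<pi> powi (- m) \<in> V" "y * \<pi> powi (- m) \<in> V"
      using q[of x] q[of y] vV[of "x * \<pi> powi (- m)"] vV[of "y * \<pi> powi (- m)"] xy pinz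
      unfolding m_def by simp_all
    then have "(x + y) * \<pi> powi (- m) \<in> V" using V.add_mem by (simp add: distrib_right)
    then have "v (x + y) - m \<ge> 0"
      using q[of "x + y"] vV[of "(x + y) * \<pi> powi (- m)"] xy F.add_mem pinz by auto
    then show "min (v x) (v y) \<le> v (x + y)" by (simp add: m_def)
  qed (use piF pinz in auto)
  then interpret D: disc_val "tot_quot V" v \<pi> .
  have V0: "V = D.level 0"
    using vV tot_quot_incl[OF sub] V.zero_mem by (auto simp: D.level_def)
  moreover have "N = D.level 1"
    using D.maximalideal_level_iff N(1) V0 by auto
  ultimately show thesis using that D.disc_val_axioms by blast
qed

section \<open>Extensions of discrete valuation rings\<close>

lemma (in ring) dimension_of_basis:
  assumes K: "subfield K R" and Us: "set Us \<subseteq> carrier R"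
    and E: "E = {combine Ks Us | Ks. length Ks = length Us \<and> set Ks \<subseteq> K}"
    and indep: "\<And>Ks. length Ks = length Us \<Longrightarrow> set Ks \<subseteq> K \<Longrightarrow> combine Ks Us = \<zero> \<Longrightarrow> set Ks \<subseteq> {\<zero>}"
  shows "dimension (length Us) K E"
proof -
  have "independent K Us"
  proof (rule trivial_combine_imp_independent[OF K Us])
    \<comment> \<open>The independence criterion ranges over coefficient lists of every length;
      \<open>combine_normalize\<close> cuts them or pads them with zeros to the length of
      \<open>Us\<close>.\<close>
    fix Ks assume Ks: "set Ks \<subseteq> K" "combine Ks Us = \<zero>"
    have "set Ks \<subseteq> carrier R" using Ks(1) subfieldE(3)[OF K] by blast
    then obtain Ks' where Ks': "set (take (length Us) Ks) \<subseteq> set Ks'"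
      "set Ks' \<subseteq> set (take (length Us) Ks) \<union> {\<zero>}" "length Ks' = length Us" "combine Ks' Us = \<zero>"
      using combine_normalize[OF _ Us Ks(2)] by metis
    have "\<zero> \<in> K" using subringE(2)[OF subfieldE(1)[OF K]] .
    then have "set Ks' \<subseteq> K" using Ks'(2) Ks(1) set_take_subset by fastforce
    then show "set (take (length Us) Ks) \<subseteq> {\<zero>}" using indep Ks' by blast
  qed
  then show ?thesis
    using dimension_independent Span_eq_combine_set_length_version[OF K Us] E by metis
qed

lemma combine_ring_on:
  assumes "subring_set S" "length Ks = length Us"
  shows "ring.combine (ring_on S) Ks Us = (\<Sum>i<length Us. Ks ! i * Us ! i)"
proof -
  interpret cring "ring_on S" by (rule cring_ring_on[OF assms(1)])
  show ?thesis
    using assms(2)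
    by (induction Ks Us rule: list_induct2) (simp_all del: sum.lessThan_Suc add: sum.lessThan_Suc_shift)
qed

lemma ring_on_UNIV: "ring_on UNIV = ring_of_type_algebra"
  by (simp add: ring_of_type_algebra_def)

lemma dimension_field:
  fixes K E :: "'l::field set"
  assumes K: "subfield_set K"
    and span: "\<And>x. x \<in> E \<longleftrightarrow> (\<exists>c. (\<forall>i<n. c i \<in> K) \<and> x = (\<Sum>i<n. c i * t i))"
    and indep: "\<And>c. (\<forall>i<n. c i \<in> K) \<Longrightarrow> (\<Sum>i<n. c i * t i) = 0 \<Longrightarrow> \<forall>i<n. c i = 0"
  shows "ring.dimension ring_of_type_algebra n K E"
proof -
  interpret R: Ring.field "ring_of_type_algebra :: 'l ring" by (rule field_from_type_algebra)
  have UNIV: "subring_set (UNIV :: 'l set)" by unfold_locales auto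
  define Us where "Us = map t [0..<n]"
  have len: "length Us = n" by (simp add: Us_def)
  have comb: "R.combine Ks Us = (\<Sum>i<n. Ks ! i * t i)" if "length Ks = length Us" for Ks
    using combine_ring_on[OF UNIV that] by (simp add: ring_on_UNIV len) (simp add: Us_def)
  have "R.dimension (length Us) K E"
  proof (rule R.dimension_of_basis[OF subfield_set.subfield[OF K]])
    show "E = {R.combine Ks Us |Ks. length Ks = length Us \<and> set Ks \<subseteq> K}"
    proof (intro Set.set_eqI iffI)
      fix x assume "x \<in> E"
      then obtain c where c: "\<forall>i<n. c i \<in> K" "x = (\<Sum>i<n. c i * t i)" using span by blast
      have "x = R.combine (map c [0..<n]) Us" using c(2) comb[of "map c [0..<n]"] by (simp add: len)
      moreover have "set (map c [0..<n]) \<subseteq> K" "length (map c [0..<n]) = length Us" using c(1) by (auto simp: len)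
      ultimately show "x \<in> {R.combine Ks Us |Ks. length Ks = length Us \<and> set Ks \<subseteq> K}" by blast
    next
      fix x assume "x \<in> {R.combine Ks Us |Ks. length Ks = length Us \<and> set Ks \<subseteq> K}"
      then obtain Ks where Ks: "length Ks = length Us" "set Ks \<subseteq> K" "x = R.combine Ks Us" by blast
      have "\<forall>i<n. Ks ! i \<in> K" using Ks(1,2) len nth_mem by (metis subsetD)
      then show "x \<in> E" unfolding span Ks(3) comb[OF Ks(1)] by blast
    qed
    fix Ks assume Ks: "length Ks = length Us" "set Ks \<subseteq> K" "R.combine Ks Us = \<zero>\<^bsub>ring_of_type_algebra\<^esub>"
    have "\<forall>i<n. Ks ! i \<in> K" using Ks(1,2) len nth_mem by (metis subsetD)
    then have "\<forall>i<n. Ks ! i = 0" using indep[of "\<lambda>i. Ks ! i"] comb[OF Ks(1)] Ks(3) by simp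
    then show "set Ks \<subseteq> {\<zero>\<^bsub>ring_of_type_algebra\<^esub>}" using Ks(1) len by (auto simp: in_set_conv_nth)
  qed auto
  then show ?thesis by (simp add: len)
qed

text \<open>Dividing the equation of degree n by \<open>y ^ (n - 1)\<close> expresses y as a
  polynomial in \<open>inverse y\<close> over A.\<close>

lemma valuation_ring_integrally_closed:
  fixes A :: "'l::field set"
  assumes "subring_set A" "integral_over A y" "y \<in> A \<or> inverse y \<in> A"
  shows "y \<in> A"
proof (rule ccontr)
  interpret subring_set A by fact
  assume y: "y \<notin> A"
  then have iy: "inverse y \<in> A" "y \<noteq> 0" using assms(3) zero_mem by auto
  obtain n c where c: "\<forall>i<n. c i \<in> A" "y ^ n = (\<Sum>i<n. c i * y ^ i)"
    using assms(2) unfolding integral_over_iff[OF assms(1)] by blast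
  have "n \<noteq> 0" using c(2) by (cases n) auto
  then obtain m where m: "n = Suc m" by (cases n) auto
  have "y = inverse y ^ m * y ^ n" using iy by (simp add: m power_inverse)
  also have "\<dots> = (\<Sum>i<n. c i * inverse y ^ (m - i))"
    unfolding c(2) sum_distrib_left
  proof (rule sum.cong)
    fix i assume "i \<in> {..<n}"
    then have "m = (m - i) + i" by (simp add: m)
    then have "inverse y ^ m = inverse y ^ (m - i) * inverse y ^ i" by (metis power_add)
    then show "inverse y ^ m * (c i * y ^ i) = c i * inverse y ^ (m - i)"
      using iy(2) by (simp add: power_inverse)
  qed simp
  also have "\<dots> \<in> A" using c(1) iy(1) by (intro sum_mem mult_mem power_mem) auto
  finally show False using y by simp
qed

text \<open>Submodules of a free module of finite rank over a discrete valuation ring are finitely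
  generated; here in terms of sequences of vectors.\<close>

lemma (in disc_val) sequence_of_vectors:
  fixes g :: "nat \<Rightarrow> nat \<Rightarrow> 'l"
  assumes "\<And>i j. g i j \<in> level 0"
  shows "\<exists>N c. (\<forall>i<N. c i \<in> level 0) \<and> (\<forall>j<n. g N j = (\<Sum>i<N. c i * g i j))"
  using assms
proof (induction n arbitrary: g)
  case 0
  show ?case by (intro exI[of _ 0]) simp
next
  case (Suc n)
  show ?case
  proof (cases "\<forall>i. g i n = 0")
    case True
    obtain N c where c: "\<forall>i<N. c i \<in> level 0" "\<forall>j<n. g N j = (\<Sum>i<N. c i * g i j)"
      using Suc.IH[of g] Suc.prems by blast
    have "\<forall>j<Suc n. g N j = (\<Sum>i<N. c i * g i j)" using c(2) True by (auto simp: less_Suc_eq)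
    then show ?thesis using c(1) by blast
  next
    case False
    \<comment> \<open>\<open>g m\<close> is the vector whose last coordinate has least value among
      the nonzero ones. Subtracting multiples of it from the later vectors clears their last
      coordinate, which leaves n coordinates for the induction.\<close>
    then obtain m where m: "g m n \<noteq> 0" and min: "\<And>i. g i n \<noteq> 0 \<Longrightarrow> nat (v (g m n)) \<le> nat (v (g i n))"
      using ex_has_least_nat[of "\<lambda>i. g i n \<noteq> 0" _ "\<lambda>i. nat (v (g i n))"] by blast
    define q where "q i = g i n / g m n" for i
    have q: "q i \<in> level 0" for i
    proof (rule levelI)
      show "q i \<in> F" unfolding q_def by (intro divide_mem level_mem[OF Suc.prems])
      assume "q i \<noteq> 0"
      then have "g i n \<noteq> 0" by (auto simp: q_def)
      then show "0 \<le> v (q i)"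
        using min[of i] m level_v[OF Suc.prems, of i n] level_v[OF Suc.prems, of m n]
          level_mem[OF Suc.prems] by (simp add: q_def v_divide)
    qed
    define g' where "g' i j = g (Suc m + i) j - q (Suc m + i) * g m j" for i j
    have "g' i j \<in> level 0" for i j
      unfolding g'_def using Suc.prems q by (intro O.mems)
    then obtain N c where c: "\<forall>i<N. c i \<in> level 0" "\<forall>j<n. g' N j = (\<Sum>i<N. c i * g' i j)"
      using Suc.IH[of g'] by blast
    have g'n: "g' i n = 0" for i using m by (simp add: g'_def q_def)
    have c': "g' N j = (\<Sum>i<N. c i * g' i j)" if "j < Suc n" for j
      using that c(2) g'n by (cases "j = n") auto
    \<comment> \<open>The relation among the differences \<open>g'\<close>, rewritten for g: the
      multiples of \<open>g m\<close> subtracted on both sides are collected in the coefficient at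
      m.\<close>
    define d where "d i = (if i < m then 0 else if i = m then q (Suc m + N) - (\<Sum>i<N. c i * q (Suc m + i)) else c (i - Suc m))" for i
    have "d i \<in> level 0" if "i < Suc m + N" for i
      using that c(1) q by (auto simp: d_def intro!: O.mems O.sum_mem)
    moreover have "g (Suc m + N) j = (\<Sum>i<Suc m + N. d i * g i j)" if j: "j < Suc n" for j
    proof -
      have "(\<Sum>i<Suc m + N. d i * g i j) = (\<Sum>i<Suc m. d i * g i j) + (\<Sum>i<N. d (Suc m + i) * g (Suc m + i) j)"
        by (induction N) (simp_all add: add.assoc)
      also have "(\<Sum>i<Suc m. d i * g i j) = d m * g m j" by (simp add: d_def)
      also have "(\<Sum>i<N. d (Suc m + i) * g (Suc m + i) j) = (\<Sum>i<N. c i * g (Suc m + i) j)"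
        by (simp add: d_def)
      also have "\<dots> = (\<Sum>i<N. c i * g' i j) + (\<Sum>i<N. c i * q (Suc m + i)) * g m j"
        by (simp add: g'_def right_diff_distrib sum_subtractf sum_distrib_right mult.assoc)
      also have "(\<Sum>i<N. c i * g' i j) = g' N j" using c'[OF j] by simp
      finally show ?thesis by (simp add: d_def g'_def algebra_simps)
    qed
    ultimately show ?thesis by (intro exI[of _ "Suc m + N"] exI[of _ d]) blast
  qed
qed

text \<open>An extension of valued fields with a basis t for which w is computed coefficientwise
  (\<open>ortho\<close>). K has value group e\<int>, and \<open>t l\<close> has value l mod e, so
  indices with the same remainder have equal values. Those divisible by e, f in number, yield a
  basis of the residue field, and e is the ramification index. One locale serves all three
  extensions of the theorem.\<close>

locale val_ext = disc_val E w \<rho> for E :: "'l::field set" and w :: "'l \<Rightarrow> int" and \<rho> :: 'l +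
  fixes K :: "'l set" and \<pi> :: 'l and t :: "nat \<Rightarrow> 'l" and e f :: nat
  assumes K_subfield: "subfield_set K" and K_sub: "K \<subseteq> E"
    and e_pos: "0 < e" and f_pos: "0 < f"
    and pi_mem: "\<pi> \<in> K" and pi_nz: "\<pi> \<noteq> 0" and w_pi: "w \<pi> = int e"
    and w_K: "x \<in> K \<Longrightarrow> x \<noteq> 0 \<Longrightarrow> int e dvd w x"
    and t_mem: "l < e * f \<Longrightarrow> t l \<in> E" and t_nz: "l < e * f \<Longrightarrow> t l \<noteq> 0"
    and w_t: "l < e * f \<Longrightarrow> w (t l) = int (l mod e)"
    and span: "x \<in> E \<Longrightarrow> \<exists>c. (\<forall>l<e * f. c l \<in> K) \<and> x = (\<Sum>l<e * f. c l * t l)"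
    and ortho: "(\<forall>l<e * f. c l \<in> K) \<Longrightarrow> (\<Sum>l<e * f. c l * t l) \<in> level m \<Longrightarrow> l < e * f \<Longrightarrow> c l * t l \<in> level m"
begin

interpretation K: subfield_set K by (rule K_subfield)

lemma disc_val_K: "disc_val K (\<lambda>x. w x div int e) \<pi>"
proof
  show "w (x * y) div int e = w x div int e + w y div int e" if "x \<in> K" "y \<in> K" "x \<noteq> 0" "y \<noteq> 0" for x y
    using that v_mult[OF subsetD[OF K_sub] subsetD[OF K_sub], of x y] w_K[of x] w_K[of y] by simp
  show "min (w x div int e) (w y div int e) \<le> w (x + y) div int e"
    if "x \<in> K" "y \<in> K" "x \<noteq> 0" "y \<noteq> 0" "x + y \<noteq> 0" for x y
  proof -
    have "min (w x) (w y) \<le> w (x + y)" using that v_add K_sub by blast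
    then have "min (w x) (w y) div int e \<le> w (x + y) div int e" using e_pos by (intro zdiv_mono1) auto
    then show ?thesis by (auto simp: min_def split: if_splits)
  qed
  show "w \<pi> div int e = 1" using w_pi e_pos by simp
qed (use pi_mem pi_nz in auto)

interpretation D: disc_val K "\<lambda>x. w x div int e" \<pi> by (rule disc_val_K)

lemma level_K: "D.level m = K \<inter> level (int e * m)"
proof -
  have "m \<le> w x div int e \<longleftrightarrow> int e * m \<le> w x" if x: "x \<in> K" "x \<noteq> 0" for x
  proof -
    obtain k where "w x = int e * k" using w_K[OF x] by (auto elim: dvdE)
    then show ?thesis using e_pos by simp
  qed
  then show ?thesis using K_sub by (auto simp: D.level_def level_def)
qed

abbreviation "OK \<equiv> K \<inter> level 0"
abbreviation "MK \<equiv> K \<inter> level 1"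

lemma MK_eq: "MK = K \<inter> level (int e)"
proof -
  have "int e \<le> w x" if "x \<in> K" "x \<noteq> 0" "1 \<le> w x" for x
    using w_K[OF that(1,2)] that(3) by (intro zdvd_imp_le) auto
  then show ?thesis using e_pos by (auto simp: level_def)
qed

lemma OK_level: "OK = D.level 0" "MK = D.level 1"
  using level_K[of 0] level_K[of 1] MK_eq by auto

lemma dvr_OK: "dvr OK MK"
  using D.dvr_level by (simp add: OK_level)

lemma subring_OK: "subring_set OK"
  using D.subring_level by (simp add: OK_level)

lemma tot_quot_OK: "tot_quot OK = K"
  using D.tot_quot_level by (simp add: OK_level)

text \<open>Linear independence is a consequence of \<open>ortho\<close>: zero lies in every level,
  hence so does each summand.\<close>

lemma coeffs_unique:
  assumes "\<forall>l<e * f. c l \<in> K" "(\<Sum>l<e * f. c l * t l) = 0" "l < e * f"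
  shows "c l = 0"
proof -
  have "c l * t l = 0" using ortho[OF assms(1) _ assms(3)] assms(2) zero_level by (intro level_all) simp
  then show ?thesis using t_nz[OF assms(3)] by simp
qed

text \<open>Since \<open>t l\<close> has value less than e, the value of c exceeds -e; being a
  multiple of e, it is nonnegative.\<close>

lemma coeff_integral:
  assumes "c \<in> K" "l < e * f" "c * t l \<in> level 0" shows "c \<in> OK"
proof -
  have "c \<in> level 0"
  proof (rule levelI)
    assume c: "c \<noteq> 0"
    have "0 \<le> w (c * t l)" using level_v[OF assms(3)] c t_nz[OF assms(2)] by simp
    then have "- int (l mod e) \<le> w c" using v_mult[of c "t l"] c t_nz t_mem w_t assms K_sub by auto
    moreover have "int (l mod e) < int e" using e_pos by simp
    ultimately have "- int e < w c" by linarith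
    moreover obtain k where k: "w c = int e * k" using w_K[OF assms(1) c] by (auto elim: dvdE)
    ultimately have "int e * (- 1) < int e * k" by simp
    then have "k \<ge> 0" using e_pos by (simp only: mult_less_cancel_left) auto
    then show "0 \<le> w c" using k by simp
  qed (use assms K_sub in auto)
  then show ?thesis using assms(1) by blast
qed

lemma integral_coeffs:
  assumes "x \<in> level 0"
  shows "\<exists>c. (\<forall>l<e * f. c l \<in> OK) \<and> x = (\<Sum>l<e * f. c l * t l)"
proof -
  obtain c where c: "\<forall>l<e * f. c l \<in> K" "x = (\<Sum>l<e * f. c l * t l)"
    using span level_mem[OF assms] by blast
  have "c l \<in> OK" if "l < e * f" for l
    using coeff_integral[of "c l" l] ortho[OF c(1) _ that, of 0] c assms that by simp
  then show ?thesis using c(2) by blast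
qed

lemma t_level: "l < e * f \<Longrightarrow> t l \<in> level 0"
  using t_mem w_t by (intro levelI) auto

lemma sum_single:
  assumes "l < (n::nat)" shows "(\<Sum>i<n. (if i = l then a else 0) * t i) = a * t l"
proof -
  have "(\<Sum>i<n. (if i = l then a else 0) * t i) = (\<Sum>i<n. if i = l then a * t l else 0)"
    by (intro sum.cong) auto
  then show ?thesis using assms by simp
qed

lemma inj_t: "inj_on t {..<e * f}"
proof (rule inj_onI, rule ccontr)
  fix l l' assume l: "l \<in> {..<e * f}" "l' \<in> {..<e * f}" "t l = t l'" "l \<noteq> l'"
  define c :: "nat \<Rightarrow> 'l" where "c i = (if i = l then 1 else 0) - (if i = l' then 1 else 0)" for i
  have "(\<Sum>i<e * f. c i * t i) = t l - t l'"
    using l sum_single[of l "e * f" 1] sum_single[of l' "e * f" 1]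
    by (simp add: c_def left_diff_distrib sum_subtractf)
  moreover have "\<forall>i<e * f. c i \<in> K" by (auto simp: c_def intro: K.mems)
  ultimately have "c l = 0" using coeffs_unique[of c l] l by simp
  then show False using l by (simp add: c_def)
qed

text \<open>The definition indexes coefficients by the basis elements themselves. By
  \<open>inj_t\<close> this is the same as indexing by l, and extensionality of
  \<open>\<rightarrow>\<^sub>E\<close> makes the coefficient function unique.\<close>

lemma finite_free: "finite_free_extension OK (level 0)"
  unfolding finite_free_extension_def
proof (intro conjI exI)
  show "subring OK (ring_on (level 0))"
    by (rule subring_ring_on[OF subring_OK subring_level]) auto
  show "t ` {..<e * f} \<subseteq> level 0" using t_level by auto
  show "finite (t ` {..<e * f})" by simp
  show "\<forall>x\<in>level 0. \<exists>!c. c \<in> t ` {..<e * f} \<rightarrow>\<^sub>E OK \<and> x = (\<Sum>b\<in>t ` {..<e * f}. c b * b)"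
  proof
    fix x assume "x \<in> level 0"
    then obtain c where c: "\<forall>l<e * f. c l \<in> OK" "x = (\<Sum>l<e * f. c l * t l)" using integral_coeffs by blast
    have re: "(\<Sum>b\<in>t ` {..<e * f}. d b * b) = (\<Sum>l<e * f. d (t l) * t l)" for d
      using inj_t by (simp add: sum.reindex)
    define d where "d = (\<lambda>b\<in>t ` {..<e * f}. c (the_inv_into {..<e * f} t b))"
    have dt: "d (t l) = c l" if "l < e * f" for l
      using that inj_t by (simp add: d_def the_inv_into_f_f)
    show "\<exists>!c. c \<in> t ` {..<e * f} \<rightarrow>\<^sub>E OK \<and> x = (\<Sum>b\<in>t ` {..<e * f}. c b * b)"
    proof (rule ex1I[of _ d])
      have "d \<in> t ` {..<e * f} \<rightarrow>\<^sub>E OK"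
        using c(1) dt by (intro PiE_I) (auto simp: d_def)
      then show "d \<in> t ` {..<e * f} \<rightarrow>\<^sub>E OK \<and> x = (\<Sum>b\<in>t ` {..<e * f}. d b * b)"
        using c(2) by (simp add: re dt)
      fix d' assume d': "d' \<in> t ` {..<e * f} \<rightarrow>\<^sub>E OK \<and> x = (\<Sum>b\<in>t ` {..<e * f}. d' b * b)"
      have mem: "d' (t l) \<in> K" if "l < e * f" for l
        using d' that PiE_mem[of d' "t ` {..<e * f}" "\<lambda>_. OK" "t l"] by auto
      have "(\<Sum>l<e * f. (d' (t l) - c l) * t l) = 0"
        using d' c(2) re[of d'] by (simp add: left_diff_distrib sum_subtractf)
      then have "d' (t l) = c l" if "l < e * f" for l
        using coeffs_unique[of "\<lambda>l. d' (t l) - c l" l] that mem c(1) K.diff_mem by auto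
      then show "d' = d" using d' \<open>d \<in> _\<close> dt
        by (intro PiE_ext[of d' "t ` {..<e * f}" "\<lambda>_. OK" d]) auto
    qed
  qed
qed

text \<open>The powers of x have coordinate vectors over \<open>OK\<close>. By
  \<open>sequence_of_vectors\<close> one of them is a combination of the preceding ones, which is an
  integral equation; no determinant is involved.\<close>

lemma integral_OK:
  assumes "x \<in> level 0" shows "integral_over OK x"
proof -
  have "\<exists>c. (\<forall>l<e * f. c l \<in> OK) \<and> x ^ i = (\<Sum>l<e * f. c l * t l)" for i
    by (rule integral_coeffs) (rule O.power_mem[OF assms])
  then obtain g where g: "\<And>i. (\<forall>l<e * f. g i l \<in> OK) \<and> x ^ i = (\<Sum>l<e * f. g i l * t l)" by metis
  define g' where "g' i l = (if l < e * f then g i l else 0)" for i l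
  have "g' i l \<in> D.level 0" for i l
    using g subring_set.zero_mem[OF subring_OK] by (auto simp: g'_def OK_level[symmetric])
  then obtain N c where c: "\<forall>i<N. c i \<in> D.level 0" "\<forall>l<e * f. g' N l = (\<Sum>i<N. c i * g' i l)"
    using D.sequence_of_vectors[of g' "e * f"] by blast
  have "x ^ N = (\<Sum>l<e * f. g' N l * t l)" using g by (simp add: g'_def)
  also have "\<dots> = (\<Sum>l<e * f. \<Sum>i<N. c i * g' i l * t l)" using c(2) by (simp add: sum_distrib_right)
  also have "\<dots> = (\<Sum>i<N. c i * (\<Sum>l<e * f. g' i l * t l))"
    by (subst sum.swap) (simp add: sum_distrib_left mult.assoc)
  also have "\<dots> = (\<Sum>i<N. c i * x ^ i)" using g by (simp add: g'_def)
  finally show ?thesis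
    unfolding integral_over_iff[OF subring_OK] using c(1) OK_level(1) by auto
qed

lemma integral_extension: "integral_extension_domain OK (level 0)"
  unfolding integral_extension_domain_def
  using subring_ring_on[OF subring_OK subring_level] domain_ring_on[OF subring_level] integral_OK by blast

lemma degree: "has_degree OK (level 0) (e * f)"
  unfolding has_degree_def tot_quot_OK tot_quot_level
proof (rule dimension_field[OF K_subfield])
  show "x \<in> E \<longleftrightarrow> (\<exists>c. (\<forall>i<e * f. c i \<in> K) \<and> x = (\<Sum>i<e * f. c i * t i))" for x
  proof
    assume "\<exists>c. (\<forall>i<e * f. c i \<in> K) \<and> x = (\<Sum>i<e * f. c i * t i)"
    then show "x \<in> E" using K_sub t_mem by (auto intro!: sum_mem mult_mem)
  qed (rule span)
qed (use coeffs_unique in blast)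

lemma ramification_index: "has_ramification_index MK (level 0) (level 1) e"
  unfolding has_ramification_index_def level_ideal_pow
  by (rule level_eq_genideal[of \<pi>])
    (use pi_mem pi_nz w_pi MK_eq e_pos K_sub in \<open>auto intro!: levelI\<close>)

lemma MK_Int: "MK = OK \<inter> level 1"
  using level_antimono[of 0 1] by auto

lemma coset_eq:
  assumes "x \<in> level 0" "y \<in> level 0"
  shows "level 1 +>\<^bsub>ring_on (level 0)\<^esub> x = level 1 +>\<^bsub>ring_on (level 0)\<^esub> y \<longleftrightarrow> x - y \<in> level 1"
proof -
  have co: "level 1 +>\<^bsub>ring_on (level 0)\<^esub> x = {m + x | m. m \<in> level 1}" for x
    by (auto simp: a_r_coset_def')
  show ?thesis
  proof
    assume "level 1 +>\<^bsub>ring_on (level 0)\<^esub> x = level 1 +>\<^bsub>ring_on (level 0)\<^esub> y"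
    moreover have "x \<in> level 1 +>\<^bsub>ring_on (level 0)\<^esub> x" unfolding co using zero_level by force
    ultimately show "x - y \<in> level 1" unfolding co by auto
  next
    assume xy: "x - y \<in> level 1"
    have "m + x = (m + (x - y)) + y" "m + y = (m - (x - y)) + x" for m by simp_all
    then show "level 1 +>\<^bsub>ring_on (level 0)\<^esub> x = level 1 +>\<^bsub>ring_on (level 0)\<^esub> y"
      unfolding co using level_add[OF _ xy] level_diff[OF _ xy] by blast
  qed
qed

lemma sum_split:
  "(\<Sum>l<e * f. g l) = (\<Sum>i<f. g (e * i)) + (\<Sum>l | l < e * f \<and> \<not> e dvd l. g l)"
proof -
  have "{..<e * f} = (\<lambda>i. e * i) ` {..<f} \<union> {l. l < e * f \<and> \<not> e dvd l}"
    using e_pos by (auto elim!: dvdE)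
  moreover have "(\<lambda>i. e * i) ` {..<f} \<inter> {l. l < e * f \<and> \<not> e dvd l} = {}" by auto
  ultimately have "(\<Sum>l<e * f. g l) = sum g ((\<lambda>i. e * i) ` {..<f}) + sum g {l. l < e * f \<and> \<not> e dvd l}"
    by (metis (no_types, lifting) finite_Un finite_lessThan sum.union_disjoint)
  also have "sum g ((\<lambda>i. e * i) ` {..<f}) = (\<Sum>i<f. g (e * i))"
    using e_pos by (subst sum.reindex) (auto simp: inj_on_def)
  finally show ?thesis .
qed

text \<open>Summands at indices not divisible by e have positive value and vanish modulo
  \<open>level 1\<close>.\<close>

lemma residue_span:
  assumes "x \<in> level 0"
  shows "\<exists>c. (\<forall>i<f. c i \<in> OK) \<and> x - (\<Sum>i<f. c i * t (e * i)) \<in> level 1"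
proof -
  obtain c where c: "\<forall>l<e * f. c l \<in> OK" "x = (\<Sum>l<e * f. c l * t l)" using integral_coeffs[OF assms] by blast
  have "c l * t l \<in> level 1" if "l < e * f" "\<not> e dvd l" for l
  proof -
    have "l mod e \<noteq> 0" using that(2) by (simp add: mod_eq_0_iff_dvd)
    then have "1 \<le> int (l mod e)" by linarith
    then have "t l \<in> level 1" using that(1) t_mem w_t by (intro levelI) auto
    then show ?thesis using c(1) that level_mult[of "c l" 0 "t l" 1] by auto
  qed
  then have "x - (\<Sum>i<f. c (e * i) * t (e * i)) \<in> level 1"
    unfolding c(2) sum_split[of "\<lambda>l. c l * t l"] by (auto intro: level_sum)
  then show ?thesis using c(1) e_pos by (intro exI[of _ "\<lambda>i. c (e * i)"]) auto
qed

text \<open>Extending c by zero to the other indices makes \<open>ortho\<close> applicable at level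
  1, and \<open>t (e * i)\<close> has value 0.\<close>

lemma residue_indep:
  assumes "\<forall>i<f. c i \<in> OK" "(\<Sum>i<f. c i * t (e * i)) \<in> level 1" "i < f"
  shows "c i \<in> level 1"
proof -
  define d where "d l = (if e dvd l then c (l div e) else 0)" for l
  have "(\<Sum>l<e * f. d l * t l) = (\<Sum>i<f. c i * t (e * i))"
    using e_pos by (subst sum_split) (simp add: d_def)
  moreover have "\<forall>l<e * f. d l \<in> K" using assms(1) e_pos K.zero_mem by (auto simp: d_def elim!: dvdE)
  moreover have "e * i < e * f" using assms(3) e_pos by simp
  ultimately have "d (e * i) * t (e * i) \<in> level 1" using ortho[of d 1 "e * i"] assms(2) by simp
  then have "t (e * i) * c i \<in> level 1" using e_pos by (simp add: d_def mult.commute)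
  then show ?thesis
    using level_scale[of "t (e * i)" "c i" 1] t_mem t_nz w_t \<open>e * i < e * f\<close> by simp
qed

interpretation R: cring "ring_on (level 0)" by (rule cring_ring_on[OF subring_level])
interpretation M: maximalideal "level 1" "ring_on (level 0)"
  using maximalideal_level_iff by blast

abbreviation "res x \<equiv> level 1 +>\<^bsub>ring_on (level 0)\<^esub> x"

lemma res_hom: "ring_hom_ring (ring_on (level 0)) (ring_on (level 0) Quot level 1) res"
  by (rule M.rcos_ring_hom_ring)

lemma field_res: "Ring.field (ring_on (level 0) Quot level 1)"
  by (rule M.quotient_is_field[OF R.is_cring])

lemma carrier_res: "carrier (ring_on (level 0) Quot level 1) = res ` level 0"
  by (auto simp: FactRing_def A_RCOSETS_def')

lemma zero_res: "\<zero>\<^bsub>ring_on (level 0) Quot level 1\<^esub> = res 0"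
  using R.a_rcos_zero[OF M.is_ideal zero_level] by (simp add: FactRing_def)

lemma subfield_res: "subfield (res ` OK) (ring_on (level 0) Quot level 1)"
proof -
  interpret Q: Ring.field "ring_on (level 0) Quot level 1" by (rule field_res)
  interpret h: ring_hom_ring "ring_on (level 0)" "ring_on (level 0) Quot level 1" res by (rule res_hom)
  have "subring OK (ring_on (level 0))" by (rule subring_ring_on[OF subring_OK subring_level]) auto
  then have "subring (res ` OK) (ring_on (level 0) Quot level 1)" by (rule h.img_is_subring)
  then show ?thesis
  proof (rule Q.subfieldI')
    fix k assume "k \<in> res ` OK - {\<zero>\<^bsub>ring_on (level 0) Quot level 1\<^esub>}"
    then obtain a where a: "a \<in> OK" "k = res a" "res a \<noteq> res 0" by (auto simp: zero_res)
    then have "a \<notin> level 1" using coset_eq[of a 0] zero_level by auto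
    then have "a \<noteq> 0" "w a = 0" using a zero_level[of 1] level_v[of a 0] levelI[of a 1] level_mem[of a 0] by force+
    then have ia: "inverse a \<in> OK" using a K.inverse_mem K_sub by (auto intro!: levelI simp: v_inverse)
    have "res a \<otimes>\<^bsub>ring_on (level 0) Quot level 1\<^esub> res (inverse a) = \<one>\<^bsub>ring_on (level 0) Quot level 1\<^esub>"
      using h.hom_mult[of a "inverse a"] h.hom_one a ia \<open>a \<noteq> 0\<close> by auto
    then have "inv\<^bsub>ring_on (level 0) Quot level 1\<^esub> (res a) = res (inverse a)"
      using a ia by (intro Q.comm_inv_char) (auto intro!: h.hom_closed)
    then show "inv\<^bsub>ring_on (level 0) Quot level 1\<^esub> k \<in> res ` OK" using a ia by auto
  qed
qed

lemma residue_degree: "has_residue_degree OK MK (level 0) (level 1) f"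
  unfolding has_residue_degree_def
proof (intro conjI)
  show "MK = OK \<inter> level 1" by (rule MK_Int)
  interpret Q: Ring.field "ring_on (level 0) Quot level 1" by (rule field_res)
  interpret h: ring_hom_ring "ring_on (level 0)" "ring_on (level 0) Quot level 1" res by (rule res_hom)
  define us where "us = map (\<lambda>i. t (e * i)) [0..<f]"
  define Us where "Us = map res us"
  have us: "set us \<subseteq> level 0" "length us = f" using t_level e_pos by (auto simp: us_def)
  have comb: "Q.combine (map res ks) Us = res (\<Sum>i<f. ks ! i * t (e * i))"
    if "length ks = f" "set ks \<subseteq> OK" for ks
  proof -
    have "Q.combine (map res ks) Us = res (R.combine ks us)"
      unfolding Us_def using that us by (intro h.combine_hom) auto
    then show ?thesis using combine_ring_on[OF subring_level, of ks us] that us by (simp add: us_def)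
  qed
  \<comment> \<open>Relations over the residue field are lifted coefficient by coefficient to
    \<open>OK\<close>, where \<open>residue_indep\<close> can be applied.\<close>
  have lift: "\<exists>ks. Ks = map res ks \<and> length ks = length Ks \<and> set ks \<subseteq> OK" if "set Ks \<subseteq> res ` OK" for Ks
    using that
  proof (induction Ks)
    case (Cons k Ks)
    then obtain ks a where "Ks = map res ks" "length ks = length Ks" "set ks \<subseteq> OK" "a \<in> OK" "k = res a" by auto
    then show ?case by (intro exI[of _ "a # ks"]) auto
  qed simp
  have "Q.dimension (length Us) (res ` OK) (carrier (ring_on (level 0) Quot level 1))"
  proof (rule Q.dimension_of_basis[OF subfield_res])
    show Us_sub: "set Us \<subseteq> carrier (ring_on (level 0) Quot level 1)" using us by (auto simp: Us_def carrier_res)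
    show "carrier (ring_on (level 0) Quot level 1) = {Q.combine Ks Us |Ks. length Ks = length Us \<and> set Ks \<subseteq> res ` OK}"
    proof (intro Set.set_eqI iffI)
      fix Y assume "Y \<in> carrier (ring_on (level 0) Quot level 1)"
      then obtain x where x: "x \<in> level 0" "Y = res x" by (auto simp: carrier_res)
      obtain c where c: "\<forall>i<f. c i \<in> OK" "x - (\<Sum>i<f. c i * t (e * i)) \<in> level 1" using residue_span[OF x(1)] by blast
      define ks where "ks = map c [0..<f]"
      have ks: "length ks = f" "set ks \<subseteq> OK" using c(1) by (auto simp: ks_def)
      have "(\<Sum>i<f. c i * t (e * i)) \<in> level 0"
        using c(1) t_level e_pos by (intro O.sum_mem O.mult_mem) auto
      then have "Y = res (\<Sum>i<f. c i * t (e * i))" using coset_eq x c(2) by simp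
      also have "(\<Sum>i<f. c i * t (e * i)) = (\<Sum>i<f. ks ! i * t (e * i))" by (simp add: ks_def)
      finally have "Y = Q.combine (map res ks) Us" using comb[OF ks] by simp
      moreover have "length (map res ks) = length Us" "set (map res ks) \<subseteq> res ` OK"
        using ks us by (auto simp: Us_def)
      ultimately show "Y \<in> {Q.combine Ks Us |Ks. length Ks = length Us \<and> set Ks \<subseteq> res ` OK}" by blast
    next
      fix Y assume "Y \<in> {Q.combine Ks Us |Ks. length Ks = length Us \<and> set Ks \<subseteq> res ` OK}"
      then obtain Ks where Ks: "Y = Q.combine Ks Us" "set Ks \<subseteq> res ` OK" by blast
      have "set Ks \<subseteq> carrier (ring_on (level 0) Quot level 1)" using Ks(2) by (auto simp: carrier_res)
      then show "Y \<in> carrier (ring_on (level 0) Quot level 1)"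
        unfolding Ks(1) using Us_sub by (rule Q.combine_in_carrier)
    qed
    fix Ks assume Ks: "length Ks = length Us" "set Ks \<subseteq> res ` OK" "Q.combine Ks Us = \<zero>\<^bsub>ring_on (level 0) Quot level 1\<^esub>"
    obtain ks where ks: "Ks = map res ks" "length ks = length Ks" "set ks \<subseteq> OK" using lift[OF Ks(2)] by blast
    have len: "length ks = f" using ks(2) Ks(1) us by (simp add: Us_def)
    have ksmem: "\<forall>i<f. ks ! i \<in> OK" using ks(3) len nth_mem by (metis subsetD)
    then have S: "(\<Sum>i<f. ks ! i * t (e * i)) \<in> level 0"
      using t_level e_pos by (intro O.sum_mem O.mult_mem) auto
    have "res (\<Sum>i<f. ks ! i * t (e * i)) = res 0" using comb[OF len ks(3)] Ks(3) ks(1) zero_res by simp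
    then have "(\<Sum>i<f. ks ! i * t (e * i)) \<in> level 1" using coset_eq[OF S zero_level] by simp
    then have "ks ! i \<in> level 1" if "i < f" for i using residue_indep[OF ksmem] that by blast
    then have "res (ks ! i) = res 0" if "i < f" for i
      using coset_eq[of "ks ! i" 0] zero_level ksmem that by auto
    then show "set Ks \<subseteq> {\<zero>\<^bsub>ring_on (level 0) Quot level 1\<^esub>}"
      using len by (auto simp: ks(1) zero_res in_set_conv_nth)
  qed
  then show "Q.dimension f (res ` OK) (carrier (ring_on (level 0) Quot level 1))"
    using us by (simp add: Us_def)
qed

text \<open>\<open>level 0\<close> is integral over \<open>OK\<close>, hence contained in the
  integrally closed A. Conversely, an x in A of negative value would give
  \<open>inverse x ^ e / \<pi>\<close> of nonnegative value, so multiplying by \<open>x ^ e\<close>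
  would put \<open>inverse \<pi>\<close> into A and thus into \<open>OK\<close>.\<close>

lemma unique_extension:
  "valuation_ring_of E A \<and> A \<inter> K = OK \<longleftrightarrow> A = level 0"
proof
  have E: "subring_set E" by unfold_locales
  assume A: "valuation_ring_of E A \<and> A \<inter> K = OK"
  then have sub: "subring_set A" using subring_set_of_subring[OF _ E] by (auto simp: valuation_ring_of_def)
  interpret A: subring_set A by fact
  interpret RE: cring "ring_on E" by (rule cring_ring_on[OF E])
  have AE: "A \<subseteq> E" using A subringE(1)[of A "ring_on E"] by (auto simp: valuation_ring_of_def)
  have val: "x \<in> A \<or> inverse x \<in> A" if "x \<in> E" for x
    using A that A.zero_mem by (cases "x = 0") (auto simp: valuation_ring_of_def)
  have O_A: "level 0 \<subseteq> A"
  proof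
    fix x assume x: "x \<in> level 0"
    have "integral_over A x" using integral_over_mono[OF _ integral_OK[OF x]] A by blast
    then show "x \<in> A" using valuation_ring_integrally_closed[OF sub] val level_mem[OF x] by blast
  qed
  have "x \<in> level 0" if x: "x \<in> A" for x
  proof (rule ccontr)
    assume nx: "x \<notin> level 0"
    have "x \<in> E" using AE x by blast
    then have x0: "x \<noteq> 0" "w x \<le> - 1" using nx levelI[of x 0] zero_level[of 0] by fastforce+
    have "w (inverse x ^ e) = - int e * w x" using x0 \<open>x \<in> E\<close> by (simp add: v_power v_inverse inverse_mem)
    moreover have "- int e * w x \<ge> int e" using x0(2) e_pos mult_left_mono[of 1 "- w x" "int e"] by simp
    moreover have piE: "\<pi> \<in> E" using pi_mem K_sub by blast
    moreover have "w (inverse x ^ e / \<pi>) = w (inverse x ^ e) - w \<pi>"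
      using piE pi_nz x0 \<open>x \<in> E\<close> by (intro v_divide) (auto intro: power_mem inverse_mem)
    moreover have "inverse x ^ e / \<pi> \<in> E" using piE \<open>x \<in> E\<close> by (intro divide_mem power_mem inverse_mem)
    ultimately have "inverse x ^ e / \<pi> \<in> level 0" using w_pi by (intro levelI) simp_all
    then have "x ^ e * (inverse x ^ e / \<pi>) \<in> A" using O_A x by (intro A.mult_mem A.power_mem) auto
    moreover have "x ^ e * (inverse x ^ e / \<pi>) = inverse \<pi>" using x0 pi_nz by (simp add: field_simps)
    ultimately have "inverse \<pi> \<in> A \<inter> K" using K.inverse_mem pi_mem by simp
    then have "inverse \<pi> \<in> level 0" using A by blast
    then show False using level_v[of "inverse \<pi>" 0] v_inverse[of \<pi>] pi_mem K_sub pi_nz w_pi e_pos by auto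
  qed
  then show "A = level 0" using O_A by blast
next
  assume "A = level 0"
  moreover have "subring (level 0) (ring_on E)"
    by (rule subring_ring_on) (auto simp: subring_level level_mem intro: subring_set_axioms)
  ultimately show "valuation_ring_of E A \<and> A \<inter> K = OK"
    unfolding valuation_ring_of_def using level0_or_inverse by blast
qed

lemma fundamental_equality: "fundamental_equality_no_splitting OK MK (level 0) (level 1)"
  unfolding fundamental_equality_no_splitting_def tot_quot_OK tot_quot_level
  using dvr_OK dvr_level K_sub unique_extension degree ramification_index residue_degree by blast

text \<open>\<open>level 0\<close> is integral over the smaller ring and integrally closed in E. The
  condition on t ensures that the quotient field of A is all of E.\<close>

lemma int_closure_eq:
  assumes A: "subring_set A" "OK \<subseteq> A" "A \<subseteq> level 0" and t: "\<And>l. l < e * f \<Longrightarrow> t l \<in> tot_quot A"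
  shows "int_closure A = level 0"
proof -
  interpret T: subfield_set "tot_quot A" by (rule subfield_set_tot_quot[OF A(1)])
  have "K \<subseteq> tot_quot A" using tot_quot_mono[OF subring_OK A(1,2)] tot_quot_OK by simp
  then have "(\<Sum>l<e * f. c l * t l) \<in> tot_quot A" if "\<forall>l<e * f. c l \<in> K" for c
    using that t by (intro T.sum_mem T.mult_mem) auto
  then have "E \<subseteq> tot_quot A" using span by blast
  moreover have "tot_quot A \<subseteq> E"
    by (rule tot_quot_least[OF A(1) subfield_set_axioms]) (use A(3) level_mem in blast)
  ultimately have tq: "tot_quot A = E" by blast
  show ?thesis
    unfolding int_closure_def tq
    using integral_over_level[OF A(1) _ A(3)] integral_over_mono[OF A(2) integral_OK] level_mem by blast
qed

text \<open>With f = 1 and \<open>t 0 = 1\<close>, \<open>residue_span\<close> says that every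
  element of \<open>level 0\<close> is congruent to one of \<open>OK\<close>, so reduction
  restricted to \<open>OK\<close> is surjective with kernel \<open>MK\<close>.\<close>

lemma residue_iso:
  assumes "f = 1" "t 0 = 1"
  shows "(ring_on (level 0) Quot level 1) \<simeq> (ring_on OK Quot MK)"
proof -
  interpret h: ring_hom_ring "ring_on (level 0)" "ring_on (level 0) Quot level 1" res by (rule res_hom)
  interpret RK: cring "ring_on OK" by (rule cring_ring_on[OF subring_OK])
  have hh: "ring_hom_ring (ring_on OK) (ring_on (level 0) Quot level 1) res"
  proof (rule ring_hom_ringI)
    show "res x \<in> carrier (ring_on (level 0) Quot level 1)" if "x \<in> carrier (ring_on OK)" for x
      using that h.hom_closed by simp
    show "res (x \<otimes>\<^bsub>ring_on OK\<^esub> y) = res x \<otimes>\<^bsub>ring_on (level 0) Quot level 1\<^esub> res y"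
      "res (x \<oplus>\<^bsub>ring_on OK\<^esub> y) = res x \<oplus>\<^bsub>ring_on (level 0) Quot level 1\<^esub> res y"
      if "x \<in> carrier (ring_on OK)" "y \<in> carrier (ring_on OK)" for x y
      using that h.hom_mult[of x y] h.hom_add[of x y] by simp_all
    show "res \<one>\<^bsub>ring_on OK\<^esub> = \<one>\<^bsub>ring_on (level 0) Quot level 1\<^esub>" using h.hom_one by simp
  qed (use RK.ring_axioms h.S.ring_axioms in auto)
  interpret g: ring_hom_ring "ring_on OK" "ring_on (level 0) Quot level 1" res by (rule hh)
  have ker: "a_kernel (ring_on OK) (ring_on (level 0) Quot level 1) res = MK"
  proof -
    have "res x = res 0 \<longleftrightarrow> x \<in> level 1" if "x \<in> level 0" for x using coset_eq[OF that zero_level] by simp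
    then have "a_kernel (ring_on OK) (ring_on (level 0) Quot level 1) res = OK \<inter> level 1"
      unfolding a_kernel_def' zero_res by (intro Set.set_eqI iffI) (use level_antimono[of 0 1] in auto)
    then show ?thesis using MK_Int by simp
  qed
  have surj: "res ` carrier (ring_on OK) = carrier (ring_on (level 0) Quot level 1)"
  proof -
    have "res x \<in> res ` OK" if x: "x \<in> level 0" for x
    proof -
      obtain c where c: "\<forall>i<f. c i \<in> OK" "x - (\<Sum>i<f. c i * t (e * i)) \<in> level 1" using residue_span[OF x] by blast
      then have "x - c 0 \<in> level 1" "c 0 \<in> OK" using assms by auto
      then show ?thesis using coset_eq[of x "c 0"] x by auto
    qed
    then show ?thesis by (auto simp: carrier_res)
  qed
  have "(ring_on OK Quot MK) \<simeq> (ring_on (level 0) Quot level 1)"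
    using g.FactRing_iso[OF surj] ker by simp
  moreover have "ring (ring_on OK Quot MK)"
    using dvr_OK by (intro ideal.quotient_is_ring maximalideal.axioms(1)) (simp add: dvr_def)
  ultimately show ?thesis by (rule ring_iso_sym[rotated])
qed

end

section \<open>Monomial valuations\<close>

definition polys_over :: "'l::comm_ring_1 set \<Rightarrow> 'l poly set" where
  "polys_over F = {P. \<forall>i. Polynomial.coeff P i \<in> F}"

definition frac_field :: "'l::field set \<Rightarrow> 'l \<Rightarrow> 'l set" where
  "frac_field F s = {poly P s / poly Q s | P Q. P \<in> polys_over F \<and> Q \<in> polys_over F \<and> poly Q s \<noteq> 0}"

definition transcendental_over :: "'l::field set \<Rightarrow> 'l \<Rightarrow> bool" where
  "transcendental_over F s \<longleftrightarrow> (\<forall>P\<in>polys_over F. poly P s = 0 \<longrightarrow> P = 0)"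

section \<open>Polynomials over subrings and the field F(s)\<close>

context subring_set
begin

lemma polys_over_coeff: "P \<in> polys_over A \<Longrightarrow> Polynomial.coeff P i \<in> A"
  by (simp add: polys_over_def)

lemma subring_polys_over: "subring_set (polys_over A)"
proof
  show "1 \<in> polys_over A" by (auto simp: polys_over_def Polynomial.coeff_1 mems)
  show "P - Q \<in> polys_over A" if "P \<in> polys_over A" "Q \<in> polys_over A" for P Q
    using that by (auto simp: polys_over_def mems)
  show "P * Q \<in> polys_over A" if "P \<in> polys_over A" "Q \<in> polys_over A" for P Q
    using that by (auto simp: polys_over_def Polynomial.coeff_mult intro!: sum_mem mult_mem)
qed

lemma monom_polys_over: "c \<in> A \<Longrightarrow> Polynomial.monom c n \<in> polys_over A"
  by (auto simp: polys_over_def zero_mem)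

lemma const_polys_over: "c \<in> A \<Longrightarrow> [:c:] \<in> polys_over A"
  using monom_polys_over[of c 0] by (simp add: monom_0)

lemma poly_mem: "P \<in> polys_over A \<Longrightarrow> x \<in> A \<Longrightarrow> poly P x \<in> A"
  unfolding poly_altdef by (intro sum_mem mult_mem power_mem) (auto simp: polys_over_def)

end

lemma polys_over_mono: "A \<subseteq> B \<Longrightarrow> polys_over A \<subseteq> polys_over B"
  by (auto simp: polys_over_def)

lemma poly_eq_sum_lessThan:
  fixes P :: "'a::comm_ring_1 poly"
  shows "Polynomial.degree P < N \<Longrightarrow> poly P x = (\<Sum>i<N. Polynomial.coeff P i * x ^ i)"
proof -
  assume "Polynomial.degree P < N"
  then have "(\<Sum>i\<le>Polynomial.degree P. Polynomial.coeff P i * x ^ i) = (\<Sum>i<N. Polynomial.coeff P i * x ^ i)"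
    by (intro sum.mono_neutral_left) (auto simp: coeff_eq_0)
  then show ?thesis by (simp add: poly_altdef)
qed

context subfield_set
begin

lemma subfield_frac_field: "subfield_set (frac_field F s)"
proof -
  interpret P: subring_set "polys_over F" by (rule subring_polys_over)
  have I: "z \<in> frac_field F s" if "z = poly P s / poly Q s" "P \<in> polys_over F" "Q \<in> polys_over F" "poly Q s \<noteq> 0" for z P Q
    using that unfolding frac_field_def by blast
  show ?thesis
  proof
    show "1 \<in> frac_field F s" by (rule I[of _ 1 1]) (auto simp: P.one_mem)
    show "x - y \<in> frac_field F s" "x * y \<in> frac_field F s"
      if xy: "x \<in> frac_field F s" "y \<in> frac_field F s" for x y
    proof -
      obtain P Q P' Q' where *: "x = poly P s / poly Q s" "y = poly P' s / poly Q' s" "P \<in> polys_over F"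
        "Q \<in> polys_over F" "P' \<in> polys_over F" "Q' \<in> polys_over F" "poly Q s \<noteq> 0" "poly Q' s \<noteq> 0"
        using xy unfolding frac_field_def by blast
      have "x - y = poly (P * Q' - P' * Q) s / poly (Q * Q') s" using *(7,8) unfolding *(1,2) by (simp add: diff_frac_eq)
      then show "x - y \<in> frac_field F s"
        by (rule I) (use * in \<open>auto intro: P.mems\<close>)
      have "x * y = poly (P * P') s / poly (Q * Q') s" unfolding *(1,2) by simp
      then show "x * y \<in> frac_field F s"
        by (rule I) (use * in \<open>auto intro: P.mems\<close>)
    qed
    show "inverse x \<in> frac_field F s" if x: "x \<in> frac_field F s" for x
    proof -
      obtain P Q where *: "x = poly P s / poly Q s" "P \<in> polys_over F" "Q \<in> polys_over F" "poly Q s \<noteq> 0"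
        using x unfolding frac_field_def by blast
      show ?thesis
      proof (cases "poly P s = 0")
        case True
        then show ?thesis using * by (intro I[of _ 0 1]) (auto simp: P.mems)
      next
        case False
        then show ?thesis using * by (intro I[of _ Q P]) auto
      qed
    qed
  qed
qed

lemma poly_in_frac_field: "P \<in> polys_over F \<Longrightarrow> poly P s \<in> frac_field F s"
proof -
  assume P: "P \<in> polys_over F"
  have "poly P s = poly P s / poly 1 s" "(1 :: 'l poly) \<in> polys_over F" "poly (1 :: 'l poly) s \<noteq> 0"
    using subring_set.one_mem[OF subring_polys_over] by auto
  then show ?thesis unfolding frac_field_def using P by blast
qed

lemma frac_field_incl: "F \<subseteq> frac_field F s" "s \<in> frac_field F s"
  using poly_in_frac_field[OF const_polys_over] poly_in_frac_field[OF monom_polys_over[OF one_mem, of 1], of s]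
  by (auto simp: poly_monom)

lemma frac_field_least:
  assumes "subfield_set L" "F \<subseteq> L" "s \<in> L" shows "frac_field F s \<subseteq> L"
proof -
  interpret L: subfield_set L by fact
  have "poly P s \<in> L" if "P \<in> polys_over F" for P
    using L.poly_mem polys_over_mono[OF assms(2)] that assms(3) by blast
  then show ?thesis by (auto simp: frac_field_def intro!: L.divide_mem)
qed

lemma transcendental_over_iff:
  "ring.transcendental ring_of_type_algebra F s \<longleftrightarrow> transcendental_over F s"
proof -
  interpret R: Ring.field "ring_of_type_algebra :: 'l ring" by (rule field_from_type_algebra)
  \<comment> \<open>HOL-Algebra stores a polynomial as a list with the leading coefficient first,
    hence the reversal.\<close>
  have ev: "R.eval xs s = poly (Poly (rev xs)) s" for xs
    by (induction xs) (simp_all add: Poly_snoc poly_monom)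
  have sub: "subring F ring_of_type_algebra" using subfieldE(1)[OF subfield] .
  show ?thesis
  proof
    assume tr: "R.transcendental F s"
    have "P = 0" if P: "P \<in> polys_over F" "poly P s = 0" for P
    proof (rule ccontr)
      assume nz: "P \<noteq> 0"
      let ?xs = "rev (coeffs P)"
      have "set ?xs \<subseteq> F" using P(1) by (auto simp: polys_over_def coeffs_def)
      moreover have "hd ?xs \<noteq> 0" "?xs \<noteq> []"
        using nz by (simp_all add: hd_rev last_coeffs_eq_coeff_degree)
      ultimately have "?xs \<in> carrier (F [X]\<^bsub>ring_of_type_algebra\<^esub>)"
        by (auto simp: univ_poly_carrier[symmetric] polynomial_def)
      moreover have "[] \<in> carrier (F [X]\<^bsub>ring_of_type_algebra\<^esub>)"
        by (auto simp: univ_poly_carrier[symmetric] polynomial_def)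
      moreover have "R.eval ?xs s = R.eval [] s" using ev[of ?xs] P(2) by simp
      ultimately have "?xs = []" using tr unfolding R.transcendental_def inj_on_def by blast
      then show False using nz by simp
    qed
    then show "transcendental_over F s" by (simp add: transcendental_over_def)
  next
    assume tr: "transcendental_over F s"
    show "R.transcendental F s"
    proof (rule ccontr)
      assume "R.algebraic F s"
      then have "(R.algebraic over F) s" by (simp add: over_def)
      then obtain p where p: "p \<in> carrier (F [X]\<^bsub>ring_of_type_algebra\<^esub>)" "p \<noteq> []" "R.eval p s = 0"
        using R.algebraicE[OF sub, of s] by auto
      have "set p \<subseteq> F" "hd p \<noteq> 0" using p by (auto simp: univ_poly_carrier[symmetric] polynomial_def)
      then have "Poly (rev p) \<in> polys_over F"
        by (auto simp: polys_over_def nth_default_def zero_mem) (metis length_rev nth_mem set_rev subsetD)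
      then have "Poly (rev p) = 0" using tr ev[of p] p(3) by (auto simp: transcendental_over_def)
      moreover have "Polynomial.coeff (Poly (rev p)) (length p - 1) = hd p"
        using p(2) by (simp add: nth_default_def rev_nth hd_conv_nth)
      ultimately show False using \<open>hd p \<noteq> 0\<close> by simp
    qed
  qed
qed

text \<open>Elements algebraic over F form a field, so if s were algebraic, its power would be too.
  This transfers transcendence from u to its roots.\<close>

lemma transcendental_root:
  assumes "transcendental_over F (s ^ n)" shows "transcendental_over F s"
proof (rule ccontr)
  interpret R: Ring.field "ring_of_type_algebra :: 'l ring" by (rule field_from_type_algebra)
  assume "\<not> transcendental_over F s"
  then have "(R.algebraic over F) s"
    using transcendental_over_iff by (simp add: over_def)
  moreover have "subfield {x \<in> carrier ring_of_type_algebra. (R.algebraic over F) x} ring_of_type_algebra"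
    by (rule R.subfield_of_algebraics[OF subfield])
  ultimately have "(R.algebraic over F) (s ^ n)"
  proof (induction n)
    case 0
    then show ?case using subringE(3)[OF subfieldE(1)] by fastforce
  next
    case (Suc n)
    then show ?case using subringE(6)[OF subfieldE(1)] by fastforce
  qed
  moreover have "transcendental_over F x \<longleftrightarrow> R.transcendental F x" for x
    using subfield_set.transcendental_over_iff[OF subfield_set_axioms] by blast
  ultimately show False using assms by (simp add: over_def)
qed

text \<open>Since \<open>s\<close> is a root of \<open>Y ^ q - s ^ q\<close>, the combinations on the right already form the field
  generated by \<open>s\<close>.\<close>

lemma power_basis_span:
  assumes "0 < q" "x \<in> frac_field F s"
  shows "\<exists>c. (\<forall>l<q. c l \<in> frac_field F (s ^ q)) \<and> x = (\<Sum>l<q. c l * s ^ l)"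
proof -
  interpret R: Ring.field "ring_of_type_algebra :: 'l ring" by (rule field_from_type_algebra)
  define K where "K = frac_field F (s ^ q)"
  interpret K: subfield_set K unfolding K_def by (rule subfield_frac_field)
  have sq: "s ^ q \<in> K" unfolding K_def by (rule frac_field_incl)
  define P where "P = Polynomial.monom 1 q - [:s ^ q:]"
  have "P \<in> polys_over K"
    unfolding P_def using K.monom_polys_over[OF K.one_mem] K.const_polys_over[OF sq]
      subring_set.diff_mem[OF K.subring_polys_over] by blast
  moreover have "poly P s = 0" by (simp add: P_def poly_monom)
  moreover have "Polynomial.coeff P q = 1" using assms(1) by (simp add: P_def coeff_pCons split: nat.split)
  then have "P \<noteq> 0" by auto
  ultimately have "\<not> transcendental_over K s" by (auto simp: transcendental_over_def)
  then have "(R.algebraic over K) s" using K.transcendental_over_iff by (simp add: over_def)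
  then have S: "subfield (R.simple_extension K s) ring_of_type_algebra"
    using R.simple_extension_is_subfield[OF K.subfield, of s] by simp
  have "subfield_set (R.simple_extension K s)"
  proof
    show "1 \<in> R.simple_extension K s" using subringE(3)[OF subfieldE(1)[OF S]] by simp
    fix x y assume xy: "x \<in> R.simple_extension K s" "y \<in> R.simple_extension K s"
    show "x * y \<in> R.simple_extension K s" using subringE(6)[OF subfieldE(1)[OF S] xy] by simp
    have "x + - y \<in> R.simple_extension K s"
      using subringE(5,7)[OF subfieldE(1)[OF S]] xy by fastforce
    then show "x - y \<in> R.simple_extension K s" by simp
  next
    fix x assume x: "x \<in> R.simple_extension K s"
    show "inverse x \<in> R.simple_extension K s"
    proof (cases "x = 0")
      case False
      then have "inv\<^bsub>ring_of_type_algebra\<^esub> x = inverse x" by (intro R.inv_char) auto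
      then show ?thesis using R.subfield_m_inv(1)[OF S, of x] x False by simp
    qed (use x in simp)
  qed
  moreover have "K \<subseteq> R.simple_extension K s" "s \<in> R.simple_extension K s"
    using R.simple_extension_incl[of K s]
      R.simple_extension.lin[OF R.simple_extension.zero, of _ K s]
      R.simple_extension.lin[OF R.simple_extension.lin[OF R.simple_extension.zero K.one_mem] K.zero_mem, of s] by auto
  ultimately have sub: "frac_field F s \<subseteq> R.simple_extension K s"
    using frac_field_incl(1)[of "s ^ q"] by (intro frac_field_least) (auto simp: K_def)
  have "\<exists>c. (\<forall>l<q. c l \<in> K) \<and> x = (\<Sum>l<q. c l * s ^ l)" if "x \<in> R.simple_extension K s" for x
    using that
  proof induction
    case zero
    show ?case by (intro exI[of _ "\<lambda>_. 0"]) (simp add: K.zero_mem)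
  next
    case (lin k1 k2)
    then obtain c where c: "\<forall>l<q. c l \<in> K" "k1 = (\<Sum>l<q. c l * s ^ l)" by blast
    obtain r where r: "q = Suc r" using assms(1) by (cases q) auto
    \<comment> \<open>Multiplication by s shifts the coefficients; the top one wraps around to the
      constant term, because \<open>s ^ q\<close> lies in K.\<close>
    define d where "d l = (case l of 0 \<Rightarrow> c r * s ^ q + k2 | Suc l \<Rightarrow> c l)" for l
    have "(\<Sum>l<q. d l * s ^ l) = c r * s ^ q + k2 + (\<Sum>l<r. c l * s ^ Suc l)"
      unfolding r sum.lessThan_Suc_shift by (simp add: d_def r)
    also have "\<dots> = k1 * s + k2"
      unfolding c(2) r by (simp add: sum_distrib_left algebra_simps)
    finally have "k1 * s + k2 = (\<Sum>l<q. d l * s ^ l)" by simp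
    moreover have "\<forall>l<q. d l \<in> K" using c(1) lin r sq by (auto simp: d_def intro!: K.mems split: nat.split)
    ultimately show ?case by auto
  qed
  then show ?thesis using sub assms(2) by (auto simp: K_def)
qed

end

text \<open>The construction starts from a \<open>valued_field\<close> instead of a
  \<open>disc_val\<close> because it is applied to h v, which for h > 1 takes no value 1 on F; in
  F(s) it is s that becomes the uniformizer.\<close>

locale mono_val = valued_field F v for F :: "'l::field set" and v +
  fixes s :: 'l
  assumes trans: "transcendental_over F s"
begin

interpretation PF: subring_set "polys_over F" by (rule subring_polys_over)

lemma poly_s_eq_0: "P \<in> polys_over F \<Longrightarrow> poly P s = 0 \<longleftrightarrow> P = 0"
  using trans by (auto simp: transcendental_over_def)

lemma poly_s_inj: "P \<in> polys_over F \<Longrightarrow> Q \<in> polys_over F \<Longrightarrow> poly P s = poly Q s \<Longrightarrow> P = Q"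
  using poly_s_eq_0[of "P - Q"] PF.diff_mem by simp

definition wt :: "'l poly \<Rightarrow> int" where
  "wt P = Min ((\<lambda>i. v (Polynomial.coeff P i) + int i) ` {i. Polynomial.coeff P i \<noteq> 0})"

lemma finite_support: "finite {i. Polynomial.coeff P i \<noteq> 0}"
  by (rule finite_subset[of _ "{..Polynomial.degree P}"]) (auto intro: le_degree)

lemma wt_le: "Polynomial.coeff P i \<noteq> 0 \<Longrightarrow> wt P \<le> v (Polynomial.coeff P i) + int i"
  unfolding wt_def using finite_support[of P] by (intro Min_le) auto

lemma wt_attained:
  assumes "P \<noteq> 0" obtains i where "Polynomial.coeff P i \<noteq> 0" "wt P = v (Polynomial.coeff P i) + int i"
proof -
  have "{i. Polynomial.coeff P i \<noteq> 0} \<noteq> {}" using assms by (auto simp: poly_eq_iff)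
  then have "wt P \<in> (\<lambda>i. v (Polynomial.coeff P i) + int i) ` {i. Polynomial.coeff P i \<noteq> 0}"
    unfolding wt_def using finite_support[of P] by (intro Min_in) auto
  then show thesis using that by blast
qed

lemma wt_ge_iff:
  assumes "P \<in> polys_over F" "P \<noteq> 0"
  shows "m \<le> wt P \<longleftrightarrow> (\<forall>i. Polynomial.coeff P i \<in> level (m - int i))"
proof
  assume "m \<le> wt P"
  then show "\<forall>i. Polynomial.coeff P i \<in> level (m - int i)"
    using wt_le[of P] polys_over_coeff[OF assms(1)] by (force intro!: levelI)
next
  assume *: "\<forall>i. Polynomial.coeff P i \<in> level (m - int i)"
  obtain i where "Polynomial.coeff P i \<noteq> 0" "wt P = v (Polynomial.coeff P i) + int i" using wt_attained[OF assms(2)] .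
  then show "m \<le> wt P" using level_v[of "Polynomial.coeff P i" "m - int i"] * by auto
qed

text \<open>The first coefficients attaining the minimum in the two factors contribute the only term
  of minimal value to a coefficient of the product.\<close>

lemma wt_mult:
  assumes P: "P \<in> polys_over F" "P \<noteq> 0" and Q: "Q \<in> polys_over F" "Q \<noteq> 0"
  shows "wt (P * Q) = wt P + wt Q"
proof -
  let ?p = "Polynomial.coeff P" and ?q = "Polynomial.coeff Q"
  have PQ: "P * Q \<in> polys_over F" "P * Q \<noteq> 0" using P Q PF.mult_mem by auto
  have pl: "?p i \<in> level (wt P - int i)" and ql: "?q i \<in> level (wt Q - int i)" for i
    using wt_ge_iff[OF P, of "wt P"] wt_ge_iff[OF Q, of "wt Q"] by auto
  have tl: "?p i * ?q (n - i) \<in> level (wt P + wt Q - int n)" if "i \<le> n" for i n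
    using level_mult[OF pl[of i] ql[of "n - i"]] that by (simp add: of_nat_diff algebra_simps)
  have ge: "wt P + wt Q \<le> wt (P * Q)"
    unfolding wt_ge_iff[OF PQ] Polynomial.coeff_mult using tl by (auto intro!: level_sum)
  define i0 where "i0 = (LEAST i. ?p i \<noteq> 0 \<and> wt P = v (?p i) + int i)"
  define j0 where "j0 = (LEAST i. ?q i \<noteq> 0 \<and> wt Q = v (?q i) + int i)"
  have i0: "?p i0 \<noteq> 0" "wt P = v (?p i0) + int i0"
    using wt_attained[OF P(2)] LeastI_ex[of "\<lambda>i. ?p i \<noteq> 0 \<and> wt P = v (?p i) + int i"] unfolding i0_def by metis+
  have j0: "?q j0 \<noteq> 0" "wt Q = v (?q j0) + int j0"
    using wt_attained[OF Q(2)] LeastI_ex[of "\<lambda>i. ?q i \<noteq> 0 \<and> wt Q = v (?q i) + int i"] unfolding j0_def by metis+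
  have ps: "?p i \<in> level (wt P - int i + 1)" if "i < i0" for i
    using not_less_Least[of i "\<lambda>i. ?p i \<noteq> 0 \<and> wt P = v (?p i) + int i"] that wt_le[of P i] polys_over_coeff[OF P(1)]
    unfolding i0_def[symmetric] by (intro levelI) auto
  have qs: "?q i \<in> level (wt Q - int i + 1)" if "i < j0" for i
    using not_less_Least[of i "\<lambda>i. ?q i \<noteq> 0 \<and> wt Q = v (?q i) + int i"] that wt_le[of Q i] polys_over_coeff[OF Q(1)]
    unfolding j0_def[symmetric] by (intro levelI) auto
  let ?n = "i0 + j0"
  have rest: "?p i * ?q (?n - i) \<in> level (wt P + wt Q - int ?n + 1)" if "i \<le> ?n" "i \<noteq> i0" for i
  proof (cases "i < i0")
    case True
    then show ?thesis using level_mult[OF ps[of i] ql[of "?n - i"]] that(1) by (simp add: of_nat_diff algebra_simps)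
  next
    case False
    then have "?n - i < j0" using that by auto
    then show ?thesis using level_mult[OF pl[of i] qs[of "?n - i"]] that(1) by (simp add: of_nat_diff algebra_simps)
  qed
  let ?x = "?p i0 * ?q j0" and ?y = "\<Sum>i\<in>{..?n} - {i0}. ?p i * ?q (?n - i)"
  have x: "?x \<in> F" "?x \<noteq> 0" "v ?x = wt P + wt Q - int ?n"
    using i0 j0 P Q polys_over_coeff by (auto simp: v_mult mult_mem)
  have y: "?y \<in> level (v ?x + 1)" unfolding x(3) using rest by (intro level_sum) auto
  have "Polynomial.coeff (P * Q) ?n = ?x + ?y"
    unfolding Polynomial.coeff_mult by (subst sum.remove[of _ i0]) auto
  then have "Polynomial.coeff (P * Q) ?n \<noteq> 0" "v (Polynomial.coeff (P * Q) ?n) = wt P + wt Q - int ?n"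
    using v_add_strict[OF x(1,2) y] x(3) by simp_all
  then show ?thesis using wt_le[of "P * Q" ?n] ge by simp
qed

text \<open>Any representation as a fraction may be used: transcendence turns equal fractions into a
  polynomial identity, and \<open>wt_mult\<close> makes the difference of weights agree.\<close>

definition w :: "'l \<Rightarrow> int" where
  "w x = (THE n. \<exists>P\<in>polys_over F. \<exists>Q\<in>polys_over F. P \<noteq> 0 \<and> Q \<noteq> 0 \<and> x = poly P s / poly Q s \<and> n = wt P - wt Q)"

lemma w_eq:
  assumes "P \<in> polys_over F" "P \<noteq> 0" "Q \<in> polys_over F" "Q \<noteq> 0"
  shows "w (poly P s / poly Q s) = wt P - wt Q"
  unfolding w_def
proof (rule the_equality)
  fix n assume "\<exists>P'\<in>polys_over F. \<exists>Q'\<in>polys_over F. P' \<noteq> 0 \<and> Q' \<noteq> 0 \<and> poly P s / poly Q s = poly P' s / poly Q' s \<and> n = wt P' - wt Q'"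
  then obtain P' Q' where *: "P' \<in> polys_over F" "Q' \<in> polys_over F" "P' \<noteq> 0" "Q' \<noteq> 0"
    "poly P s / poly Q s = poly P' s / poly Q' s" "n = wt P' - wt Q'" by blast
  have "poly (P * Q') s = poly (P' * Q) s"
    using *(5) poly_s_eq_0[OF assms(3)] poly_s_eq_0[OF *(2)] assms(4) *(4) by (simp add: field_simps)
  then have "P * Q' = P' * Q" using poly_s_inj * assms PF.mult_mem by blast
  then have "wt P + wt Q' = wt P' + wt Q" using wt_mult assms * by metis
  then show "n = wt P - wt Q" using *(6) by simp
qed (use assms in blast)

lemma frac_fieldE:
  assumes "x \<in> frac_field F s" "x \<noteq> 0"
  obtains P Q where "P \<in> polys_over F" "Q \<in> polys_over F" "P \<noteq> 0" "Q \<noteq> 0" "x = poly P s / poly Q s"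
  using assms unfolding frac_field_def by fastforce

sublocale W: valued_field "frac_field F s" w
proof -
  interpret L: subfield_set "frac_field F s" by (rule subfield_frac_field)
  show "valued_field (frac_field F s) w"
  proof
    fix x y assume xy: "x \<in> frac_field F s" "y \<in> frac_field F s" "x \<noteq> 0" "y \<noteq> 0"
    obtain P Q where *: "P \<in> polys_over F" "Q \<in> polys_over F" "P \<noteq> 0" "Q \<noteq> 0" "x = poly P s / poly Q s"
      using frac_fieldE xy by metis
    obtain P' Q' where **: "P' \<in> polys_over F" "Q' \<in> polys_over F" "P' \<noteq> 0" "Q' \<noteq> 0" "y = poly P' s / poly Q' s"
      using frac_fieldE xy by metis
    have "x * y = poly (P * P') s / poly (Q * Q') s" using * ** by simp
    then have "w (x * y) = wt (P * P') - wt (Q * Q')" using w_eq[of "P * P'" "Q * Q'"] * ** PF.mult_mem by simp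
    then show "w (x * y) = w x + w y" using * ** wt_mult w_eq by simp
    assume nz: "x + y \<noteq> 0"
    define R where "R = P * Q' + P' * Q"
    have "x + y = poly R s / poly (Q * Q') s"
      unfolding *(5) **(5) using * ** poly_s_eq_0[of Q] poly_s_eq_0[of Q'] by (simp add: R_def add_frac_eq)
    moreover have R: "R \<in> polys_over F" unfolding R_def using * ** by (intro PF.mems)
    moreover have "R \<noteq> 0" using calculation(1) nz by auto
    ultimately have wxy: "w (x + y) = wt R - wt (Q * Q')" using w_eq[of R "Q * Q'"] * ** PF.mult_mem by simp
    define m where "m = min (wt (P * Q')) (wt (P' * Q))"
    have "Polynomial.coeff (P * Q') i \<in> level (m - int i)" "Polynomial.coeff (P' * Q) i \<in> level (m - int i)" for i
      using wt_ge_iff[of "P * Q'" m] wt_ge_iff[of "P' * Q" m] * ** PF.mult_mem by (auto simp: m_def)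
    then have "m \<le> wt R" unfolding wt_ge_iff[OF R \<open>R \<noteq> 0\<close>] by (auto simp: R_def intro: level_add)
    then show "min (w x) (w y) \<le> w (x + y)"
      unfolding wxy m_def using * ** w_eq wt_mult by (auto simp: min_def)
  qed
qed

lemma poly_s_mem: "P \<in> polys_over F \<Longrightarrow> poly P s \<in> frac_field F s"
  by (rule poly_in_frac_field)

lemma w_poly: "P \<in> polys_over F \<Longrightarrow> P \<noteq> 0 \<Longrightarrow> w (poly P s) = wt P"
proof -
  assume P: "P \<in> polys_over F" "P \<noteq> 0"
  have "wt 1 + wt 1 = wt (1 :: 'l poly)" using wt_mult[of 1 1] PF.one_mem by simp
  then show ?thesis using w_eq[OF P PF.one_mem] by simp
qed

lemma w_const: "c \<in> F \<Longrightarrow> c \<noteq> 0 \<Longrightarrow> w c = v c"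
proof -
  assume c: "c \<in> F" "c \<noteq> 0"
  have "{i. Polynomial.coeff [:c:] i \<noteq> 0} = {0}" using c by (auto simp: coeff_pCons' split: if_splits)
  then have "wt [:c:] = v c" by (simp add: wt_def)
  then show ?thesis using w_poly[OF const_polys_over[OF c(1)]] c by simp
qed

lemma w_s: "w s = 1"
proof -
  have "{i. Polynomial.coeff (Polynomial.monom (1::'l) 1) i \<noteq> 0} = {1}" by auto
  then have "wt (Polynomial.monom 1 1) = 1" by (simp add: wt_def v_one)
  then show ?thesis using w_poly[OF monom_polys_over[OF one_mem, of 1]] by (simp add: poly_monom monom_eq_0_iff)
qed

lemma s_nz: "s \<noteq> 0"
  using poly_s_eq_0[OF monom_polys_over[OF one_mem, of 1]] by (auto simp: poly_monom monom_eq_0_iff)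

sublocale W: disc_val "frac_field F s" w s
  by unfold_locales (use frac_field_incl s_nz w_s in auto)

lemma poly_level_iff:
  assumes "P \<in> polys_over F"
  shows "poly P s \<in> W.level m \<longleftrightarrow> (\<forall>i. Polynomial.coeff P i \<in> level (m - int i))"
proof (cases "P = 0")
  case False
  then have "poly P s \<in> W.level m \<longleftrightarrow> m \<le> wt P"
    using w_poly[OF assms] poly_s_mem[OF assms] poly_s_eq_0[OF assms] by (auto simp: W.level_def)
  then show ?thesis using wt_ge_iff[OF assms False] by simp
qed (simp add: W.zero_level zero_level)

text \<open>The exponents iq + l with l < q are pairwise distinct, so in \<Sum> P_l(s^q) s^l nothing
  cancels: the coefficients of the sum are those of the \<open>P l\<close>, sorted into residue
  classes modulo q.\<close>

lemma interleave:
  assumes "0 < q" "\<And>l. l < q \<Longrightarrow> P l \<in> polys_over F"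
  obtains R where "R \<in> polys_over F" "poly R s = (\<Sum>l<q. poly (P l) (s ^ q) * s ^ l)"
    "\<And>i l. l < q \<Longrightarrow> Polynomial.coeff R (i * q + l) = Polynomial.coeff (P l) i"
proof -
  define M where "M = Suc (\<Sum>l<q. Polynomial.degree (P l))"
  have M: "Polynomial.degree (P l) < M" if "l < q" for l
    using that member_le_sum[of l "{..<q}" "\<lambda>l. Polynomial.degree (P l)"] by (simp add: M_def)
  define g where "g n = Polynomial.coeff (P (n mod q)) (n div q)" for n
  define R where "R = (\<Sum>n<M * q. Polynomial.monom (g n) n)"
  have cR: "Polynomial.coeff R n = (if n < M * q then g n else 0)" for n
    by (simp add: R_def Polynomial.coeff_sum)
  have gF: "g n \<in> F" for n using assms polys_over_coeff by (simp add: g_def)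
  have "poly R s = (\<Sum>n<M * q. g n * s ^ n)" by (simp add: R_def poly_sum poly_monom)
  also have "\<dots> = (\<Sum>i<M. \<Sum>n=i*q..<i*q+q. g n * s ^ n)" by (rule sum.nat_group[symmetric])
  also have "\<dots> = (\<Sum>i<M. \<Sum>l<q. g (i * q + l) * s ^ (i * q + l))"
  proof (rule sum.cong[OF refl])
    fix i
    show "(\<Sum>n=i*q..<i*q+q. g n * s ^ n) = (\<Sum>l<q. g (i * q + l) * s ^ (i * q + l))"
      using sum.atLeastLessThan_shift_0[of "\<lambda>n. g n * s ^ n" "i * q" "i * q + q"]
      by (simp add: lessThan_atLeast0)
  qed
  also have "\<dots> = (\<Sum>i<M. \<Sum>l<q. Polynomial.coeff (P l) i * (s ^ q) ^ i * s ^ l)"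
    using assms(1) by (intro sum.cong refl) (simp add: g_def power_add power_mult[symmetric] mult.commute[of q])
  also have "\<dots> = (\<Sum>l<q. (\<Sum>i<M. Polynomial.coeff (P l) i * (s ^ q) ^ i) * s ^ l)"
    by (subst sum.swap) (simp add: sum_distrib_right)
  also have "\<dots> = (\<Sum>l<q. poly (P l) (s ^ q) * s ^ l)"
    using M poly_eq_sum_lessThan by (intro sum.cong refl) fastforce
  finally have "poly R s = (\<Sum>l<q. poly (P l) (s ^ q) * s ^ l)" .
  moreover have "R \<in> polys_over F" using gF zero_mem by (auto simp: polys_over_def cR)
  moreover have "Polynomial.coeff R (i * q + l) = Polynomial.coeff (P l) i" if "l < q" for i l
  proof (cases "i < M")
    case True
    then have "Suc i * q \<le> M * q" by (intro mult_le_mono1) simp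
    then show ?thesis using that by (simp add: cR g_def)
  next
    case False
    then have "M * q \<le> i * q" by simp
    then have "\<not> i * q + l < M * q" by linarith
    moreover have "Polynomial.coeff (P l) i = 0" using M[OF that] False by (intro coeff_eq_0) simp
    ultimately show ?thesis by (simp add: cR)
  qed
  ultimately show thesis using that by blast
qed

lemma interleave_single:
  assumes q: "0 < q" and P: "P \<in> polys_over F" and l: "l < q"
  obtains R where "R \<in> polys_over F" "poly R s = poly P (s ^ q) * s ^ l"
    "\<And>i j. j < q \<Longrightarrow> Polynomial.coeff R (i * q + j) = (if j = l then Polynomial.coeff P i else 0)"
proof -
  define P' where "P' j = (if j = l then P else 0)" for j
  have "P' j \<in> polys_over F" for j using P PF.zero_mem by (simp add: P'_def)
  then obtain R where R: "R \<in> polys_over F" "poly R s = (\<Sum>j<q. poly (P' j) (s ^ q) * s ^ j)"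
    "\<And>i j. j < q \<Longrightarrow> Polynomial.coeff R (i * q + j) = Polynomial.coeff (P' j) i"
    using interleave[OF q, of P'] by metis
  have "poly R s = poly P (s ^ q) * s ^ l"
    unfolding R(2) using l by (subst sum.remove[of _ l]) (auto simp: P'_def intro!: sum.neutral)
  moreover have "Polynomial.coeff R (i * q + j) = (if j = l then Polynomial.coeff P i else 0)" if "j < q" for i j
    using R(3)[OF that] by (simp add: P'_def)
  ultimately show thesis using that R(1) by blast
qed

lemma common_denominator:
  fixes c :: "nat \<Rightarrow> 'l"
  assumes "\<And>l. l < q \<Longrightarrow> c l \<in> frac_field F y"
  obtains P Q where "\<And>l. l < q \<Longrightarrow> P l \<in> polys_over F" "Q \<in> polys_over F" "poly Q y \<noteq> 0"
    "\<And>l. l < q \<Longrightarrow> c l = poly (P l) y / poly Q y"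
proof -
  have "\<exists>P Q. (\<forall>l<q. P l \<in> polys_over F) \<and> Q \<in> polys_over F \<and> poly Q y \<noteq> 0 \<and> (\<forall>l<q. c l = poly (P l) y / poly Q y)"
    using assms
  proof (induction q)
    case 0
    show ?case by (intro exI[of _ "\<lambda>_. 0"] exI[of _ 1]) (simp add: PF.one_mem)
  next
    case (Suc q)
    then obtain P Q where PQ: "\<forall>l<q. P l \<in> polys_over F" "Q \<in> polys_over F" "poly Q y \<noteq> 0"
      "\<forall>l<q. c l = poly (P l) y / poly Q y" using Suc.IH[OF Suc.prems[OF less_SucI]] by blast
    obtain A B where AB: "c q = poly A y / poly B y" "A \<in> polys_over F" "B \<in> polys_over F" "poly B y \<noteq> 0"
      using Suc.prems[of q] by (auto simp: frac_field_def)
    show ?case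
    proof (intro exI[of _ "\<lambda>l. if l < q then P l * B else A * Q"] exI[of _ "Q * B"] conjI)
      show "\<forall>l<Suc q. (if l < q then P l * B else A * Q) \<in> polys_over F"
        using PQ AB PF.mult_mem by auto
      show "\<forall>l<Suc q. c l = poly (if l < q then P l * B else A * Q) y / poly (Q * B) y"
        using PQ AB by (auto simp: less_Suc_eq)
    qed (use PQ AB PF.mult_mem in auto)
  qed
  then show thesis using that by blast
qed

text \<open>After multiplication by a common denominator the sum is a polynomial R in s, and its
  l-th summand keeps exactly the coefficients of R at exponents congruent to l modulo q. Bounds on
  all coefficients pass to this selection.\<close>

lemma power_basis_ortho:
  assumes q: "0 < q" and c: "\<forall>l<q. c l \<in> frac_field F (s ^ q)" and S: "(\<Sum>l<q. c l * s ^ l) \<in> W.level m" and l: "l < q"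
  shows "c l * s ^ l \<in> W.level m"
proof -
  obtain P Q where PQ: "\<And>l. l < q \<Longrightarrow> P l \<in> polys_over F" "Q \<in> polys_over F" "poly Q (s ^ q) \<noteq> 0"
    "\<And>l. l < q \<Longrightarrow> c l = poly (P l) (s ^ q) / poly Q (s ^ q)"
    using common_denominator[of q c "s ^ q"] c by metis
  let ?d = "poly Q (s ^ q)"
  have "poly Q (s ^ q) \<in> frac_field F (s ^ q)" using PQ(2) by (rule poly_in_frac_field)
  moreover have "frac_field F (s ^ q) \<subseteq> frac_field F s"
    by (rule frac_field_least[OF subfield_frac_field]) (use frac_field_incl W.power_mem in auto)
  ultimately have d: "?d \<in> frac_field F s" "?d \<noteq> 0" using PQ(3) by auto
  obtain R where R: "R \<in> polys_over F" "poly R s = (\<Sum>l<q. poly (P l) (s ^ q) * s ^ l)"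
    "\<And>i l. l < q \<Longrightarrow> Polynomial.coeff R (i * q + l) = Polynomial.coeff (P l) i"
    using interleave[OF q, of P] PQ(1) by blast
  have "poly R s = ?d * (\<Sum>l<q. c l * s ^ l)"
    unfolding R(2) sum_distrib_left using PQ(3,4) by (intro sum.cong) auto
  then have RL: "poly R s \<in> W.level (m + w ?d)" using W.level_scale[OF d, of _ "m + w ?d"] S by simp
  obtain R' where R': "R' \<in> polys_over F" "poly R' s = poly (P l) (s ^ q) * s ^ l"
    "\<And>i j. j < q \<Longrightarrow> Polynomial.coeff R' (i * q + j) = (if j = l then Polynomial.coeff (P l) i else 0)"
    using interleave_single[OF q PQ(1)[OF l] l] by blast
  have "Polynomial.coeff R' n \<in> level (m + w ?d - int n)" for n
  proof -
    have n: "n = (n div q) * q + n mod q" "n mod q < q" using q by simp_all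
    have "Polynomial.coeff R' n = (if n mod q = l then Polynomial.coeff R n else 0)"
      using R'(3)[OF n(2), of "n div q"] R(3)[OF n(2), of "n div q"] n(1) by simp
    then show ?thesis using RL unfolding poly_level_iff[OF R(1)] by (simp add: zero_level)
  qed
  then have "poly R' s \<in> W.level (m + w ?d)" using poly_level_iff[OF R'(1)] by blast
  moreover have "poly R' s = ?d * (c l * s ^ l)" using PQ(3) PQ(4)[OF l] R'(2) by simp
  ultimately show ?thesis using W.level_scale[OF d, of _ "m + w ?d"] by simp
qed

text \<open>A polynomial in \<open>s ^ q\<close> has only exponents divisible by q, so its weight is
  a value of v plus a multiple of q. With h v for v and g = h, this determines the value group of
  F(s^q).\<close>

lemma dvd_w:
  assumes q: "0 < q" and g: "g dvd int q" "\<And>x. x \<in> F \<Longrightarrow> x \<noteq> 0 \<Longrightarrow> g dvd v x"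
    and x: "x \<in> frac_field F (s ^ q)" "x \<noteq> 0"
  shows "g dvd w x"
proof -
  have pl: "g dvd w (poly P (s ^ q))" "poly P (s ^ q) \<in> frac_field F s" if P: "P \<in> polys_over F" "poly P (s ^ q) \<noteq> 0" for P
  proof -
    obtain R where R: "R \<in> polys_over F" "poly R s = poly P (s ^ q) * s ^ 0"
      "\<And>i j. j < q \<Longrightarrow> Polynomial.coeff R (i * q + j) = (if j = 0 then Polynomial.coeff P i else 0)"
      using interleave_single[OF q P(1) q] by blast
    then have eq: "poly R s = poly P (s ^ q)" by simp
    then have "R \<noteq> 0" using P(2) by auto
    then obtain n where n: "Polynomial.coeff R n \<noteq> 0" "wt R = v (Polynomial.coeff R n) + int n" using wt_attained by metis
    have n': "n = (n div q) * q + n mod q" "n mod q < q" using q by simp_all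
    then have "n mod q = 0" using R(3)[OF n'(2), of "n div q"] n(1) by (auto split: if_splits)
    then have "int q dvd int n" by auto
    then have "g dvd wt R" using n(2) g(2)[OF polys_over_coeff[OF R(1)] n(1)] g(1) by (metis dvd_add dvd_trans)
    then show "g dvd w (poly P (s ^ q))" using w_poly[OF R(1) \<open>R \<noteq> 0\<close>] eq by simp
    show "poly P (s ^ q) \<in> frac_field F s" using poly_s_mem[OF R(1)] eq by simp
  qed
  obtain P Q where *: "x = poly P (s ^ q) / poly Q (s ^ q)" "P \<in> polys_over F" "Q \<in> polys_over F" "poly Q (s ^ q) \<noteq> 0"
    using x(1) unfolding frac_field_def by blast
  then have "poly P (s ^ q) \<noteq> 0" using x(2) by auto
  then show ?thesis unfolding *(1) using W.v_divide pl * by simp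
qed

end

section \<open>The tower of Gauss extensions\<close>

lemma frac_field_power_subset:
  assumes "subfield_set F" shows "frac_field F (s ^ q) \<subseteq> frac_field F s"
proof -
  interpret F: subfield_set F by fact
  interpret E: subfield_set "frac_field F s" by (rule F.subfield_frac_field)
  show ?thesis
    by (rule F.frac_field_least[OF F.subfield_frac_field]) (use F.frac_field_incl E.power_mem in auto)
qed

text \<open>Here s stands for the root of u of order hk. The constant k enters only later, through
  an element of F of value k.\<close>

locale monomial_tower = disc_val F v \<pi> for F :: "'l::field set" and v :: "'l \<Rightarrow> int" and \<pi> :: 'l +
  fixes s :: 'l and h :: nat
  assumes h_pos: "0 < h" and trans_s: "transcendental_over F s"
begin

lemma valued_field_scaled: "valued_field F (\<lambda>x. int h * v x)"
proof
  show "int h * v (x * y) = int h * v x + int h * v y" if "x \<in> F" "y \<in> F" "x \<noteq> 0" "y \<noteq> 0" for x y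
    using that by (simp add: v_mult algebra_simps)
  show "min (int h * v x) (int h * v y) \<le> int h * v (x + y)"
    if "x \<in> F" "y \<in> F" "x \<noteq> 0" "y \<noteq> 0" "x + y \<noteq> 0" for x y
  proof -
    have "v x \<le> v (x + y) \<or> v y \<le> v (x + y)" using v_add[OF that] by (simp add: min_le_iff_disj)
    then show ?thesis by (auto simp: min_le_iff_disj intro: mult_left_mono)
  qed
qed

sublocale X: mono_val F "\<lambda>x. int h * v x" s
  using valued_field_scaled trans_s by (simp add: mono_val_def mono_val_axioms_def)

abbreviation "E \<equiv> frac_field F s"
abbreviation "w \<equiv> X.w"
abbreviation "lev \<equiv> X.W.level"

lemma level_scaled: "X.level (int h * m) = level m"
  using h_pos by (auto simp: X.level_def level_def)

lemma level_scaled_iff: "x \<in> X.level m \<longleftrightarrow> x \<in> F \<and> (x \<noteq> 0 \<longrightarrow> m \<le> int h * v x)"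
  by (auto simp: X.level_def)

lemma w_pi: "w \<pi> = int h"
  using X.w_const[OF unif_mem unif_nz] v_unif by simp

lemma pi_E: "\<pi> \<in> E"
  using frac_field_incl(1) unif_mem by blast

lemma const_lev: "c \<in> F \<Longrightarrow> c \<in> lev (int h * m) \<longleftrightarrow> c \<in> level m"
  using X.w_const[of c] frac_field_incl(1)[of s] h_pos
  by (cases "c = 0") (auto simp: X.W.level_def level_def subset_iff)

text \<open>The power s^l has value l and \<pi> has value h, so dividing by \<pi>^(l div h) leaves
  the remainder l mod h. As \<pi> lies in the base field, this rescaling affects neither spanning
  nor orthogonality. For q = h the case is U below D, for q = hk it is W below D.\<close>

lemma val_ext_power:
  assumes q: "0 < q" "h dvd q"
  shows "val_ext E w s (frac_field F (s ^ q)) \<pi> (\<lambda>l. s ^ l / \<pi> ^ (l div h)) h (q div h)"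
proof -
  let ?K = "frac_field F (s ^ q)"
  interpret K: subfield_set ?K by (rule subfield_frac_field)
  have hq: "h * (q div h) = q" using q by simp
  have KE: "?K \<subseteq> E" by (rule frac_field_power_subset) unfold_locales
  have piK: "\<pi> \<in> ?K" using frac_field_incl(1) unif_mem by blast
  have sE: "s \<in> E" by (rule frac_field_incl)
  show ?thesis
  proof
    show "?K \<subseteq> E" by (rule KE)
    show "0 < q div h" using q h_pos by (auto elim!: dvdE)
    show "int h dvd w x" if "x \<in> ?K" "x \<noteq> 0" for x
      using X.dvd_w[OF q(1) _ _ that, of "int h"] q(2) by auto
    show "s ^ l / \<pi> ^ (l div h) \<in> E" for l
      using sE pi_E by (intro X.W.divide_mem X.W.power_mem)
    show "s ^ l / \<pi> ^ (l div h) \<noteq> 0" for l using X.s_nz unif_nz by simp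
    show "w (s ^ l / \<pi> ^ (l div h)) = int (l mod h)" for l
    proof -
      have "w (s ^ l / \<pi> ^ (l div h)) = int l - int (l div h) * int h"
        using sE pi_E X.s_nz unif_nz by (simp add: X.W.v_divide X.W.v_power X.W.power_mem X.w_s w_pi)
      also have "\<dots> = int (l mod h)" using div_mult_mod_eq[of l h] by (metis add_diff_cancel_left' of_nat_add of_nat_mult)
      finally show ?thesis .
    qed
    show "\<exists>c. (\<forall>l<h * (q div h). c l \<in> ?K) \<and> x = (\<Sum>l<h * (q div h). c l * (s ^ l / \<pi> ^ (l div h)))" if x: "x \<in> E" for x
    proof -
      obtain c where c: "\<forall>l<q. c l \<in> ?K" "x = (\<Sum>l<q. c l * s ^ l)" using power_basis_span[OF q(1) x] by blast
      have "x = (\<Sum>l<q. (c l * \<pi> ^ (l div h)) * (s ^ l / \<pi> ^ (l div h)))" using c(2) unif_nz by simp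
      moreover have "\<forall>l<q. c l * \<pi> ^ (l div h) \<in> ?K" using c(1) K.mult_mem[OF _ K.power_mem[OF piK]] by simp
      ultimately show ?thesis unfolding hq by (intro exI[of _ "\<lambda>l. c l * \<pi> ^ (l div h)"] conjI)
    qed
    show "c l * (s ^ l / \<pi> ^ (l div h)) \<in> lev m"
      if "\<forall>l<h * (q div h). c l \<in> ?K" "(\<Sum>l<h * (q div h). c l * (s ^ l / \<pi> ^ (l div h))) \<in> lev m" "l < h * (q div h)"
      for c m l
    proof -
      define d where "d l = c l / \<pi> ^ (l div h)" for l
      have "\<forall>l<q. d l \<in> ?K" using that(1) piK unfolding hq d_def by (auto intro: K.divide_mem K.power_mem)
      moreover have "(\<Sum>l<q. d l * s ^ l) \<in> lev m" using that(2) unfolding hq by (simp add: d_def)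
      ultimately have "d l * s ^ l \<in> lev m" using X.power_basis_ortho[OF q(1)] that(3) unfolding hq by blast
      then show ?thesis by (simp add: d_def)
    qed
  qed (use h_pos piK unif_nz w_pi in auto)
qed

text \<open>On F(s^h) the values are divided by h. Then s^h has value 1 like \<pi>, so all basis
  elements are units: the extension of W by U is unramified and its degree is purely
  residual.\<close>

lemma val_ext_middle:
  assumes k: "0 < k"
  shows "val_ext (frac_field F (s ^ h)) (\<lambda>x. w x div int h) \<pi> (frac_field F (s ^ (h * k))) \<pi> (\<lambda>l. (s ^ h) ^ l / \<pi> ^ l) 1 k"
proof -
  interpret UD: val_ext E w s "frac_field F (s ^ h)" \<pi> "\<lambda>l. s ^ l / \<pi> ^ (l div h)" h "h div h"
    by (rule val_ext_power) (use h_pos in auto)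
  let ?K = "frac_field F (s ^ (h * k))" and ?L = "frac_field F (s ^ h)"
  interpret K: subfield_set ?K by (rule subfield_frac_field)
  interpret L: disc_val ?L "\<lambda>x. w x div int h" \<pi> by (rule UD.disc_val_K)
  have KL: "?K \<subseteq> ?L" unfolding power_mult by (rule frac_field_power_subset) unfold_locales
  have LE: "?L \<subseteq> E" by (rule UD.K_sub)
  have piK: "\<pi> \<in> ?K" using frac_field_incl(1) unif_mem by blast
  have piL: "\<pi> \<in> ?L" using frac_field_incl(1) unif_mem by blast
  have shL: "s ^ h \<in> ?L" by (rule frac_field_incl)
  have wsh: "w (s ^ h) = int h" using X.W.v_power[of s h] frac_field_incl(2) X.s_nz X.w_s by simp
  show ?thesis
  proof
    show "?K \<subseteq> ?L" by (rule KL)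
    show "(s ^ h) ^ l / \<pi> ^ l \<in> ?L" for l
      by (rule L.divide_mem[OF L.power_mem[OF shL] L.power_mem[OF piL]])
    show "(s ^ h) ^ l / \<pi> ^ l \<noteq> 0" for l using X.s_nz unif_nz by simp
    show "w ((s ^ h) ^ l / \<pi> ^ l) div int h = int (l mod 1)" for l
    proof -
      have "w ((s ^ h) ^ l / \<pi> ^ l) = 0"
        using X.W.v_divide[OF X.W.power_mem[OF subsetD[OF LE shL]] X.W.power_mem[OF pi_E], of l l]
          X.W.v_power[OF subsetD[OF LE shL]] X.W.v_power[OF pi_E] X.s_nz unif_nz wsh w_pi by simp
      then show ?thesis by simp
    qed
    show "\<exists>c. (\<forall>l<1 * k. c l \<in> ?K) \<and> x = (\<Sum>l<1 * k. c l * ((s ^ h) ^ l / \<pi> ^ l))" if x: "x \<in> ?L" for x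
    proof -
      obtain c where c: "\<forall>l<k. c l \<in> ?K" "x = (\<Sum>l<k. c l * (s ^ h) ^ l)"
        using power_basis_span[OF k x] unfolding power_mult by blast
      have "x = (\<Sum>l<k. (c l * \<pi> ^ l) * ((s ^ h) ^ l / \<pi> ^ l))" using c(2) unif_nz by simp
      moreover have "\<forall>l<k. c l * \<pi> ^ l \<in> ?K" using c(1) K.mult_mem[OF _ K.power_mem[OF piK]] by simp
      ultimately show ?thesis by auto
    qed
    show "c l * ((s ^ h) ^ l / \<pi> ^ l) \<in> L.level m"
      if c: "\<forall>l<1 * k. c l \<in> ?K" "(\<Sum>l<1 * k. c l * ((s ^ h) ^ l / \<pi> ^ l)) \<in> L.level m" "l < 1 * k"
      for c m l
    proof -
      \<comment> \<open>Placing the coefficients at the multiples of h, with zeros elsewhere, turns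
        the sum into one over powers of s, where \<open>power_basis_ortho\<close> is
        available.\<close>
      define d where "d j = (if h dvd j then c (j div h) / \<pi> ^ (j div h) else 0)" for j
      have dK: "\<forall>j<h * k. d j \<in> ?K"
        using c(1) piK h_pos K.zero_mem by (auto simp: d_def intro!: K.divide_mem K.power_mem elim!: dvdE)
      have "(\<Sum>l<k. c l * ((s ^ h) ^ l / \<pi> ^ l)) = (\<Sum>j\<in>(\<lambda>l. h * l) ` {..<k}. d j * s ^ j)"
        using h_pos by (subst sum.reindex) (auto simp: inj_on_def d_def power_mult)
      also have "\<dots> = (\<Sum>j<h * k. d j * s ^ j)"
        using h_pos by (intro sum.mono_neutral_left) (auto simp: d_def elim!: dvdE)
      finally have S: "(\<Sum>l<k. c l * ((s ^ h) ^ l / \<pi> ^ l)) = (\<Sum>j<h * k. d j * s ^ j)" .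
      have "(\<Sum>j<h * k. d j * s ^ j) \<in> lev (int h * m)" using c(2) S unfolding UD.level_K by simp
      then have "d (h * l) * s ^ (h * l) \<in> lev (int h * m)"
        using X.power_basis_ortho[OF _ dK, of "int h * m" "h * l"] h_pos k c(3) by simp
      then have "c l * ((s ^ h) ^ l / \<pi> ^ l) \<in> lev (int h * m)" using h_pos by (simp add: d_def power_mult)
      moreover have "c l * ((s ^ h) ^ l / \<pi> ^ l) \<in> ?L"
        using c(1,3) KL by (intro L.mult_mem L.divide_mem[OF L.power_mem[OF shL] L.power_mem[OF piL]]) auto
      ultimately show ?thesis unfolding UD.level_K by simp
    qed
  qed (use k piK unif_nz w_pi h_pos in auto)
qed

text \<open>On polynomials in \<beta>/u, an element of value 0, the monomial valuation is the Gauss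
  valuation: the least value of the coefficients, scaled by h.\<close>

lemma gauss_level:
  assumes k: "0 < k" and beta: "\<beta> \<in> F" "\<beta> \<noteq> 0" "v \<beta> = int k" and P: "P \<in> polys_over F"
  shows "poly P (inverse (s ^ (h * k)) * \<beta>) \<in> lev (int h * m) \<longleftrightarrow> (\<forall>i. Polynomial.coeff P i \<in> level m)"
proof -
  let ?n = "h * k" and ?y = "inverse (s ^ (h * k)) * \<beta>" and ?d = "Polynomial.degree P"
  \<comment> \<open>R(s) is P(\<beta>/u) times u^deg P. The i-th term has value h v(c_i) + hki in
    its coefficient and exponent hk(d - i), so all terms are shifted by the same hkd and sit at
    different exponents.\<close>
  define R where "R = (\<Sum>i\<le>?d. Polynomial.monom (Polynomial.coeff P i * \<beta> ^ i) (?n * (?d - i)))"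
  have RF: "R \<in> polys_over F"
    unfolding R_def using P beta polys_over_coeff
    by (intro subring_set.sum_mem[OF subring_polys_over] monom_polys_over mult_mem power_mem) auto
  have s0: "s \<noteq> 0" by (rule X.s_nz)
  have "poly R s = (\<Sum>i\<le>?d. Polynomial.coeff P i * \<beta> ^ i * (s ^ ?n) ^ (?d - i))"
    by (simp add: R_def poly_sum poly_monom power_mult)
  also have "\<dots> = (s ^ ?n) ^ ?d * poly P ?y"
    unfolding poly_altdef sum_distrib_left
  proof (rule sum.cong)
    fix i assume "i \<in> {..?d}"
    then have "(s ^ ?n) ^ ?d = (s ^ ?n) ^ (?d - i) * (s ^ ?n) ^ i" by (simp add: power_add[symmetric])
    then show "Polynomial.coeff P i * \<beta> ^ i * (s ^ ?n) ^ (?d - i) = (s ^ ?n) ^ ?d * (Polynomial.coeff P i * ?y ^ i)"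
      using s0 by (simp add: power_mult_distrib power_inverse field_simps)
  qed simp
  finally have Rs: "poly R s = s ^ (?n * ?d) * poly P ?y" by (simp add: power_mult)
  have sE: "s ^ (?n * ?d) \<in> E" "s ^ (?n * ?d) \<noteq> 0" "w (s ^ (?n * ?d)) = int (?n * ?d)"
    using s0 X.W.power_mem[of s "?n * ?d"] frac_field_incl(2) X.W.v_power[of s "?n * ?d"] X.w_s by auto
  have "poly P ?y \<in> lev (int h * m) \<longleftrightarrow> poly R s \<in> lev (int h * m + int (?n * ?d))"
    unfolding Rs X.W.level_scale[OF sE(1,2)] sE(3) by simp
  also have "\<dots> \<longleftrightarrow> (\<forall>j. Polynomial.coeff R j \<in> X.level (int h * m + int (?n * ?d) - int j))"
    by (rule X.poly_level_iff[OF RF])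
  also have "\<dots> \<longleftrightarrow> (\<forall>i\<le>?d. Polynomial.coeff P i \<in> level m)"
  proof -
    have n: "0 < ?n" using h_pos k by simp
    have cR: "Polynomial.coeff R (?n * (?d - i)) = Polynomial.coeff P i * \<beta> ^ i" if "i \<le> ?d" for i
    proof -
      have "Polynomial.coeff R (?n * (?d - i)) = (\<Sum>j\<le>?d. if j = i then Polynomial.coeff P j * \<beta> ^ j else 0)"
        unfolding R_def Polynomial.coeff_sum using n that by (intro sum.cong) auto
      then show ?thesis using that by simp
    qed
    have eq: "Polynomial.coeff P i * \<beta> ^ i \<in> X.level (int h * m + int (?n * ?d) - int (?n * (?d - i))) \<longleftrightarrow> Polynomial.coeff P i \<in> level m"
      if "i \<le> ?d" for i
    proof -
      have "int h * m + int (?n * ?d) - int (?n * (?d - i)) = int h * (m + int (i * k))"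
        using that by (simp add: of_nat_diff algebra_simps)
      moreover have "\<beta> ^ i * Polynomial.coeff P i \<in> level (m + int (i * k)) \<longleftrightarrow> Polynomial.coeff P i \<in> level m"
        using level_scale[of "\<beta> ^ i" "Polynomial.coeff P i" "m + int (i * k)"] beta by (simp add: v_power power_mem)
      ultimately show ?thesis by (simp only: level_scaled mult.commute)
    qed
    have "Polynomial.coeff R j = 0" if "\<And>i. i \<le> ?d \<Longrightarrow> j \<noteq> ?n * (?d - i)" for j
      unfolding R_def Polynomial.coeff_sum using that by (intro sum.neutral) auto
    then show ?thesis using cR eq X.zero_level by metis
  qed
  also have "\<dots> \<longleftrightarrow> (\<forall>i. Polynomial.coeff P i \<in> level m)"
    using coeff_eq_0[of P] zero_level by (metis not_le)
  finally show ?thesis .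
qed

end

section \<open>The ring V[\<beta>/u] and its localization at the extension of N\<close>

lemma ring_gen_adjoin:
  assumes "subring_set V"
  shows "ring_gen (V \<union> {x}) = (\<lambda>P. poly P x) ` polys_over V"
proof
  interpret V: subring_set V by fact
  interpret P: subring_set "polys_over V" by (rule V.subring_polys_over)
  interpret A: subring_set "ring_gen (V \<union> {x})" by (rule subring_set_ring_gen)
  have "subring_set ((\<lambda>P. poly P x) ` polys_over V)"
  proof
    show "1 \<in> (\<lambda>P. poly P x) ` polys_over V" using P.one_mem by (force intro: image_eqI[of _ _ 1])
    show "a - b \<in> (\<lambda>P. poly P x) ` polys_over V" "a * b \<in> (\<lambda>P. poly P x) ` polys_over V"
      if ab: "a \<in> (\<lambda>P. poly P x) ` polys_over V" "b \<in> (\<lambda>P. poly P x) ` polys_over V" for a b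
    proof -
      obtain P Q where PQ: "P \<in> polys_over V" "Q \<in> polys_over V" "a = poly P x" "b = poly Q x" using ab by blast
      have "a - b = poly (P - Q) x" "a * b = poly (P * Q) x" by (simp_all add: PQ)
      then show "a - b \<in> (\<lambda>P. poly P x) ` polys_over V" "a * b \<in> (\<lambda>P. poly P x) ` polys_over V"
        using P.diff_mem[OF PQ(1,2)] P.mult_mem[OF PQ(1,2)] by blast+
    qed
  qed
  then show "ring_gen (V \<union> {x}) \<subseteq> (\<lambda>P. poly P x) ` polys_over V"
  proof (rule ring_gen_least)
    have "c \<in> (\<lambda>P. poly P x) ` polys_over V" if "c \<in> V" for c
      using V.const_polys_over[OF that] by (force intro: image_eqI[of _ _ "[:c:]"])
    moreover have "x \<in> (\<lambda>P. poly P x) ` polys_over V"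
      using V.monom_polys_over[OF V.one_mem, of 1] by (force simp: poly_monom intro: image_eqI[of _ _ "Polynomial.monom 1 1"])
    ultimately show "V \<union> {x} \<subseteq> (\<lambda>P. poly P x) ` polys_over V" by blast
  qed
  have "V \<subseteq> ring_gen (V \<union> {x})" "x \<in> ring_gen (V \<union> {x})" by (auto intro: ring_gen_incl)
  then show "(\<lambda>P. poly P x) ` polys_over V \<subseteq> ring_gen (V \<union> {x})"
    using A.poly_mem polys_over_mono by blast
qed

lemma genideal_adjoin:
  assumes V: "subring_set V" and N: "ideal N (ring_on V)"
  shows "genideal (ring_on (ring_gen (V \<union> {x}))) N = (\<lambda>P. poly P x) ` polys_over N" (is "_ = ?J")
proof -
  let ?A = "ring_gen (V \<union> {x})"
  have A: "subring_set ?A" by (rule subring_set_ring_gen)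
  interpret A: subring_set ?A by fact
  interpret R: cring "ring_on ?A" by (rule cring_ring_on[OF A])
  note Nd = idealD_ring_on[OF N]
  have NA: "N \<subseteq> carrier (ring_on ?A)" using Nd(1) by (auto intro: ring_gen_incl)
  have xA: "x \<in> ?A" by (auto intro: ring_gen_incl)
  have Nsum: "sum f S \<in> N" if "\<And>i. i \<in> S \<Longrightarrow> f i \<in> N" for f :: "nat \<Rightarrow> 'a" and S
    using that by (induction S rule: infinite_finite_induct) (auto intro: Nd)
  have "ideal ?J (ring_on ?A)"
    unfolding ideal_ring_on_iff[OF A]
  proof (intro conjI ballI)
    show "?J \<subseteq> ?A"
      using A.poly_mem[OF _ xA] polys_over_mono[of N ?A] NA by auto
    show "0 \<in> ?J" using Nd(2) by (force intro: image_eqI[of _ _ 0] simp: polys_over_def)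
    show "a + b \<in> ?J" if ab: "a \<in> ?J" "b \<in> ?J" for a b
    proof -
      obtain P Q where PQ: "P \<in> polys_over N" "Q \<in> polys_over N" "a = poly P x" "b = poly Q x" using ab by blast
      then have "P + Q \<in> polys_over N" using Nd(3) by (auto simp: polys_over_def)
      then show ?thesis using PQ by (force intro: image_eqI[of _ _ "P + Q"])
    qed
    show "a * b \<in> ?J" if ab: "a \<in> ?A" "b \<in> ?J" for a b
    proof -
      obtain P Q where PQ: "P \<in> polys_over V" "Q \<in> polys_over N" "a = poly P x" "b = poly Q x"
        using ab unfolding ring_gen_adjoin[OF V] by blast
      then have "P * Q \<in> polys_over N" using Nd(4) by (auto simp: polys_over_def Polynomial.coeff_mult intro!: Nsum)
      then show ?thesis using PQ by (force intro: image_eqI[of _ _ "P * Q"])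
    qed
  qed
  moreover have "N \<subseteq> ?J"
  proof
    fix c assume "c \<in> N"
    then have "[:c:] \<in> polys_over N" using Nd(2) by (auto simp: polys_over_def coeff_pCons split: nat.split)
    then show "c \<in> ?J" by (force intro: image_eqI[of _ _ "[:c:]"])
  qed
  ultimately have "genideal (ring_on ?A) N \<subseteq> ?J" by (rule R.genideal_minimal)
  moreover have "?J \<subseteq> genideal (ring_on ?A) N"
  proof
    fix b assume "b \<in> ?J"
    then obtain P where P: "P \<in> polys_over N" "b = poly P x" by blast
    have I: "ideal (genideal (ring_on ?A) N) (ring_on ?A)" by (rule R.genideal_ideal[OF NA])
    have "Polynomial.coeff P i * x ^ i \<in> genideal (ring_on ?A) N" for i
    proof -
      have "Polynomial.coeff P i \<in> genideal (ring_on ?A) N"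
        using P(1) R.genideal_self[OF NA] by (auto simp: polys_over_def)
      then show ?thesis using idealD_ring_on(4)[OF I A.power_mem[OF xA]] by (simp add: mult.commute)
    qed
    moreover define J where "J = genideal (ring_on ?A) N"
    then have "sum f S \<in> J" if "\<And>i. f i \<in> J" for f :: "nat \<Rightarrow> 'a" and S
      using that idealD_ring_on(2,3)[OF I] by (induction S rule: infinite_finite_induct) auto
    ultimately show "b \<in> genideal (ring_on ?A) N" unfolding P(2) poly_altdef J_def by simp
  qed
  ultimately show ?thesis by blast
qed

context monomial_tower
begin

text \<open>By \<open>gauss_level\<close>, membership in V[\<beta>/u] and in its prime generated by
  N is read off from the value, so the localization at that prime consists of the elements of F(u)
  of nonnegative value.\<close>

lemma rees_extension_eq:
  assumes k: "0 < k" and beta: "\<beta> \<in> F" "\<beta> \<noteq> 0" "v \<beta> = int k"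
  shows "rees_extension (level 0) (level 1) \<beta> (s ^ (h * k)) = frac_field F (s ^ (h * k)) \<inter> lev 0"
proof -
  let ?u = "s ^ (h * k)" and ?x = "inverse (s ^ (h * k)) * \<beta>"
  let ?A = "ring_gen (level 0 \<union> {?x})" and ?p = "genideal (ring_on (ring_gen (level 0 \<union> {?x}))) (level 1)"
  have A: "?A = (\<lambda>P. poly P ?x) ` polys_over (level 0)" by (rule ring_gen_adjoin[OF subring_level])
  have p: "?p = (\<lambda>P. poly P ?x) ` polys_over (level 1)" by (rule genideal_adjoin[OF subring_level ideal_level]) simp
  note G = gauss_level[OF k beta]
  have L0: "polys_over (level m) \<subseteq> polys_over F" for m by (rule polys_over_mono) (auto intro: level_mem)
  have u0: "?u \<noteq> 0" using X.s_nz by simp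
  interpret L: subfield_set "frac_field F ?u" by (rule subfield_frac_field)
  have xL: "?x \<in> frac_field F ?u"
    by (intro L.mult_mem L.inverse_mem frac_field_incl(2)) (use beta frac_field_incl in auto)
  \<comment> \<open>Since u = \<beta>/x, elements of F(u) are fractions of polynomials in x, to
    which \<open>gauss_level\<close> applies.\<close>
  have LX: "frac_field F ?u \<subseteq> frac_field F ?x"
  proof (rule frac_field_least[OF subfield_frac_field])
    interpret X: subfield_set "frac_field F ?x" by (rule subfield_frac_field)
    show "F \<subseteq> frac_field F ?x" by (rule frac_field_incl)
    have "\<beta> * inverse ?x \<in> frac_field F ?x" 
      by (rule X.mult_mem[OF subsetD[OF frac_field_incl(1) beta(1)] X.inverse_mem[OF frac_field_incl(2)]])
    moreover have "\<beta> * inverse ?x = ?u" using beta u0 by (simp add: field_simps)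
    ultimately show "?u \<in> frac_field F ?x" by metis
  qed
  have coeff: "P \<in> polys_over (level m) \<longleftrightarrow> (\<forall>i. Polynomial.coeff P i \<in> level m)" for P m by (simp add: polys_over_def)
  show ?thesis
  proof (intro Set.equalityI subsetI)
    fix z assume "z \<in> rees_extension (level 0) (level 1) \<beta> ?u"
    then obtain a b where ab: "z = a / b" "a \<in> ?A" "b \<in> ?A" "b \<notin> ?p" by (auto simp: rees_extension_def localization_at_def)
    obtain P Q where PQ: "P \<in> polys_over (level 0)" "Q \<in> polys_over (level 0)" "a = poly P ?x" "b = poly Q ?x"
      using ab(2,3) unfolding A by blast
    have PQF: "P \<in> polys_over F" "Q \<in> polys_over F" using PQ L0 by auto
    have aL: "a \<in> lev 0" "b \<in> lev 0" using G[OF PQF(1), of 0] G[OF PQF(2), of 0] PQ by (auto simp: polys_over_def)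
    have "Q \<notin> polys_over (level 1)" using ab(4) PQ(4) unfolding p by blast
    then have b1: "b \<notin> lev (int h * 1)" using G[OF PQF(2), of 1] PQ(4) coeff by blast
    have bL: "b \<in> frac_field F ?u" "a \<in> frac_field F ?u"
      using L.poly_mem[OF _ xL] PQ polys_over_mono[OF frac_field_incl(1)] PQF by blast+
    have bnz: "b \<noteq> 0" using b1 X.W.zero_level by metis
    \<comment> \<open>Some coefficient of the denominator is outside N, so the value lies in [0, h);
      values on F(u) are multiples of h, hence it is 0.\<close>
    have "w b < int h" using b1 bnz aL(2) X.W.level_mem[OF aL(2)] by (auto simp: X.W.level_def)
    moreover have "int h dvd w b" using X.dvd_w[of "h * k" "int h" b] h_pos k bL bnz by auto
    moreover have "0 \<le> w b" using X.W.level_v[OF aL(2) bnz] .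
    ultimately have "w b = 0" by (metis less_le_not_le zdvd_imp_le order_le_less)
    then have "inverse b \<in> lev 0" using X.W.v_inverse[OF X.W.level_mem[OF aL(2)] bnz]
      by (intro X.W.levelI X.W.inverse_mem X.W.level_mem[OF aL(2)]) simp
    then have "z \<in> lev 0" unfolding ab(1) divide_inverse using aL(1) X.W.O.mult_mem by blast
    then show "z \<in> frac_field F ?u \<inter> lev 0" using bL L.divide_mem ab(1) by blast
  next
    fix z assume z: "z \<in> frac_field F ?u \<inter> lev 0"
    then obtain P Q where PQ: "P \<in> polys_over F" "Q \<in> polys_over F" "poly Q ?x \<noteq> 0" "z = poly P ?x / poly Q ?x"
      using LX unfolding frac_field_def by blast
    have "Q \<noteq> 0" using PQ(3) by auto
    then have "\<exists>i. Polynomial.coeff Q i \<noteq> 0" by (auto simp: poly_eq_iff)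
    moreover have "finite {i. Polynomial.coeff Q i \<noteq> 0}" by (rule X.finite_support)
    ultimately obtain i where i: "Polynomial.coeff Q i \<noteq> 0" "\<And>j. Polynomial.coeff Q j \<noteq> 0 \<Longrightarrow> v (Polynomial.coeff Q i) \<le> v (Polynomial.coeff Q j)"
      using ex_is_arg_min_if_finite[of "{i. Polynomial.coeff Q i \<noteq> 0}" "\<lambda>i. v (Polynomial.coeff Q i)"]
      by (auto simp: is_arg_min_linorder)
    \<comment> \<open>Dividing by a coefficient of least value makes one coefficient of the
      denominator 1 and the others integral. The denominator then has value 0 and avoids the prime,
      and the numerator inherits nonnegative value from z.\<close>
    let ?c = "inverse (Polynomial.coeff Q i)"
    have cF: "?c \<in> F" "?c \<noteq> 0" "v ?c = - v (Polynomial.coeff Q i)"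
      using i(1) polys_over_coeff[OF PQ(2)] by (auto simp: inverse_mem v_inverse)
    define Q' where "Q' = Polynomial.smult ?c Q"
    define P' where "P' = Polynomial.smult ?c P"
    have QF: "Q' \<in> polys_over F" "P' \<in> polys_over F" using PQ cF by (auto simp: polys_over_def Q'_def P'_def mult_mem)
    have zz: "z = poly P' ?x / poly Q' ?x" "poly Q' ?x \<noteq> 0" using PQ cF by (auto simp: P'_def Q'_def)
    have "?c * Polynomial.coeff Q j \<in> level 0" for j
      unfolding level_scale[OF cF(1,2)] cF(3) using i(2)[of j] polys_over_coeff[OF PQ(2)] by (auto intro: levelI)
    then have Q0: "Q' \<in> polys_over (level 0)" by (auto simp: polys_over_def Q'_def)
    have Qi: "Polynomial.coeff Q' i = 1" using i(1) by (simp add: Q'_def)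
    have Q1: "Q' \<notin> polys_over (level 1)"
    proof
      assume "Q' \<in> polys_over (level 1)"
      then have "Polynomial.coeff Q' i \<in> level 1" using coeff by blast
      then show False using v_one level_v[of 1 1] Qi by simp
    qed
    have notp: "poly Q' ?x \<notin> ?p"
    proof
      assume "poly Q' ?x \<in> ?p"
      then obtain R where R: "R \<in> polys_over (level 1)" "poly Q' ?x = poly R ?x" unfolding p by blast
      then have "poly Q' ?x \<in> lev (int h * 1)" using G[OF subsetD[OF L0 R(1)], of 1] R coeff by metis
      then show False using G[OF QF(1), of 1] Q1 coeff by blast
    qed
    have "poly Q' ?x \<in> lev (int h * 0)" using G[OF QF(1), of 0] Q0 coeff by blast
    then have "poly P' ?x \<in> lev (int h * 0)"
      using z zz X.W.O.mult_mem[of z "poly Q' ?x"] by simp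
    then have "P' \<in> polys_over (level 0)" using G[OF QF(2), of 0] coeff by blast
    then show "z \<in> rees_extension (level 0) (level 1) \<beta> ?u"
      unfolding rees_extension_def localization_at_def using zz(1) notp Q0 A by blast
  qed
qed

text \<open>The three instances of \<open>val_ext\<close> have (e, f) = (1, k) for W below U, (h, k)
  for W below D and (h, 1) for U below D. The rings enter through equations so that the result can
  be used a second time with h = 1, where the top ring is U itself.\<close>

theorem tower:
  assumes k: "0 < k" and beta: "\<beta> \<in> F" "\<beta> \<noteq> 0" "v \<beta> = int k"
    and W_def: "W = rees_extension (level 0) (level 1) \<beta> (s ^ (h * k))"
    and Q_def: "Q = genideal (ring_on W) (level 1)"
    and U_def: "U = int_closure (ring_gen (W \<union> {s ^ h}))"
    and D_def: "D = int_closure (ring_gen (W \<union> {s}))"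
    and P_def: "P = cgenideal (ring_on U) (s ^ h)"
    and M_def: "M = cgenideal (ring_on D) s"
  shows "D = int_closure (ring_gen (U \<union> {s}))
    \<and> dvr U P \<and> dvr D M
    \<and> finite_free_extension W U \<and> integral_extension_domain W U
    \<and> finite_free_extension W D \<and> integral_extension_domain W D
    \<and> has_ramification_index P D M h \<and> has_ramification_index Q U P 1
    \<and> has_degree U D h \<and> has_degree W U k
    \<and> (ring_on D Quot M) \<simeq> (ring_on U Quot P)
    \<and> has_residue_degree W Q U P k
    \<and> fundamental_equality_no_splitting W Q U P
    \<and> fundamental_equality_no_splitting W Q D M
    \<and> fundamental_equality_no_splitting U P D M"
    and "D = lev 0"
proof -
  let ?K = "frac_field F (s ^ (h * k))" and ?L = "frac_field F (s ^ h)"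
  have hk: "h * k div h = k" "h div h = 1" using h_pos by auto
  interpret UD: val_ext E w s ?L \<pi> "\<lambda>l. s ^ l / \<pi> ^ (l div h)" h 1
    using val_ext_power[of h] h_pos by simp
  interpret WD: val_ext E w s ?K \<pi> "\<lambda>l. s ^ l / \<pi> ^ (l div h)" h k
    using val_ext_power[of "h * k"] h_pos k by simp
  interpret WU: val_ext ?L "\<lambda>x. w x div int h" \<pi> ?K \<pi> "\<lambda>l. (s ^ h) ^ l / \<pi> ^ l" 1 k
    by (rule val_ext_middle[OF k])
  interpret L: subfield_set ?L by (rule subfield_frac_field)
  interpret K: subfield_set ?K by (rule subfield_frac_field)
  have KL: "?K \<subseteq> ?L" by (rule WU.K_sub)
  have L0: "WU.level 0 = ?L \<inter> lev 0" using UD.level_K[of 0] by simp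
  have L1: "WU.level 1 = ?L \<inter> lev 1" using UD.OK_level(2) by simp
  have W: "W = ?K \<inter> lev 0" unfolding W_def by (rule rees_extension_eq[OF k beta])
  have KW: "?K \<inter> WU.level 0 = W" "?K \<inter> WU.level 1 = ?K \<inter> lev 1" using KL W L0 L1 by auto
  have shL: "s ^ h \<in> ?L" and sE: "s \<in> E" by (rule frac_field_incl)+
  have wsh: "w (s ^ h) = int h" using X.W.v_power[OF sE] X.s_nz X.w_s by simp
  have shE: "s ^ h \<in> E" using sE X.W.power_mem by blast
  have sh0: "s ^ h \<in> WU.level 0" unfolding L0 using shL shE wsh by (auto intro: X.W.levelI)
  have s0: "s \<in> lev 0" using sE X.w_s by (auto intro: X.W.levelI)
  have subW: "subring_set W" using WD.subring_OK W by simp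
  \<comment> \<open>The basis elements are powers of s or s^h over powers of \<pi>. With \<pi> in W
    they lie in the quotient fields of the adjoined rings, as \<open>int_closure_eq\<close>
    asks.\<close>
  have piW: "\<pi> \<in> W" unfolding W using frac_field_incl(1) unif_mem pi_E w_pi by (auto intro!: X.W.levelI)
  have piA: "\<pi> \<in> tot_quot A" "x \<in> tot_quot A" if "subring_set A" "W \<subseteq> A" "x \<in> A" for A x
    using piW tot_quot_incl[OF that(1)] that by auto
  have frac: "x ^ i / \<pi> ^ j \<in> tot_quot A" if "subring_set A" "W \<subseteq> A" "x \<in> A" for A x i j
  proof -
    interpret T: subfield_set "tot_quot A" by (rule subfield_set_tot_quot[OF that(1)])
    show ?thesis using piA[OF that] by (intro T.divide_mem T.power_mem)
  qed
  have U: "U = WU.level 0"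
    unfolding U_def
  proof (rule WU.int_closure_eq[OF subring_set_ring_gen])
    show "?K \<inter> WU.level 0 \<subseteq> ring_gen (W \<union> {s ^ h})" unfolding KW(1) by (auto intro: ring_gen_incl)
    show "ring_gen (W \<union> {s ^ h}) \<subseteq> WU.level 0"
      by (rule ring_gen_least[OF WU.subring_level]) (use KW(1) sh0 in auto)
    show "(s ^ h) ^ l / \<pi> ^ l \<in> tot_quot (ring_gen (W \<union> {s ^ h}))" for l
      by (rule frac[OF subring_set_ring_gen]) (auto intro: ring_gen_incl)
  qed
  have U': "U = ?L \<inter> lev 0" using U L0 by simp
  have D: "D = lev 0"
    unfolding D_def
  proof (rule WD.int_closure_eq[OF subring_set_ring_gen])
    show "?K \<inter> lev 0 \<subseteq> ring_gen (W \<union> {s})" unfolding W[symmetric] by (auto intro: ring_gen_incl)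
    show "ring_gen (W \<union> {s}) \<subseteq> lev 0"
      by (rule ring_gen_least[OF X.W.subring_level]) (use W s0 in auto)
    show "s ^ l / \<pi> ^ (l div h) \<in> tot_quot (ring_gen (W \<union> {s}))" for l
      by (rule frac[OF subring_set_ring_gen]) (auto intro: ring_gen_incl)
  qed
  have WU_sub: "W \<subseteq> U" using W U' KL by blast
  have D2: "lev 0 = int_closure (ring_gen (U \<union> {s}))"
  proof (rule UD.int_closure_eq[OF subring_set_ring_gen, symmetric])
    show "?L \<inter> lev 0 \<subseteq> ring_gen (U \<union> {s})" unfolding U'[symmetric] by (auto intro: ring_gen_incl)
    show "ring_gen (U \<union> {s}) \<subseteq> lev 0"
      by (rule ring_gen_least[OF X.W.subring_level]) (use U' s0 in auto)
    show "s ^ l / \<pi> ^ (l div h) \<in> tot_quot (ring_gen (U \<union> {s}))" for l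
      by (rule frac[OF subring_set_ring_gen]) (use WU_sub in \<open>auto intro: ring_gen_incl\<close>)
  qed
  have P: "P = WU.level 1"
    unfolding P_def U using WU.level_eq_cgenideal[OF sh0] X.s_nz wsh h_pos by simp
  have M: "M = lev 1"
    unfolding M_def D using X.W.level_eq_cgenideal[OF s0] X.s_nz X.w_s by simp
  have Q: "Q = ?K \<inter> lev 1"
  proof -
    interpret B: disc_val ?K "\<lambda>x. w x div int h" \<pi> by (rule WD.disc_val_K)
    have W0: "W = B.level 0" using WD.OK_level(1) W by simp
    have "level 1 \<subseteq> B.level 1"
    proof
      fix c assume c: "c \<in> level 1"
      then have "c \<in> lev (int h * 1)" using const_lev level_mem by blast
      then show "c \<in> B.level 1" unfolding WD.level_K using level_mem[OF c] frac_field_incl(1) by auto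
    qed
    then have "Q = B.level 1"
      unfolding Q_def W0 using unif_mem unif_nz v_unif w_pi h_pos
      by (intro B.level_eq_genideal[of \<pi>]) (auto intro: levelI)
    then show ?thesis using WD.OK_level(2) by simp
  qed
  have P': "P = ?L \<inter> lev 1" using P L1 by simp
  show "D = lev 0" by (rule D)
  have "has_degree U D h" "has_ramification_index P D M h" "fundamental_equality_no_splitting U P D M"
    "(ring_on D Quot M) \<simeq> (ring_on U Quot P)"
    using UD.degree UD.ramification_index UD.fundamental_equality UD.residue_iso U' P' D M by simp_all
  moreover have "finite_free_extension W D" "integral_extension_domain W D" "fundamental_equality_no_splitting W Q D M"
    using WD.finite_free WD.integral_extension WD.fundamental_equality W Q D M by simp_all
  moreover have "finite_free_extension W U" "integral_extension_domain W U" "fundamental_equality_no_splitting W Q U P"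
    "has_degree W U k" "has_ramification_index Q U P 1" "has_residue_degree W Q U P k"
    using WU.finite_free WU.integral_extension WU.fundamental_equality WU.degree WU.ramification_index WU.residue_degree
    unfolding KW Q[symmetric] unfolding U[symmetric] P[symmetric] by simp_all
  moreover have "dvr U P" "dvr D M" using WU.dvr_level X.W.dvr_level U P D M by simp_all
  ultimately show "D = int_closure (ring_gen (U \<union> {s}))
    \<and> dvr U P \<and> dvr D M
    \<and> finite_free_extension W U \<and> integral_extension_domain W U
    \<and> finite_free_extension W D \<and> integral_extension_domain W D
    \<and> has_ramification_index P D M h \<and> has_ramification_index Q U P 1
    \<and> has_degree U D h \<and> has_degree W U k
    \<and> (ring_on D Quot M) \<simeq> (ring_on U Quot P)
    \<and> has_residue_degree W Q U P k
    \<and> fundamental_equality_no_splitting W Q U P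
    \<and> fundamental_equality_no_splitting W Q D M
    \<and> fundamental_equality_no_splitting U P D M"
    using D2 D by blast
qed

end

section \<open>Noetherian subrings\<close>

text \<open>The ascending chain condition as a statement about sequences: some term lies in the
  ideal of its predecessors. It is applied directly to powers of an element, to leading coefficients
  and to torsion elements.\<close>

definition noetherian_set :: "'a::comm_ring_1 set \<Rightarrow> bool" where
  "noetherian_set A \<longleftrightarrow> (\<forall>g::nat \<Rightarrow> 'a. (\<forall>i. g i \<in> A) \<longrightarrow> (\<exists>n c. (\<forall>i<n. c i \<in> A) \<and> g n = (\<Sum>i<n. c i * g i)))"

definition lin_span :: "'a::comm_ring_1 set \<Rightarrow> (nat \<Rightarrow> 'a) \<Rightarrow> nat \<Rightarrow> 'a set" where
  "lin_span A g n = {\<Sum>i<n. c i * g i | c. \<forall>i<n. c i \<in> A}"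

lemma noetherian_set_iff:
  "noetherian_set A \<longleftrightarrow> (\<forall>g. (\<forall>i. g i \<in> A) \<longrightarrow> (\<exists>n. g n \<in> lin_span A g n))"
  unfolding noetherian_set_def lin_span_def by blast

context subring_set
begin

lemma ideal_lin_span:
  assumes "\<And>i. g i \<in> A" shows "ideal (lin_span A g n) (ring_on A)"
  unfolding ideal_ring_on_iff[OF subring_set_axioms]
proof (intro conjI ballI)
  show "lin_span A g n \<subseteq> A" using assms by (auto simp: lin_span_def intro!: sum_mem mult_mem)
  show "0 \<in> lin_span A g n" unfolding lin_span_def by (rule CollectI, rule exI[of _ "\<lambda>_. 0"]) (simp add: zero_mem)
  fix x assume "x \<in> lin_span A g n"
  then obtain c where c: "\<forall>i<n. c i \<in> A" "x = (\<Sum>i<n. c i * g i)" by (auto simp: lin_span_def)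
  { fix y assume "y \<in> lin_span A g n"
    then obtain d where d: "\<forall>i<n. d i \<in> A" "y = (\<Sum>i<n. d i * g i)" by (auto simp: lin_span_def)
    have "x + y = (\<Sum>i<n. (c i + d i) * g i)" by (simp add: c(2) d(2) sum.distrib distrib_right)
    then show "x + y \<in> lin_span A g n" unfolding lin_span_def using c(1) d(1) add_mem
      by (intro CollectI exI[of _ "\<lambda>i. c i + d i"]) auto }
  { fix a assume "a \<in> A"
    moreover have "a * x = (\<Sum>i<n. (a * c i) * g i)" by (simp add: c(2) sum_distrib_left mult.assoc)
    ultimately show "a * x \<in> lin_span A g n" unfolding lin_span_def using c(1) mult_mem
      by (intro CollectI exI[of _ "\<lambda>i. a * c i"]) auto }
qed

lemma lin_span_mono:
  assumes "m \<le> n" shows "lin_span A g m \<subseteq> lin_span A g n"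
proof
  fix x assume "x \<in> lin_span A g m"
  then obtain c where c: "\<forall>i<m. c i \<in> A" "x = (\<Sum>i<m. c i * g i)" by (auto simp: lin_span_def)
  have "x = (\<Sum>i<n. (if i < m then c i else 0) * g i)"
    unfolding c(2) using assms by (intro sum.mono_neutral_cong_left) auto
  then show "x \<in> lin_span A g n" unfolding lin_span_def using c(1) zero_mem
    by (intro CollectI exI[of _ "\<lambda>i. if i < m then c i else 0"]) auto
qed

lemma gen_lin_span: "i < n \<Longrightarrow> g i \<in> lin_span A g n"
  unfolding lin_span_def
  by (intro CollectI exI[of _ "\<lambda>j. if j = i then 1 else 0"])
    (auto simp: zero_mem one_mem if_distrib[of "\<lambda>x. x * _"] sum.If_cases)

text \<open>The union of the ideals spanned by initial segments is finitely generated, so it equals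
  one of them, which therefore contains the next term.\<close>

lemma noetherian_setI:
  assumes "\<And>J. ideal J (ring_on A) \<Longrightarrow> \<exists>S. finite S \<and> S \<subseteq> J \<and> J \<subseteq> genideal (ring_on A) S"
  shows "noetherian_set A"
  unfolding noetherian_set_iff
proof (intro allI impI)
  interpret R: cring "ring_on A" by (rule cring_ring_on[OF subring_set_axioms])
  fix g :: "nat \<Rightarrow> 'a" assume g: "\<forall>i. g i \<in> A"
  let ?L = "lin_span A g"
  have id: "ideal (?L n) (ring_on A)" for n using ideal_lin_span g by blast
  define J where "J = (\<Union>n. ?L n)"
  have "ideal J (ring_on A)"
    unfolding ideal_ring_on_iff[OF subring_set_axioms]
  proof (intro conjI ballI)
    show "J \<subseteq> A" "0 \<in> J" using idealD_ring_on(1,2)[OF id] by (auto simp: J_def)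
    fix x assume "x \<in> J"
    then obtain m where m: "x \<in> ?L m" by (auto simp: J_def)
    { fix y assume "y \<in> J"
      then obtain n where n: "y \<in> ?L n" by (auto simp: J_def)
      have "x \<in> ?L (max m n)" "y \<in> ?L (max m n)"
        using m n lin_span_mono[of m "max m n" g] lin_span_mono[of n "max m n" g] by auto
      then show "x + y \<in> J" using idealD_ring_on(3)[OF id] by (auto simp: J_def) }
    { fix a assume "a \<in> A" then show "a * x \<in> J" using m idealD_ring_on(4)[OF id] by (auto simp: J_def) }
  qed
  then obtain S where S: "finite S" "S \<subseteq> J" "J \<subseteq> genideal (ring_on A) S" using assms by blast
  have "\<exists>N. S \<subseteq> ?L N"
    using S(1,2)
  proof (induction S rule: finite_induct)
    case (insert x S)
    then obtain N M where "S \<subseteq> ?L N" "x \<in> ?L M" by (auto simp: J_def)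
    then have "insert x S \<subseteq> ?L (max N M)"
      using lin_span_mono[of N "max N M" g] lin_span_mono[of M "max N M" g] by auto
    then show ?case by blast
  qed simp
  then obtain N where "S \<subseteq> ?L N" by blast
  then have "J \<subseteq> ?L N" using R.genideal_minimal[OF id] S(3) by blast
  moreover have "g N \<in> J" using gen_lin_span[of N "Suc N" g] by (auto simp: J_def)
  ultimately show "\<exists>n. g n \<in> ?L n" by blast
qed

end

lemma noetherian_set_UNIV:
  assumes "noetherian_ring (ring_of_type_algebra :: 'a::comm_ring_1 ring)"
  shows "noetherian_set (UNIV :: 'a set)"
proof -
  interpret U: subring_set "UNIV :: 'a set" by unfold_locales auto
  interpret N: noetherian_ring "ring_of_type_algebra :: 'a ring" by fact
  show ?thesis
  proof (rule U.noetherian_setI)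
    fix J :: "'a set" assume "ideal J (ring_on UNIV)"
    then obtain S where S: "finite S" "J = genideal ring_of_type_algebra S"
      using N.finetely_gen[of J] by (auto simp: ring_on_UNIV)
    then show "\<exists>S. finite S \<and> S \<subseteq> J \<and> J \<subseteq> genideal (ring_on UNIV) S"
      using N.genideal_self[of S] by (auto simp: ring_on_UNIV)
  qed
qed

lemma noetherian_set_image:
  fixes \<eta> :: "'a::comm_ring_1 \<Rightarrow> 'b::comm_ring_1"
  assumes "noetherian_set A" and add: "\<And>x y. \<eta> (x + y) = \<eta> x + \<eta> y" and mult: "\<And>x y. \<eta> (x * y) = \<eta> x * \<eta> y"
  shows "noetherian_set (\<eta> ` A)"
  unfolding noetherian_set_def
proof (intro allI impI)
  fix g :: "nat \<Rightarrow> 'b" assume "\<forall>i. g i \<in> \<eta> ` A"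
  then have "\<forall>i. \<exists>x. x \<in> A \<and> g i = \<eta> x" by blast
  then obtain g' where g': "\<And>i. g' i \<in> A" "\<And>i. g i = \<eta> (g' i)" by metis
  obtain n c where c: "\<forall>i<n. c i \<in> A" "g' n = (\<Sum>i<n. c i * g' i)"
    using assms(1) g'(1) unfolding noetherian_set_def by blast
  have z: "\<eta> 0 = 0" using add[of 0 0] by simp
  have "\<eta> (sum f S) = (\<Sum>i\<in>S. \<eta> (f i))" for f :: "nat \<Rightarrow> 'a" and S
    by (induction S rule: infinite_finite_induct) (simp_all add: z add)
  then have "g n = (\<Sum>i<n. \<eta> (c i) * g i)" by (simp add: g'(2) c(2) mult)
  then show "\<exists>n c. (\<forall>i<n. c i \<in> \<eta> ` A) \<and> g n = (\<Sum>i<n. c i * g i)"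
    using c(1) by (intro exI[of _ n] exI[of _ "\<lambda>i. \<eta> (c i)"]) auto
qed

text \<open>Course-of-values recursion: the next term is picked in dependence on the set of all
  earlier ones.\<close>

fun history_seq :: "('a set \<Rightarrow> 'a) \<Rightarrow> nat \<Rightarrow> 'a" where
  "history_seq pick n = pick (history_seq pick ` {..<n})"

declare history_seq.simps [simp del]

text \<open>In an ideal that is not finitely generated, pick successively a polynomial of least
  degree outside the ideal of the earlier ones. A relation between leading coefficients produces one
  of smaller degree that should have been picked instead.\<close>

theorem hilbert_basis:
  fixes A :: "'a::comm_ring_1 set"
  assumes A: "subring_set A" and N: "noetherian_set A"
  shows "noetherian_set (polys_over A)"
proof -
  interpret A: subring_set A by fact
  interpret P: subring_set "polys_over A" by (rule A.subring_polys_over)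
  interpret R: cring "ring_on (polys_over A)" by (rule cring_ring_on[OF A.subring_polys_over])
  let ?I = "genideal (ring_on (polys_over A))"
  show ?thesis
  proof (rule P.noetherian_setI, rule ccontr)
    fix J assume J: "ideal J (ring_on (polys_over A))"
    assume no: "\<not> (\<exists>S. finite S \<and> S \<subseteq> J \<and> J \<subseteq> ?I S)"
    note Jd = idealD_ring_on[OF J]
    define good where "good S p \<longleftrightarrow> p \<in> J \<and> p \<notin> ?I S \<and> (\<forall>q. q \<in> J \<and> q \<notin> ?I S \<longrightarrow> Polynomial.degree p \<le> Polynomial.degree q)" for S p
    have ex: "\<exists>p. good S p" if "finite S" "S \<subseteq> J" for S
      using that no ex_has_least_nat[of "\<lambda>p. p \<in> J \<and> p \<notin> ?I S" _ Polynomial.degree] unfolding good_def by blast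
    define f where "f = history_seq (\<lambda>S. SOME p. good S p)"
    have f: "good (f ` {..<n}) (f n)" for n
    proof (induction n rule: less_induct)
      case (less n)
      then have "f ` {..<n} \<subseteq> J" by (auto simp: good_def)
      moreover have "f n = (SOME p. good (f ` {..<n}) p)" unfolding f_def by (subst history_seq.simps) simp
      ultimately show ?case using someI_ex[OF ex[of "f ` {..<n}"]] by simp
    qed
    have fJ: "f n \<in> J" "f n \<notin> ?I (f ` {..<n})" for n using f[of n] by (auto simp: good_def)
    have fsub: "f ` S \<subseteq> carrier (ring_on (polys_over A))" for S using fJ(1) Jd(1) by auto
    have Iid: "ideal (?I (f ` S)) (ring_on (polys_over A))" for S by (rule R.genideal_ideal[OF fsub])
    have deg: "Polynomial.degree (f i) \<le> Polynomial.degree (f n)" if "i < n" for i n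
    proof -
      have "?I (f ` {..<i}) \<subseteq> ?I (f ` {..<n})"
        using that R.genideal_self[OF fsub[of "{..<n}"]] by (intro R.genideal_minimal[OF Iid]) auto
      then have "f n \<notin> ?I (f ` {..<i})" using fJ by blast
      then show ?thesis using f[of i] fJ(1)[of n] by (auto simp: good_def)
    qed
    define a where "a n = Polynomial.lead_coeff (f n)" for n
    have "a n \<in> A" for n using Jd(1)[OF fJ(1)] A.polys_over_coeff by (simp add: a_def)
    then obtain n c where c: "\<forall>i<n. c i \<in> A" "a n = (\<Sum>i<n. c i * a i)"
      using N unfolding noetherian_set_def by blast
    define d where "d i = Polynomial.degree (f i)" for i
    \<comment> \<open>The monomials raise the earlier degrees to \<open>d n\<close>, so that g has
      the same coefficient at \<open>d n\<close> as \<open>f n\<close>; degrees never decrease along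
      the sequence.\<close>
    define g where "g = (\<Sum>i<n. Polynomial.monom (c i) (d n - d i) * f i)"
    have mI: "Polynomial.monom (c i) (d n - d i) * f i \<in> ?I (f ` {..<n})" if "i < n" for i
      using that c(1) A.monom_polys_over R.genideal_self[OF fsub[of "{..<n}"]]
      by (intro idealD_ring_on(4)[OF Iid]) auto
    have sumI: "sum h S \<in> K" if "ideal K (ring_on (polys_over A))" "\<And>i. i \<in> S \<Longrightarrow> h i \<in> K" for h :: "nat \<Rightarrow> 'a poly" and S K
      using that(2) idealD_ring_on(2,3)[OF that(1)] by (induction S rule: infinite_finite_induct) auto
    have gI: "g \<in> ?I (f ` {..<n})" unfolding g_def using mI by (intro sumI[OF Iid]) auto
    have gJ: "g \<in> J" unfolding g_def using c(1) A.monom_polys_over fJ(1) by (intro sumI[OF J] Jd(4)) auto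
    have um: "- x \<in> K" if "ideal K (ring_on (polys_over A))" "x \<in> K" for x K
      using idealD_ring_on(4)[OF that(1) P.uminus_mem[OF P.one_mem] that(2)] by simp
    have hJ: "f n - g \<in> J" using Jd(3)[OF fJ(1) um[OF J gJ]] by simp
    have hI: "f n - g \<notin> ?I (f ` {..<n})"
    proof
      assume "f n - g \<in> ?I (f ` {..<n})"
      then have "(f n - g) + g \<in> ?I (f ` {..<n})" using idealD_ring_on(3)[OF Iid] gI by blast
      then show False using fJ(2) by simp
    qed
    have dle: "Polynomial.degree (Polynomial.monom (c i) (d n - d i) * f i) \<le> d n" if "i < n" for i
    proof -
      have "Polynomial.degree (Polynomial.monom (c i) (d n - d i) * f i) \<le> (d n - d i) + d i"
        unfolding d_def by (rule order_trans[OF degree_mult_le add_right_mono[OF degree_monom_le]])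
      then show ?thesis using deg[OF that] by (simp add: d_def)
    qed
    then have "Polynomial.degree g \<le> d n" unfolding g_def by (intro degree_sum_le) auto
    then have dh: "Polynomial.degree (f n - g) \<le> d n" by (intro degree_diff_le) (simp_all add: d_def)
    have "Polynomial.coeff (Polynomial.monom (c i) (d n - d i) * f i) (d n) = c i * a i" if "i < n" for i
      using deg[OF that] by (simp add: coeff_monom_mult a_def d_def)
    then have "Polynomial.coeff (f n - g) (d n) = 0"
      using c(2) by (simp add: g_def Polynomial.coeff_sum a_def d_def)
    moreover have "f n - g \<noteq> 0" using hI idealD_ring_on(2)[OF Iid] by metis
    ultimately have "Polynomial.degree (f n - g) < d n"
      using dh by (metis leading_coeff_0_iff order_le_less)
    then show False using f[of n] hJ hI by (auto simp: good_def d_def)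
  qed
qed

lemma noetherian_set_adjoin:
  assumes "subring_set A" "noetherian_set A"
  shows "noetherian_set (ring_gen (A \<union> {x}))"
  unfolding ring_gen_adjoin[OF assms(1)]
  by (rule noetherian_set_image[OF hilbert_basis[OF assms]]) simp_all

lemma noetherian_set_adjoin_finite:
  assumes "subring_set A" "noetherian_set A" "finite S"
  shows "noetherian_set (ring_gen (A \<union> S))"
  using assms(3)
proof (induction S rule: finite_induct)
  case empty
  have "ring_gen A = A" using ring_gen_least[OF assms(1) subset_refl] ring_gen_incl by blast
  then show ?case using assms(2) by simp
next
  case (insert x S)
  have "ring_gen (ring_gen (A \<union> S) \<union> {x}) = ring_gen (A \<union> insert x S)"
  proof
    have "ring_gen (A \<union> S) \<subseteq> ring_gen (A \<union> insert x S)" by (rule ring_gen_mono) auto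
    then show "ring_gen (ring_gen (A \<union> S) \<union> {x}) \<subseteq> ring_gen (A \<union> insert x S)"
      by (intro ring_gen_least[OF subring_set_ring_gen]) (auto intro: ring_gen_incl)
    show "ring_gen (A \<union> insert x S) \<subseteq> ring_gen (ring_gen (A \<union> S) \<union> {x})"
      by (intro ring_gen_least[OF subring_set_ring_gen]) (auto intro: ring_gen_incl)
  qed
  then show ?case using noetherian_set_adjoin[OF subring_set_ring_gen insert.IH, of x] by simp
qed

section \<open>Almost integral elements\<close>

text \<open>The chain condition for the sequence \<tau>^e \<zeta>^j in A gives a relation from which
  the common factor \<tau>^e can be cancelled.\<close>

lemma almost_integral_imp_integral:
  assumes A: "subring_set A" "noetherian_set A" and \<tau>: "\<And>z. \<tau> * z = 0 \<Longrightarrow> z = 0"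
    and ai: "\<And>j. \<tau> ^ e * \<zeta> ^ j \<in> A"
  shows "integral_over A \<zeta>"
proof -
  obtain n c where c: "\<forall>i<n. c i \<in> A" "\<tau> ^ e * \<zeta> ^ n = (\<Sum>i<n. c i * (\<tau> ^ e * \<zeta> ^ i))"
    using A(2)[unfolded noetherian_set_def, rule_format, of "\<lambda>j. \<tau> ^ e * \<zeta> ^ j"] ai by blast
  have Xe: "\<tau> ^ e * z = 0 \<Longrightarrow> z = 0" for z using \<tau> by (induction e) (auto simp: mult.assoc)
  have "\<tau> ^ e * (\<zeta> ^ n - (\<Sum>i<n. c i * \<zeta> ^ i)) = 0"
    using c(2) by (simp add: right_diff_distrib sum_distrib_left ac_simps)
  then have "\<zeta> ^ n = (\<Sum>i<n. c i * \<zeta> ^ i)" using Xe by fastforce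
  then show ?thesis unfolding integral_over_iff[OF A(1)] using c(1) by blast
qed

text \<open>The exponent e0 n suffices: powers below n need at most n factors \<tau>^e0, and the
  integral equation reduces higher powers to smaller ones.\<close>

lemma integral_imp_almost_integral:
  assumes A: "subring_set A" and \<tau>: "\<tau> \<in> A" "\<tau> ^ e0 * \<zeta> \<in> A" and i: "integral_over A \<zeta>"
  shows "\<exists>e. \<forall>j. \<tau> ^ e * \<zeta> ^ j \<in> A"
proof -
  interpret subring_set A by fact
  obtain n c where c: "\<forall>i<n. c i \<in> A" "\<zeta> ^ n = (\<Sum>i<n. c i * \<zeta> ^ i)"
    using i unfolding integral_over_iff[OF A] by blast
  have "\<tau> ^ (e0 * n) * \<zeta> ^ j \<in> A" for j
  proof (induction j rule: less_induct)
    case (less j)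
    show ?case
    proof (cases "j < n")
      case True
      then have "\<tau> ^ (e0 * n) = \<tau> ^ (e0 * (n - j)) * (\<tau> ^ e0) ^ j"
        by (simp add: power_mult[symmetric] power_add[symmetric] distrib_left[symmetric])
      then have "\<tau> ^ (e0 * n) * \<zeta> ^ j = \<tau> ^ (e0 * (n - j)) * (\<tau> ^ e0 * \<zeta>) ^ j"
        by (simp add: power_mult_distrib mult.assoc)
      then show ?thesis using \<tau> by (simp add: mult_mem power_mem)
    next
      case False
      then have "\<zeta> ^ j = \<zeta> ^ (j - n) * \<zeta> ^ n" by (simp add: power_add[symmetric])
      then have "\<tau> ^ (e0 * n) * \<zeta> ^ j = (\<Sum>i<n. c i * (\<tau> ^ (e0 * n) * \<zeta> ^ (j - n + i)))"
        by (simp add: c(2) sum_distrib_left power_add ac_simps)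
      also have "\<dots> \<in> A" using c(1) False by (intro sum_mem mult_mem[OF _ less]) auto
      finally show ?thesis .
    qed
  qed
  then show ?thesis by blast
qed

text \<open>The ascending ideals of elements that f^n multiplies into \<tau>A become stationary; L
  is the stage from which they no longer grow.\<close>

lemma saturation_bound:
  assumes A: "subring_set A" "noetherian_set A" and f: "f \<in> A"
  obtains L where "\<And>y n. y \<in> A \<Longrightarrow> f ^ n * y \<in> (*) \<tau> ` A \<Longrightarrow> f ^ L * y \<in> (*) \<tau> ` A"
proof -
  interpret subring_set A by fact
  have XA: "a * x \<in> (*) \<tau> ` A" if "a \<in> A" "x \<in> (*) \<tau> ` A" for a x
    using that mult_mem by (force intro: image_eqI simp: ac_simps)
  have up: "f ^ n * y \<in> (*) \<tau> ` A" if "f ^ m * y \<in> (*) \<tau> ` A" "m \<le> n" for m n y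
  proof -
    have "f ^ n * y = f ^ (n - m) * (f ^ m * y)" using that(2) by (simp add: mult.assoc[symmetric] power_add[symmetric])
    then show ?thesis using XA[OF power_mem[OF f] that(1)] by simp
  qed
  have "\<exists>L. \<forall>y n. y \<in> A \<longrightarrow> f ^ n * y \<in> (*) \<tau> ` A \<longrightarrow> f ^ L * y \<in> (*) \<tau> ` A"
  proof (rule ccontr)
    assume "\<not> ?thesis"
    then obtain y n where y: "\<And>L. y L \<in> A" "\<And>L. f ^ n L * y L \<in> (*) \<tau> ` A" "\<And>L. f ^ L * y L \<notin> (*) \<tau> ` A" by metis
    \<comment> \<open>The subsequence grows so fast that the exponent at stage N handles all earlier
      chosen elements, hence their combination \<open>g N\<close> as well, contradicting the choice
      of \<open>g N\<close>.\<close>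
    define idx where "idx = rec_nat 0 (\<lambda>_ L. max L (n L))"
    have idx: "idx (Suc i) = max (idx i) (n (idx i))" for i by (simp add: idx_def)
    have mono: "idx i \<le> idx j" if "i \<le> j" for i j using that by (induction j rule: dec_induct) (auto simp: idx)
    define g where "g i = y (idx i)" for i
    obtain N c where c: "\<forall>i<N. c i \<in> A" "g N = (\<Sum>i<N. c i * g i)"
      using A(2) y(1) unfolding noetherian_set_def g_def by metis
    have "f ^ idx N * g i \<in> (*) \<tau> ` A" if "i < N" for i
    proof -
      have "n (idx i) \<le> idx N" using mono[of "Suc i" N] that idx[of i] by simp
      then show ?thesis using up[OF y(2)] unfolding g_def by blast
    qed
    then have "f ^ idx N * (c i * g i) \<in> (*) \<tau> ` A" if "i < N" for i
      using XA[of "c i" "f ^ idx N * g i"] c(1) that by (simp add: ac_simps)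
    moreover have sum_in: "(\<And>i. i \<in> S \<Longrightarrow> h i \<in> (*) \<tau> ` A) \<Longrightarrow> sum h S \<in> (*) \<tau> ` A" for h :: "nat \<Rightarrow> 'a" and S
    proof (induction S rule: infinite_finite_induct)
      case (insert x F)
      then obtain a b where "h x = \<tau> * a" "sum h F = \<tau> * b" "a \<in> A" "b \<in> A" by blast
      then show ?case using insert(1,2) add_mem by (auto simp: distrib_left[symmetric])
    qed (use zero_mem in \<open>force+\<close>)
    ultimately have "(\<Sum>i<N. f ^ idx N * (c i * g i)) \<in> (*) \<tau> ` A" by (intro sum_in) simp
    then have "f ^ idx N * g N \<in> (*) \<tau> ` A" unfolding c(2) sum_distrib_left .
    then show False using y(3) by (simp add: g_def)
  qed
  then show thesis using that by blast
qed

text \<open>A power of \<open>f\<close> that kills the \<open>f\<close>-torsion modulo \<open>\<tau>\<close> in the Noetherian ring \<open>A\<close> still does so in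
  its integral closure: with \<open>y' = f ^ n y / \<tau>\<close> both \<open>y\<close> and \<open>y'\<close> are almost integral, and comparing
  the powers of \<open>f ^ n y = \<tau> y'\<close> in \<open>A\<close> shows that \<open>f ^ L y / \<tau>\<close> is almost integral as well.\<close>

theorem saturation_bound_integral_closure:
  assumes A: "subring_set A" "noetherian_set A" and f: "f \<in> A" and \<tau>: "\<tau> \<in> A" "\<And>z. \<tau> * z = 0 \<Longrightarrow> z = 0"
  obtains L where "\<And>n e y y' \<zeta>. integral_over A y \<Longrightarrow> integral_over A y' \<Longrightarrow> \<tau> ^ e * y \<in> A \<Longrightarrow> \<tau> ^ e * y' \<in> A \<Longrightarrow>
    f ^ n * y = \<tau> * y' \<Longrightarrow> f ^ L * y = \<tau> * \<zeta> \<Longrightarrow> integral_over A \<zeta>"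
proof -
  interpret subring_set A by fact
  obtain L where L: "\<And>y n. y \<in> A \<Longrightarrow> f ^ n * y \<in> (*) \<tau> ` A \<Longrightarrow> f ^ L * y \<in> (*) \<tau> ` A"
    using saturation_bound[OF A f] by blast
  have cancel: "x = y" if "\<tau> * x = \<tau> * y" for x y
    using \<tau>(2)[of "x - y"] that by (simp add: right_diff_distrib)
  have canceln: "x = y" if "\<tau> ^ j * x = \<tau> ^ j * y" for x y j
    using that cancel by (induction j) (auto simp: mult.assoc)
  \<comment> \<open>Torsion modulo \<tau>^j is removed one factor \<tau> at a time, at the price of
    f^L for each.\<close>
  have Ln: "f ^ (L * j) * \<alpha> \<in> (*) (\<tau> ^ j) ` A" if "\<alpha> \<in> A" "f ^ n * \<alpha> \<in> (*) (\<tau> ^ j) ` A" for \<alpha> n j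
    using that
  proof (induction j arbitrary: \<alpha>)
    case 0
    then show ?case by simp
  next
    case (Suc j)
    obtain a where a: "a \<in> A" "f ^ n * \<alpha> = \<tau> ^ Suc j * a" using Suc.prems(2) by blast
    then have "f ^ n * \<alpha> = \<tau> * (\<tau> ^ j * a)" by (simp add: mult.assoc)
    then have "f ^ n * \<alpha> \<in> (*) \<tau> ` A" using a \<tau>(1) by (auto intro!: image_eqI[of _ _ "\<tau> ^ j * a"] mult_mem power_mem)
    then obtain a1 where a1: "a1 \<in> A" "f ^ L * \<alpha> = \<tau> * a1" using L[OF Suc.prems(1)] by blast
    have "\<tau> * (f ^ n * a1) = \<tau> * (\<tau> ^ j * (f ^ L * a))"
    proof -
      have "\<tau> * (f ^ n * a1) = f ^ n * (f ^ L * \<alpha>)" unfolding a1(2) by (simp add: ac_simps)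
      also have "\<dots> = f ^ L * (\<tau> ^ Suc j * a)" unfolding a(2)[symmetric] by (simp add: ac_simps)
      finally show ?thesis by (simp add: ac_simps)
    qed
    then have "f ^ n * a1 = \<tau> ^ j * (f ^ L * a)" by (rule cancel)
    then have "f ^ n * a1 \<in> (*) (\<tau> ^ j) ` A" using a(1) f by (auto intro!: image_eqI[of _ _ "f ^ L * a"] mult_mem power_mem)
    then obtain a2 where a2: "a2 \<in> A" "f ^ (L * j) * a1 = \<tau> ^ j * a2" using Suc.IH[OF a1(1)] by blast
    have "f ^ (L * Suc j) * \<alpha> = f ^ (L * j) * (f ^ L * \<alpha>)" by (simp add: power_add ac_simps)
    also have "\<dots> = \<tau> * (f ^ (L * j) * a1)" unfolding a1(2) by (simp add: ac_simps)
    also have "\<dots> = \<tau> ^ Suc j * a2" unfolding a2(2) by (simp add: mult.assoc)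
    finally show ?case using a2(1) by blast
  qed
  show thesis
  proof (rule that[of L])
    fix n e y y' \<zeta>
    assume int: "integral_over A y" "integral_over A y'" and mem: "\<tau> ^ e * y \<in> A" "\<tau> ^ e * y' \<in> A"
      and eq: "f ^ n * y = \<tau> * y'" "f ^ L * y = \<tau> * \<zeta>"
    obtain e1 where e1: "\<And>j. \<tau> ^ e1 * y ^ j \<in> A" using integral_imp_almost_integral[OF A(1) \<tau>(1) mem(1) int(1)] by blast
    obtain e2 where e2: "\<And>j. \<tau> ^ e2 * y' ^ j \<in> A" using integral_imp_almost_integral[OF A(1) \<tau>(1) mem(2) int(2)] by blast
    define e' where "e' = e1 + e2"
    have y: "\<tau> ^ e' * y ^ j \<in> A" "\<tau> ^ e' * y' ^ j \<in> A" for j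
    proof -
      have "\<tau> ^ e' * y ^ j = \<tau> ^ e2 * (\<tau> ^ e1 * y ^ j)" "\<tau> ^ e' * y' ^ j = \<tau> ^ e1 * (\<tau> ^ e2 * y' ^ j)"
        by (simp_all add: e'_def power_add ac_simps)
      then show "\<tau> ^ e' * y ^ j \<in> A" "\<tau> ^ e' * y' ^ j \<in> A" using e1 e2 \<tau>(1) mult_mem power_mem by auto
    qed
    have "\<tau> ^ e' * \<zeta> ^ j \<in> A" for j
    proof -
      have "f ^ (n * j) * (\<tau> ^ e' * y ^ j) = \<tau> ^ e' * (f ^ n * y) ^ j"
        unfolding power_mult by (simp add: power_mult_distrib ac_simps)
      also have "\<dots> = \<tau> ^ j * (\<tau> ^ e' * y' ^ j)" unfolding eq(1) by (simp add: power_mult_distrib ac_simps)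
      finally have "f ^ (n * j) * (\<tau> ^ e' * y ^ j) \<in> (*) (\<tau> ^ j) ` A" using y(2) by blast
      then obtain b where b: "b \<in> A" "f ^ (L * j) * (\<tau> ^ e' * y ^ j) = \<tau> ^ j * b" using Ln[OF y(1)] by blast
      have "\<tau> ^ j * (\<tau> ^ e' * \<zeta> ^ j) = \<tau> ^ e' * (\<tau> * \<zeta>) ^ j" by (simp add: power_mult_distrib ac_simps)
      also have "\<dots> = f ^ (L * j) * (\<tau> ^ e' * y ^ j)"
        unfolding eq(2)[symmetric] power_mult by (simp add: power_mult_distrib ac_simps)
      finally have "\<tau> ^ j * (\<tau> ^ e' * \<zeta> ^ j) = \<tau> ^ j * b" using b(2) by simp
      then show ?thesis using canceln b(1) by metis
    qed
    then show "integral_over A \<zeta>" using almost_integral_imp_integral[OF A, of \<tau> e' \<zeta>] \<tau>(2) by blast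
  qed
qed

section \<open>Minimal primes\<close>

text \<open>In the binomial expansion of degree n + m, every term contains x^n or y^m.\<close>

lemma power_sum_annihilated:
  fixes x y s t :: "'a::comm_ring_1"
  assumes "s * x ^ n = 0" "t * y ^ m = 0"
  shows "s * t * (x + y) ^ (n + m) = 0"
proof -
  have "s * t * (of_nat (n + m choose i) * x ^ i * y ^ (n + m - i)) = 0" if "i \<le> n + m" for i
  proof (cases "n \<le> i")
    case True
    then have "x ^ i = x ^ n * x ^ (i - n)" by (simp add: power_add[symmetric])
    then have "s * t * (of_nat (n + m choose i) * x ^ i * y ^ (n + m - i)) =
        (s * x ^ n) * (t * of_nat (n + m choose i) * x ^ (i - n) * y ^ (n + m - i))" by (simp add: ac_simps)
    then show ?thesis using assms(1) by simp
  next
    case False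
    then have "n + m - i = m + (n - i)" using that by simp
    then have "y ^ (n + m - i) = y ^ m * y ^ (n - i)" by (simp add: power_add)
    then have "s * t * (of_nat (n + m choose i) * x ^ i * y ^ (n + m - i)) =
        (t * y ^ m) * (s * of_nat (n + m choose i) * x ^ i * y ^ (n - i))" by (simp add: ac_simps)
    then show ?thesis using assms(2) by simp
  qed
  then show ?thesis unfolding binomial_ring sum_distrib_left by (intro sum.neutral) auto
qed

text \<open>Enlarge \<open>S0\<close> to a maximal multiplicative set S without 0. An element
  outside S cannot be added, so some power of it is killed by an element of S. This describes the
  complement z of S, makes it a prime, and forces every prime inside z to contain all of z.\<close>

lemma minimal_prime_avoiding:
  assumes A: "subring_set A" and S0: "S0 \<subseteq> A" "1 \<in> S0" "0 \<notin> S0" "\<And>x y. x \<in> S0 \<Longrightarrow> y \<in> S0 \<Longrightarrow> x * y \<in> S0"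
  obtains z where "minimal_prime A z" "z \<inter> S0 = {}"
proof -
  interpret subring_set A by fact
  define mc where "mc S \<longleftrightarrow> S0 \<subseteq> S \<and> S \<subseteq> A \<and> 0 \<notin> S \<and> (\<forall>x\<in>S. \<forall>y\<in>S. x * y \<in> S)" for S
  have "\<exists>M\<in>{S. mc S}. \<forall>S\<in>{S. mc S}. M \<subseteq> S \<longrightarrow> S = M"
  proof (rule subset_Zorn_nonempty)
    show "{S. mc S} \<noteq> {}" using S0 by (auto simp: mc_def)
    fix C assume C: "C \<noteq> {}" "subset.chain {S. mc S} C"
    then have mcC: "mc S" if "S \<in> C" for S using that by (auto simp: subset.chain_def)
    have "x * y \<in> \<Union>C" if xy: "x \<in> \<Union>C" "y \<in> \<Union>C" for x y
    proof -
      obtain S T where ST: "S \<in> C" "T \<in> C" "x \<in> S" "y \<in> T" using xy by blast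
      then have "S \<subseteq> T \<or> T \<subseteq> S" using C(2) by (auto simp: subset.chain_def)
      then obtain T' where "T' \<in> C" "x \<in> T'" "y \<in> T'" using ST by blast
      then show ?thesis using mcC[of T'] unfolding mc_def by blast
    qed
    moreover have "S0 \<subseteq> \<Union>C" "\<Union>C \<subseteq> A" "0 \<notin> \<Union>C" using mcC C(1) unfolding mc_def by blast+
    ultimately show "\<Union>C \<in> {S. mc S}" by (simp add: mc_def)
  qed
  then obtain S where S: "mc S" "\<And>T. mc T \<Longrightarrow> S \<subseteq> T \<Longrightarrow> T = S" by auto
  have S': "S \<subseteq> A" "0 \<notin> S" "1 \<in> S" "\<And>x y. x \<in> S \<Longrightarrow> y \<in> S \<Longrightarrow> x * y \<in> S" "S0 \<subseteq> S"
    using S(1) S0(2) by (auto simp: mc_def)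
  define z where "z = {x \<in> A. \<exists>s\<in>S. \<exists>n. s * x ^ n = 0}"
  have compl: "x \<in> z" if x: "x \<in> A" "x \<notin> S" for x
  proof (rule ccontr)
    assume nz: "x \<notin> z"
    let ?T = "{s * x ^ n | s n. s \<in> S}"
    have "mc ?T"
      unfolding mc_def
    proof (intro conjI ballI)
      show "S0 \<subseteq> ?T" using S'(5) by (force intro: exI[of _ 0])
      show "?T \<subseteq> A" using S'(1) x(1) by (auto intro!: mult_mem power_mem)
      show "0 \<notin> ?T" using nz x(1) by (auto simp: z_def)
      fix a b assume "a \<in> ?T" "b \<in> ?T"
      then obtain s n t m where *: "a = s * x ^ n" "b = t * x ^ m" "s \<in> S" "t \<in> S" by blast
      have "a * b = (s * t) * x ^ (n + m)" by (simp add: * power_add ac_simps)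
      then show "a * b \<in> ?T" using S'(4)[OF *(3,4)] by blast
    qed
    moreover have "S \<subseteq> ?T" by (force intro: exI[of _ 0])
    ultimately have "?T = S" using S(2) by blast
    moreover have "1 * x ^ 1 \<in> ?T" using S'(3) by blast
    ultimately show False using x(2) by simp
  qed
  have zS: "z \<inter> S = {}"
  proof -
    have "s * x ^ n \<in> S" if "x \<in> S" "s \<in> S" for x s n
    proof (induction n)
      case (Suc n)
      have "s * x ^ Suc n = x * (s * x ^ n)" by (simp add: ac_simps)
      then show ?case using S'(4)[OF that(1) Suc] by metis
    qed (use that in simp)
    note powS = this
    have False if x: "x \<in> z" "x \<in> S" for x
    proof -
      obtain s n where "s \<in> S" "s * x ^ n = 0" using x(1) by (auto simp: z_def)
      then show False using powS[OF x(2), of s n] S'(2) by simp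
    qed
    then show ?thesis by blast
  qed
  have id: "ideal z (ring_on A)"
    unfolding ideal_ring_on_iff[OF A]
  proof (intro conjI ballI)
    show "z \<subseteq> A" by (auto simp: z_def)
    show "0 \<in> z" using zero_mem S'(3) by (auto simp: z_def intro!: bexI[of _ 1] exI[of _ 1])
    fix x assume "x \<in> z"
    then obtain s n where x: "x \<in> A" "s \<in> S" "s * x ^ n = 0" by (auto simp: z_def)
    { fix y assume "y \<in> z"
      then obtain t m where y: "y \<in> A" "t \<in> S" "t * y ^ m = 0" by (auto simp: z_def)
      show "x + y \<in> z" using power_sum_annihilated[OF x(3) y(3)] S'(4)[OF x(2) y(2)] add_mem[OF x(1) y(1)]
        unfolding z_def by blast }
    { fix a assume "a \<in> A"
      moreover have "s * (a * x) ^ n = a ^ n * (s * x ^ n)" by (simp add: power_mult_distrib ac_simps)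
      ultimately show "a * x \<in> z" using x mult_mem by (auto simp: z_def) }
  qed
  have pr: "primeideal z (ring_on A)"
    unfolding primeideal_ring_on_iff[OF A]
  proof (intro conjI ballI impI)
    show "ideal z (ring_on A)" by (rule id)
    show "1 \<notin> z" using zS S'(3) by blast
    fix x y assume "x \<in> A" "y \<in> A" "x * y \<in> z"
    then show "x \<in> z \<or> y \<in> z" using compl S'(4) zS by blast
  qed
  have "minimal_prime A z"
    unfolding minimal_prime_def
  proof (intro conjI allI impI)
    fix q assume q: "primeideal q (ring_on A) \<and> q \<subseteq> z"
    have "x \<in> q" if xz: "x \<in> z" for x
    proof -
      obtain s n where x: "x \<in> A" "s \<in> S" "s * x ^ n = 0" using xz by (auto simp: z_def)
      have "s * x ^ n \<in> q" using x(3) idealD_ring_on(2)[OF primeidealD_ring_on(1)[of q A]] q by simp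
      then have "s \<in> q \<or> x ^ n \<in> q" using primeidealD_ring_on(3)[of q A s "x ^ n"] q x S'(1) power_mem by blast
      moreover have "s \<notin> q" using q x(2) zS by blast
      ultimately show ?thesis using primeidealD_ring_on(4)[of q A x n] q x(1) by blast
    qed
    then show "q = z" using q by blast
  qed (rule pr)
  then show thesis using that zS S'(5) by blast
qed

text \<open>Otherwise the products of elements outside p with powers of a would be avoided by a
  minimal prime; it would lie in p and miss a, so it would differ from z. In other words, z becomes
  the nilradical after localizing at p.\<close>

lemma unique_minimal_prime_annihilator:
  assumes p: "primeideal p (ring_on A)" and z: "unique_minimal_prime_in A p z" and a: "a \<in> z"
  obtains s n where "s \<in> A" "s \<notin> p" "s * a ^ n = 0"
proof -
  have A: "subring_set A" by (rule primeideal_subring_set[OF p])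
  interpret subring_set A by fact
  have zp: "minimal_prime A z" "z \<subseteq> p" "\<And>z'. minimal_prime A z' \<Longrightarrow> z' \<subseteq> p \<Longrightarrow> z' = z"
    using z by (auto simp: unique_minimal_prime_in_def)
  have aA: "a \<in> A" using a zp(2) idealD_ring_on(1)[OF primeidealD_ring_on(1)[OF p]] by blast
  let ?S = "{s * a ^ n | s n. s \<in> A \<and> s \<notin> p}"
  have "0 \<in> ?S"
  proof (rule ccontr)
    assume "0 \<notin> ?S"
    moreover have "?S \<subseteq> A" using aA by (auto intro!: mult_mem power_mem)
    moreover have "1 * a ^ 0 \<in> ?S" using one_mem primeidealD_ring_on(2)[OF p] by blast
    then have "1 \<in> ?S" by simp
    moreover have "x * y \<in> ?S" if "x \<in> ?S" "y \<in> ?S" for x y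
    proof -
      obtain s n t m where *: "x = s * a ^ n" "y = t * a ^ m" "s \<in> A" "s \<notin> p" "t \<in> A" "t \<notin> p" using \<open>x \<in> ?S\<close> \<open>y \<in> ?S\<close> by blast
      have "x * y = (s * t) * a ^ (n + m)" by (simp add: * power_add ac_simps)
      moreover have "s * t \<notin> p" using primeidealD_ring_on(3)[OF p] * by blast
      ultimately show ?thesis using mult_mem * by blast
    qed
    ultimately obtain z' where z': "minimal_prime A z'" "z' \<inter> ?S = {}" using minimal_prime_avoiding[OF A, of ?S] by blast
    have z'A: "z' \<subseteq> A" using z'(1) idealD_ring_on(1)[OF primeidealD_ring_on(1)] by (auto simp: minimal_prime_def)
    have "x \<in> p" if "x \<in> z'" for x
    proof (rule ccontr)
      assume "x \<notin> p"
      then have "x * a ^ 0 \<in> ?S" using that z'A by blast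
      then show False using z'(2) that by auto
    qed
    then have "z' = z" using zp(3) z'(1) by blast
    moreover have "1 * a ^ 1 \<in> ?S" using one_mem primeidealD_ring_on(2)[OF p] by blast
    ultimately show False using a z'(2) by auto
  qed
  then show thesis using that by force
qed

section \<open>Homomorphisms on total quotient rings\<close>

abbreviation (input) emb :: "'a::comm_ring_1 \<Rightarrow> 'a tqr" where
  "emb a \<equiv> Tqr a 1"

lemma emb_add: "emb (a + b) = emb a + emb b"
  by transfer (simp add: tqr_rel_def regular_UNIV_one)

lemma emb_mult: "emb (a * b) = emb a * emb b"
  by transfer (simp add: tqr_rel_def regular_UNIV_one)

lemma emb_0 [simp]: "emb 0 = 0"
  by transfer (simp add: tqr_rel_def regular_UNIV_one)

lemma emb_1 [simp]: "emb 1 = 1"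
  by transfer (simp add: tqr_rel_def regular_UNIV_one)

lemma emb_power: "emb (a ^ n) = emb a ^ n"
  by (induction n) (simp_all add: emb_mult)

lemma emb_sum: "emb (sum f S) = (\<Sum>i\<in>S. emb (f i))"
  by (induction S rule: infinite_finite_induct) (simp_all add: emb_add)

lemma emb_eq_iff: "emb a = emb b \<longleftrightarrow> a = b"
  by transfer (simp add: tqr_rel_def regular_UNIV_one)

lemma Tqr_mult_emb: "regular_in UNIV d \<Longrightarrow> Tqr a d * emb d = emb a"
  by transfer (auto simp: tqr_rel_def regular_UNIV_one regular_UNIV_mult)

lemma Tqr_1_mult_emb: "regular_in UNIV d \<Longrightarrow> Tqr 1 d * emb d = 1"
  by (simp add: Tqr_mult_emb)

lemma tqr_fraction:
  obtains a d where "regular_in UNIV d" "(x::'a::comm_ring_1 tqr) * emb d = emb a"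
proof -
  have "\<exists>a d. regular_in UNIV d \<and> x * emb d = emb a"
    by transfer (auto simp: tqr_rel_def regular_UNIV_one regular_UNIV_mult)
  then show thesis using that by blast
qed

lemma regular_power: "regular_in UNIV d \<Longrightarrow> regular_in UNIV (d ^ n)"
  by (induction n) (simp_all add: regular_UNIV_one regular_UNIV_mult)

locale unital_hom =
  fixes \<Theta> :: "'a::comm_ring_1 \<Rightarrow> 'l::field"
  assumes hom_1: "\<Theta> 1 = 1" and hom_add: "\<Theta> (x + y) = \<Theta> x + \<Theta> y" and hom_mult: "\<Theta> (x * y) = \<Theta> x * \<Theta> y"
begin

lemma hom_0: "\<Theta> 0 = 0"
  using hom_add[of 0 0] by (metis add.right_neutral add_left_cancel)

lemma hom_uminus: "\<Theta> (- x) = - \<Theta> x"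
  using hom_add[of x "- x"] hom_0 by (simp add: eq_neg_iff_add_eq_0 add.commute)

lemma hom_power: "\<Theta> (x ^ n) = \<Theta> x ^ n"
  by (induction n) (simp_all add: hom_1 hom_mult)

text \<open>Fractions with some denominator of nonzero image. Two representations satisfy a d' = a'
  d, since both sides equal x d d', so the quotient of the images does not depend on the
  choice.\<close>

definition ext_dom :: "'a tqr set" where
  "ext_dom = {x. \<exists>a d. x * emb d = emb a \<and> \<Theta> d \<noteq> 0}"

definition ext :: "'a tqr \<Rightarrow> 'l" where
  "ext x = (THE l. \<exists>a d. x * emb d = emb a \<and> \<Theta> d \<noteq> 0 \<and> l = \<Theta> a / \<Theta> d)"

lemma ext_eq:
  assumes "x * emb d = emb a" "\<Theta> d \<noteq> 0" shows "ext x = \<Theta> a / \<Theta> d"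
  unfolding ext_def
proof (rule the_equality)
  fix l assume "\<exists>a d. x * emb d = emb a \<and> \<Theta> d \<noteq> 0 \<and> l = \<Theta> a / \<Theta> d"
  then obtain a' d' where *: "x * emb d' = emb a'" "\<Theta> d' \<noteq> 0" "l = \<Theta> a' / \<Theta> d'" by blast
  have "emb (a * d') = (x * emb d') * emb d" by (simp add: emb_mult assms(1)[symmetric] ac_simps)
  also have "\<dots> = emb (a' * d)" unfolding *(1) by (simp add: emb_mult)
  finally have "\<Theta> a * \<Theta> d' = \<Theta> a' * \<Theta> d" unfolding emb_eq_iff using hom_mult by metis
  then show "l = \<Theta> a / \<Theta> d" unfolding *(3) using *(2) assms(2) by (simp add: frac_eq_eq)
qed (use assms in blast)

lemma ext_domI: "x * emb d = emb a \<Longrightarrow> \<Theta> d \<noteq> 0 \<Longrightarrow> x \<in> ext_dom"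
  by (auto simp: ext_dom_def)

lemma ext_emb: "emb a \<in> ext_dom" "ext (emb a) = \<Theta> a"
  using ext_domI[of "emb a" 1 a] ext_eq[of "emb a" 1 a] by (simp_all add: hom_1)

lemma ext_add_mult:
  assumes "x \<in> ext_dom" "y \<in> ext_dom"
  shows "x + y \<in> ext_dom" "x * y \<in> ext_dom" "- x \<in> ext_dom"
    "ext (x + y) = ext x + ext y" "ext (x * y) = ext x * ext y" "ext (- x) = - ext x"
proof -
  obtain a d where x: "x * emb d = emb a" "\<Theta> d \<noteq> 0" using assms(1) by (auto simp: ext_dom_def)
  obtain a' d' where y: "y * emb d' = emb a'" "\<Theta> d' \<noteq> 0" using assms(2) by (auto simp: ext_dom_def)
  have dd: "\<Theta> (d * d') \<noteq> 0" using x y by (simp add: hom_mult)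
  have "(x + y) * emb (d * d') = (x * emb d) * emb d' + (y * emb d') * emb d"
    by (simp add: emb_mult algebra_simps)
  also have "\<dots> = emb (a * d' + a' * d)" unfolding x(1) y(1) by (simp add: emb_mult emb_add)
  finally have s: "(x + y) * emb (d * d') = emb (a * d' + a' * d)" .
  have "(x * y) * emb (d * d') = (x * emb d) * (y * emb d')" by (simp add: emb_mult ac_simps)
  also have "\<dots> = emb (a * a')" unfolding x(1) y(1) by (simp add: emb_mult)
  finally have m: "(x * y) * emb (d * d') = emb (a * a')" .
  have "emb (- a) + emb a = 0" by (simp flip: emb_add)
  then have "emb (- a) = - emb a" by (simp add: eq_neg_iff_add_eq_0)
  then have u: "(- x) * emb d = emb (- a)" using x(1) by simp
  show "x + y \<in> ext_dom" "x * y \<in> ext_dom" "- x \<in> ext_dom" using ext_domI s m u dd x(2) by blast+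
  show "ext (x + y) = ext x + ext y"
    using x(2) y(2) unfolding ext_eq[OF s dd] ext_eq[OF x] ext_eq[OF y] by (simp add: hom_add hom_mult add_frac_eq)
  show "ext (x * y) = ext x * ext y"
    using ext_eq[OF m dd] ext_eq[OF x] ext_eq[OF y] x(2) y(2) by (simp add: hom_mult)
  show "ext (- x) = - ext x" using ext_eq[OF u x(2)] ext_eq[OF x] by (simp add: hom_uminus)
qed

lemma subring_ext_dom: "subring_set ext_dom"
proof
  show "1 \<in> ext_dom" using ext_emb(1)[of 1] by simp
  show "x - y \<in> ext_dom" if "x \<in> ext_dom" "y \<in> ext_dom" for x y
    using ext_add_mult(1)[OF that(1) ext_add_mult(3)[OF that(2) that(2)]] by simp
qed (rule ext_add_mult(2))

lemma ext_1: "ext 1 = 1"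
  using ext_emb(2)[of 1] by (simp add: hom_1)

lemma ext_0: "ext 0 = 0"
  using ext_emb(2)[of 0] by (simp add: hom_0)

lemma ext_power: "x \<in> ext_dom \<Longrightarrow> ext (x ^ n) = ext x ^ n"
  using subring_set.power_mem[OF subring_ext_dom]
  by (induction n) (simp_all add: ext_1 ext_add_mult(5))

lemma ext_sum: "(\<And>i. i \<in> S \<Longrightarrow> f i \<in> ext_dom) \<Longrightarrow> ext (sum f S) = (\<Sum>i\<in>S. ext (f i))"
proof (induction S rule: infinite_finite_induct)
  case (insert x S)
  then have "sum f S \<in> ext_dom" by (intro subring_set.sum_mem[OF subring_ext_dom]) auto
  then show ?case using insert by (simp add: ext_add_mult(4))
qed (simp_all add: ext_0)

lemma ext_integral:
  assumes A: "subring_set A" "A \<subseteq> ext_dom" "ext ` A \<subseteq> S" and S: "subring_set S"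
    and x: "x \<in> ext_dom" "integral_over A x"
  shows "integral_over S (ext x)"
proof -
  interpret E: subring_set ext_dom by (rule subring_ext_dom)
  obtain n c where c: "\<forall>i<n. c i \<in> A" "x ^ n = (\<Sum>i<n. c i * x ^ i)"
    using x(2) unfolding integral_over_iff[OF A(1)] by blast
  have cd: "c i \<in> ext_dom" if "i < n" for i using that c(1) A(2) by blast
  have "ext x ^ n = ext (\<Sum>i<n. c i * x ^ i)" using ext_power[OF x(1)] c(2) by metis
  also have "\<dots> = (\<Sum>i<n. ext (c i) * ext x ^ i)"
    using cd x(1) E.power_mem by (subst ext_sum) (auto simp: ext_add_mult(5) ext_power E.mult_mem)
  finally show ?thesis unfolding integral_over_iff[OF S] using c(1) A(3)
    by (intro exI[of _ n] exI[of _ "\<lambda>i. ext (c i)"]) auto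
qed

end

lemma regular_const_poly: "regular_in UNIV d \<Longrightarrow> regular_in UNIV [:d:]"
  by (auto simp: regular_in_def poly_eq_iff mult.commute)

text \<open>Fractions of \<open>R\<close> viewed as constant fractions of R[X]: the passage from
  \<open>C'\<close> to the ambient ring of the Itoh rings.\<close>

lift_definition const_tqr :: "'a::comm_ring_1 tqr \<Rightarrow> 'a poly tqr" is "\<lambda>x. ([:fst x:], [:snd x:])"
  by (simp add: tqr_rel_def regular_const_poly ac_simps)

lemma const_tqr_add: "const_tqr (x + y) = const_tqr x + const_tqr y"
  by transfer (simp add: tqr_rel_def regular_const_poly regular_UNIV_mult ac_simps)

lemma const_tqr_mult: "const_tqr (x * y) = const_tqr x * const_tqr y"
  by transfer (simp add: tqr_rel_def regular_const_poly regular_UNIV_mult ac_simps)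

lemma const_tqr_emb: "const_tqr (emb a) = emb [:a:]"
  by transfer (simp add: tqr_rel_def regular_const_poly regular_UNIV_one)

lemma const_tqr_1: "const_tqr 1 = 1"
  using const_tqr_emb[of 1] by (simp flip: one_pCons)

lemma const_tqr_0: "const_tqr 0 = 0"
  using const_tqr_emb[of 0] by simp

lemma const_tqr_uminus: "const_tqr (- x) = - const_tqr x"
proof -
  have "const_tqr x + const_tqr (- x) = 0" by (metis const_tqr_add const_tqr_0 add.right_inverse)
  then show ?thesis by (simp add: eq_neg_iff_add_eq_0 add.commute)
qed

lemma const_tqr_power: "const_tqr (x ^ n) = const_tqr x ^ n"
  by (induction n) (simp_all add: const_tqr_1 const_tqr_mult)

lemma const_tqr_sum: "const_tqr (sum f S) = (\<Sum>i\<in>S. const_tqr (f i))"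
  by (induction S rule: infinite_finite_induct) (simp_all add: const_tqr_0 const_tqr_add)

section \<open>The local structure at a Rees valuation\<close>

text \<open>Kept apart from \<open>rees_point\<close> because the equality v(b) = k, assumed there,
  is first derived here in the form IV = bV.\<close>

locale rees_residue =
  fixes I :: "'r::comm_ring_1 set" and b :: 'r and \<phi> :: "'r tqr \<Rightarrow> 'l::field"
    and p\<^sub>0 z\<^sub>0 :: "'r tqr set" and F :: "'l set" and v :: "'l \<Rightarrow> int" and \<pi> :: 'l
  assumes b_reg: "regular_in UNIV b" and b_mem: "b \<in> I" and ideal_I: "ideal I ring_of_type_algebra"
    and p_prime: "primeideal p\<^sub>0 (ring_on (int_closure (blowup_ring I b)))"
    and z_min: "unique_minimal_prime_in (int_closure (blowup_ring I b)) p\<^sub>0 z\<^sub>0"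
    and val: "disc_val F v \<pi>"
    and loc: "residue_localization (int_closure (blowup_ring I b)) p\<^sub>0 z\<^sub>0 \<phi> (valued_field.level F v 0)"
begin

sublocale V: disc_val F v \<pi> by (rule val)

abbreviation "C \<equiv> blowup_ring I b"
abbreviation "C' \<equiv> int_closure (blowup_ring I b)"
abbreviation "\<beta> \<equiv> \<phi> (emb b)"
abbreviation "\<theta> r \<equiv> \<phi> (emb r)"
abbreviation "b_inv \<equiv> Tqr 1 b"

sublocale C': subring_set C' by (rule primeideal_subring_set[OF p_prime])

lemma subring_C: "subring_set C"
  unfolding blowup_ring_def by (rule subring_set_ring_gen)

sublocale C: subring_set C by (rule subring_C)

lemma emb_C: "emb r \<in> C"
  unfolding blowup_ring_def by (rule ring_gen_incl) auto

text \<open>C contains \<open>R\<close>, so its total quotient ring is the whole type; the integral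
  closure then consists of all integral elements.\<close>

lemma tot_quot_C: "x \<in> tot_quot C"
proof -
  obtain a d where ad: "regular_in UNIV d" "x * emb d = emb a" by (rule tqr_fraction)
  have "regular_in C (emb d)"
    unfolding regular_in_def
  proof (intro conjI ballI impI)
    fix y assume "y * emb d = 0"
    then have "Tqr 1 d * (y * emb d) = 0" by simp
    then have "y * (Tqr 1 d * emb d) = 0" by (simp only: ac_simps)
    then show "y = 0" using Tqr_1_mult_emb[OF ad(1)] by simp
  qed (rule emb_C)
  then show ?thesis unfolding tot_quot_def using ad(2) emb_C by blast
qed

lemma C'_iff: "x \<in> C' \<longleftrightarrow> integral_over C x"
  by (simp add: int_closure_def tot_quot_C)

lemma C_C': "C \<subseteq> C'"
  using C'_iff integral_over_mem[OF subring_C] by blast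

lemma emb_C': "emb r \<in> C'"
  using emb_C C_C' by blast

lemma phi_hom:
  "x \<in> C' \<Longrightarrow> y \<in> C' \<Longrightarrow> \<phi> (x + y) = \<phi> x + \<phi> y"
  "x \<in> C' \<Longrightarrow> y \<in> C' \<Longrightarrow> \<phi> (x * y) = \<phi> x * \<phi> y" "\<phi> 1 = 1"
  and phi_ker: "z\<^sub>0 = {x \<in> C'. \<phi> x = 0}"
  and phi_loc: "V.level 0 = {\<phi> x / \<phi> y | x y. x \<in> C' \<and> y \<in> C' - p\<^sub>0}"
proof -
  have h: "\<phi> \<in> ring_hom (ring_on C') ring_of_type_algebra" "a_kernel (ring_on C') ring_of_type_algebra \<phi> = z\<^sub>0"
    "V.level 0 = {\<phi> x / \<phi> y | x y. x \<in> C' \<and> y \<in> C' - p\<^sub>0}"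
    using loc by (auto simp: residue_localization_def)
  show "x \<in> C' \<Longrightarrow> y \<in> C' \<Longrightarrow> \<phi> (x + y) = \<phi> x + \<phi> y"
    "x \<in> C' \<Longrightarrow> y \<in> C' \<Longrightarrow> \<phi> (x * y) = \<phi> x * \<phi> y" "\<phi> 1 = 1"
    using ring_hom_add[OF h(1)] ring_hom_mult[OF h(1)] ring_hom_one[OF h(1)] by auto
  show "z\<^sub>0 = {x \<in> C'. \<phi> x = 0}" using h(2) by (auto simp: a_kernel_def')
  show "V.level 0 = {\<phi> x / \<phi> y | x y. x \<in> C' \<and> y \<in> C' - p\<^sub>0}" by (rule h(3))
qed

lemma z_sub_p: "z\<^sub>0 \<subseteq> p\<^sub>0"
  using z_min by (simp add: unique_minimal_prime_in_def)

lemma one_notin_p: "1 \<notin> p\<^sub>0"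
  by (rule primeidealD_ring_on(2)[OF p_prime])

lemma phi_power: "x \<in> C' \<Longrightarrow> \<phi> (x ^ n) = \<phi> x ^ n"
  by (induction n) (simp_all add: phi_hom C'.power_mem)

lemma phi_diff: "x \<in> C' \<Longrightarrow> y \<in> C' \<Longrightarrow> \<phi> (x - y) = \<phi> x - \<phi> y"
  using phi_hom(1)[of "x - y" y] C'.diff_mem by simp

lemma phi_level: "x \<in> C' \<Longrightarrow> \<phi> x \<in> V.level 0"
  unfolding phi_loc using one_notin_p C'.one_mem phi_hom(3) by (force intro: exI[of _ x] exI[of _ 1])

lemma phi_F: "x \<in> C' \<Longrightarrow> \<phi> x \<in> F"
  using phi_level V.level_mem by blast

lemma phi_nz: "x \<in> C' \<Longrightarrow> x \<notin> p\<^sub>0 \<Longrightarrow> \<phi> x \<noteq> 0"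
  using z_sub_p phi_ker by blast

text \<open>If x in \<open>p\<^sub>0\<close> had a unit as image, with inverse \<phi> a / \<phi> c,
  then c - ax would lie in the kernel and c in \<open>p\<^sub>0\<close>. If x is outside,
  \<open>inverse (\<phi> x)\<close> lies in V by the form of the localization.\<close>

lemma p_iff: "x \<in> C' \<Longrightarrow> x \<in> p\<^sub>0 \<longleftrightarrow> \<phi> x \<in> V.level 1"
proof
  assume x: "x \<in> C'"
  { assume xp: "x \<in> p\<^sub>0"
    show "\<phi> x \<in> V.level 1"
    proof (rule V.levelI[OF phi_F[OF x]], rule ccontr)
      assume "\<phi> x \<noteq> 0" "\<not> 1 \<le> v (\<phi> x)"
      then have "inverse (\<phi> x) \<in> V.level 0"
        using phi_F[OF x] by (intro V.levelI V.inverse_mem) (simp_all add: V.v_inverse)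
      then obtain a c where ac: "inverse (\<phi> x) = \<phi> a / \<phi> c" "a \<in> C'" "c \<in> C'" "c \<notin> p\<^sub>0" unfolding phi_loc by blast
      have "\<phi> c = \<phi> (a * x)" using ac phi_nz[OF ac(3,4)] \<open>\<phi> x \<noteq> 0\<close> x by (simp add: phi_hom field_simps)
      then have "c - a * x \<in> z\<^sub>0" using ac x by (simp add: phi_ker phi_diff C'.mems)
      then have "(c - a * x) + a * x \<in> p\<^sub>0"
        using z_sub_p idealD_ring_on(3,4)[OF primeidealD_ring_on(1)[OF p_prime]] xp ac(2) by blast
      then show False using ac(4) by simp
    qed }
  { assume l: "\<phi> x \<in> V.level 1"
    show "x \<in> p\<^sub>0"
    proof (rule ccontr)
      assume xp: "x \<notin> p\<^sub>0"
      have nz: "\<phi> x \<noteq> 0" by (rule phi_nz[OF x xp])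
      have "\<phi> 1 / \<phi> x \<in> V.level 0" unfolding phi_loc using x xp C'.one_mem by blast
      then have "0 \<le> v (inverse (\<phi> x))" using V.level_v[of "\<phi> 1 / \<phi> x" 0] nz phi_hom(3) by (simp add: inverse_eq_divide)
      then show False using V.v_inverse[OF phi_F[OF x] nz] V.level_v[OF l nz] by simp
    qed }
qed

lemma annihilator:
  assumes "x \<in> C'" "\<phi> x = 0"
  obtains s n where "s \<in> C'" "s \<notin> p\<^sub>0" "s * x ^ n = 0"
  using unique_minimal_prime_annihilator[OF p_prime z_min, of x] assms phi_ker by blast

text \<open>If the image vanished, s d^n = 0 for some s outside \<open>p\<^sub>0\<close>; but d is a
  unit of the total quotient ring, so s = 0.\<close>

lemma theta_regular_nz: assumes "regular_in UNIV d" shows "\<theta> d \<noteq> 0"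
proof
  assume "\<theta> d = 0"
  then obtain s n where s: "s \<in> C'" "s \<notin> p\<^sub>0" "s * emb d ^ n = 0" using annihilator[OF emb_C'] by blast
  have "s = s * (Tqr 1 d * emb d) ^ n" using Tqr_1_mult_emb[OF assms] by simp
  also have "\<dots> = Tqr 1 d ^ n * (s * emb d ^ n)" by (simp add: power_mult_distrib ac_simps)
  finally show False using s idealD_ring_on(2)[OF primeidealD_ring_on(1)[OF p_prime]] by simp
qed

lemma beta_nz: "\<beta> \<noteq> 0"
  by (rule theta_regular_nz[OF b_reg])

text \<open>Every a in I is (a/b) b with a/b in C, so the image of b has least value among the
  images of I.\<close>

lemma genideal_theta: "genideal (ring_on (V.level 0)) ((\<lambda>r. \<theta> r) ` I) = V.level (v \<beta>)"
proof (rule V.level_eq_genideal)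
  show "\<beta> \<in> (\<lambda>r. \<theta> r) ` I" using b_mem by blast
  show "\<beta> \<noteq> 0" by (rule beta_nz)
  show "(\<lambda>r. \<theta> r) ` I \<subseteq> V.level (v \<beta>)"
  proof clarify
    fix a assume "a \<in> I"
    then have "Tqr a b \<in> C" unfolding blowup_ring_def by (intro ring_gen_incl) auto
    then have q: "Tqr a b \<in> C'" using C_C' by blast
    then have a: "\<theta> a = \<phi> (Tqr a b) * \<beta>"
      using phi_hom(2)[OF _ emb_C'] Tqr_mult_emb[OF b_reg] by metis
    show "\<theta> a \<in> V.level (v \<beta>)"
    proof (rule V.levelI)
      show "\<theta> a \<in> F" by (rule phi_F[OF emb_C'])
      assume "\<theta> a \<noteq> 0"
      then show "v \<beta> \<le> v (\<theta> a)"
        unfolding a using V.v_mult[OF phi_F[OF q] phi_F[OF emb_C']] V.level_v[OF phi_level[OF q]] by auto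
    qed
  qed
  show "0 \<le> v \<beta>" by (rule V.level_v[OF phi_level[OF emb_C'] beta_nz])
qed (rule refl)

end

section \<open>Division by b in C' after inverting one element\<close>

locale rees_point = rees_residue I b \<phi> p\<^sub>0 z\<^sub>0 F v \<pi>
  for I :: "'r::comm_ring_1 set" and b :: 'r and \<phi> :: "'r tqr \<Rightarrow> 'l::field"
    and p\<^sub>0 z\<^sub>0 :: "'r tqr set" and F :: "'l set" and v :: "'l \<Rightarrow> int" and \<pi> :: 'l +
  fixes k :: nat and x\<^sub>0 :: "'r tqr"
  assumes x0_mem: "x\<^sub>0 \<in> C'" and p_eq: "p\<^sub>0 = {y \<in> C'. y * x\<^sub>0 \<in> cgenideal (ring_on C') (emb b)}"
    and v_beta: "v \<beta> = int k"
begin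

lemma nilpotent_C': "x ^ n = 0 \<Longrightarrow> x \<in> C'"
  unfolding C'_iff by (rule integral_over_of_nilpotent[OF subring_C])

lemma b_inv: "b_inv * emb b = 1" "emb b * b_inv = 1"
  using Tqr_1_mult_emb[OF b_reg] by (simp_all add: mult.commute)

lemma b_inv_pow: "b_inv ^ n * emb b ^ n = 1"
  using b_inv by (simp flip: power_mult_distrib)

lemma bC'_iff: "x \<in> cgenideal (ring_on C') (emb b) \<longleftrightarrow> x * b_inv \<in> C'"
proof
  assume "x \<in> cgenideal (ring_on C') (emb b)"
  then obtain c where "c \<in> C'" "x = c * emb b" by (auto simp: cgenideal_ring_on)
  then show "x * b_inv \<in> C'" using b_inv by (simp add: mult.assoc)
next
  assume "x * b_inv \<in> C'"
  moreover have "x = (x * b_inv) * emb b" using b_inv by (simp add: mult.assoc)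
  ultimately show "x \<in> cgenideal (ring_on C') (emb b)" unfolding cgenideal_ring_on by blast
qed

lemma p_iff_x0: "c \<in> C' \<Longrightarrow> c \<in> p\<^sub>0 \<longleftrightarrow> c * x\<^sub>0 * b_inv \<in> C'"
  by (subst p_eq) (simp add: bC'_iff)

lemma beta_F: "\<beta> \<in> F"
  by (rule phi_F[OF emb_C'])

lemma k_pos: "0 < k"
proof -
  have "emb b * x\<^sub>0 * b_inv = x\<^sub>0" using b_inv by (simp add: ac_simps)
  then have "emb b \<in> p\<^sub>0" using p_iff_x0[OF emb_C'] x0_mem by simp
  then show ?thesis using p_iff[OF emb_C'] V.level_v[of \<beta> 1] beta_nz v_beta by simp
qed

lemma phi_div_b: "c * b_inv \<in> C' \<Longrightarrow> \<beta> * \<phi> (c * b_inv) = \<phi> c"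
proof -
  assume c: "c * b_inv \<in> C'"
  have "emb b * (c * b_inv) = c" using b_inv by (simp add: mult.left_commute)
  then show ?thesis using phi_hom(2)[OF emb_C' c, of b] by simp
qed

text \<open>If \<open>x\<^sub>0\<close> had value at least \<open>k\<close>, then a multiple of \<open>x\<^sub>0\<close> by an element outside \<open>p\<^sub>0\<close> would lie in \<open>bC'\<close>
  up to a nilpotent; but nilpotents are integral, hence divisible by \<open>b\<close> in \<open>C'\<close>.\<close>

lemma v_x0: "\<phi> x\<^sub>0 \<noteq> 0" "v (\<phi> x\<^sub>0) = int k - 1"
proof -
  have nge: "\<phi> x\<^sub>0 \<notin> V.level (int k)"
  proof
    assume "\<phi> x\<^sub>0 \<in> V.level (int k)"
    then have "inverse \<beta> * \<phi> x\<^sub>0 \<in> V.level 0"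
      using V.level_scale[of "inverse \<beta>" "\<phi> x\<^sub>0" 0] beta_F beta_nz v_beta by (simp add: V.v_inverse V.inverse_mem)
    then obtain a c where ac: "inverse \<beta> * \<phi> x\<^sub>0 = \<phi> a / \<phi> c" "a \<in> C'" "c \<in> C'" "c \<notin> p\<^sub>0" unfolding phi_loc by blast
    have "\<phi> (c * x\<^sub>0) = \<phi> (a * emb b)"
      using ac phi_nz[OF ac(3,4)] beta_nz x0_mem emb_C'[of b] by (simp add: phi_hom field_simps)
    then have z: "\<phi> (c * x\<^sub>0 - a * emb b) = 0" using ac x0_mem emb_C' by (simp add: phi_diff C'.mult_mem)
    obtain s n where s: "s \<in> C'" "s \<notin> p\<^sub>0" "s * (c * x\<^sub>0 - a * emb b) ^ n = 0"
      using annihilator[OF C'.diff_mem[OF C'.mult_mem[OF ac(3) x0_mem] C'.mult_mem[OF ac(2) emb_C']] z] by blast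
    let ?n = "s * (c * x\<^sub>0 - a * emb b) * b_inv"
    have "?n ^ Suc n = s ^ n * (s * (c * x\<^sub>0 - a * emb b) ^ n) * ((c * x\<^sub>0 - a * emb b) * b_inv ^ Suc n)"
      by (simp add: power_mult_distrib ac_simps)
    then have "?n ^ Suc n = 0" using s(3) by simp
    then have "?n \<in> C'" by (rule nilpotent_C')
    moreover have "?n = (s * c) * x\<^sub>0 * b_inv - s * a"
      using b_inv by (simp add: algebra_simps)
    ultimately have "(s * c) * x\<^sub>0 * b_inv - s * a + s * a \<in> C'" using s ac C'.mems by metis
    then have "s * c \<in> p\<^sub>0" using p_iff_x0[of "s * c"] s ac C'.mult_mem by simp
    then show False using primeidealD_ring_on(3)[OF p_prime] s ac by blast
  qed
  show nz: "\<phi> x\<^sub>0 \<noteq> 0" using nge V.zero_level by metis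
  \<comment> \<open>For the lower bound, take a in \<open>p\<^sub>0\<close> of value 1. Then a times
    \<open>x\<^sub>0\<close> is divisible by b in \<open>C'\<close>, so 1 +
    v(\<open>x\<^sub>0\<close>) is at least k.\<close>
  have "\<pi> \<in> V.level 0" using V.unif_mem V.v_unif by (intro V.levelI) auto
  then obtain a c where ac: "\<pi> = \<phi> a / \<phi> c" "a \<in> C'" "c \<in> C'" "c \<notin> p\<^sub>0" unfolding phi_loc by blast
  have cv: "v (\<phi> c) = 0"
    using phi_level[OF ac(3)] p_iff[OF ac(3)] ac(4) phi_nz[OF ac(3,4)] V.level_v[of "\<phi> c" 0] V.levelI[OF phi_F[OF ac(3)], of 1] by fastforce
  have "\<phi> a = \<pi> * \<phi> c" using ac phi_nz[OF ac(3,4)] by simp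
  then have av: "\<phi> a \<noteq> 0" "v (\<phi> a) = 1"
    using phi_nz[OF ac(3,4)] V.unif_nz V.v_mult[OF V.unif_mem phi_F[OF ac(3)]] V.v_unif cv by auto
  have "a \<in> p\<^sub>0" using p_iff[OF ac(2)] V.levelI[OF phi_F[OF ac(2)]] av by simp
  then have ax: "a * x\<^sub>0 * b_inv \<in> C'" using p_iff_x0[OF ac(2)] by simp
  have eq: "\<beta> * \<phi> (a * x\<^sub>0 * b_inv) = \<phi> a * \<phi> x\<^sub>0" using phi_div_b[OF ax] ac(2) x0_mem by (simp add: phi_hom)
  then have nz2: "\<phi> (a * x\<^sub>0 * b_inv) \<noteq> 0" using av nz by auto
  have "int k + v (\<phi> (a * x\<^sub>0 * b_inv)) = 1 + v (\<phi> x\<^sub>0)"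
    using V.v_mult[OF beta_F phi_F[OF ax] beta_nz nz2] V.v_mult[OF phi_F[OF ac(2)] phi_F[OF x0_mem] av(1) nz] eq v_beta av by simp
  moreover have "0 \<le> v (\<phi> (a * x\<^sub>0 * b_inv))" using V.level_v[OF phi_level[OF ax] nz2] .
  moreover have "v (\<phi> x\<^sub>0) < int k" using nge V.levelI[OF phi_F[OF x0_mem], of "int k"] by fastforce
  ultimately show "v (\<phi> x\<^sub>0) = int k - 1" by linarith
qed

text \<open>Positive value puts c into \<open>p\<^sub>0\<close>, so c times
  \<open>x\<^sub>0 / b\<close> stays in \<open>C'\<close>, and since \<open>x\<^sub>0\<close> has
  value k - 1 its value is one less. The step can be repeated i times.\<close>

lemma divide_step:
  assumes "c \<in> C'" "\<phi> c \<in> V.level (int i)"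
  shows "c * (x\<^sub>0 * b_inv) ^ i \<in> C'"
  using assms
proof (induction i arbitrary: c)
  case (Suc i)
  have "V.level (int (Suc i)) \<subseteq> V.level 1" by (rule V.level_antimono) simp
  then have "c \<in> p\<^sub>0" using p_iff Suc.prems by blast
  then have c': "c * x\<^sub>0 * b_inv \<in> C'" using p_iff_x0 Suc.prems by blast
  have "\<beta> * \<phi> (c * x\<^sub>0 * b_inv) = \<phi> c * \<phi> x\<^sub>0" using phi_div_b[OF c'] Suc.prems x0_mem by (simp add: phi_hom)
  moreover have "\<phi> c * \<phi> x\<^sub>0 \<in> V.level (int (Suc i) + (int k - 1))"
    using Suc.prems v_x0 phi_F[OF x0_mem] by (intro V.level_mult) (auto intro: V.levelI)
  ultimately have "\<phi> (c * x\<^sub>0 * b_inv) \<in> V.level (int i)"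
    using V.level_scale[OF beta_F beta_nz, of "\<phi> (c * x\<^sub>0 * b_inv)" "int i + int k"] v_beta by (simp add: algebra_simps)
  then have "c * x\<^sub>0 * b_inv * (x\<^sub>0 * b_inv) ^ i \<in> C'" using Suc.IH[OF c'] by blast
  then show ?case by (simp add: mult.assoc)
qed simp

text \<open>Inverting \<open>y = x\<^sub>0 ^ k / b ^ (k - 1)\<close> leaves \<open>p\<^sub>0\<close> as the only prime over \<open>b\<close>.\<close>

definition y :: "'r tqr" where
  "y = x\<^sub>0 * (x\<^sub>0 * b_inv) ^ (k - 1)"

lemma y_mem: "y \<in> C'"
  unfolding y_def using divide_step[OF x0_mem, of "k - 1"] v_x0 k_pos phi_F[OF x0_mem]
  by (simp add: V.levelI of_nat_diff)

lemma y_eq: "y * b_inv = (x\<^sub>0 * b_inv) ^ k"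
proof -
  have "(x\<^sub>0 * b_inv) ^ k = (x\<^sub>0 * b_inv) ^ Suc (k - 1)" using k_pos by simp
  then show ?thesis unfolding y_def by (simp add: ac_simps)
qed

lemma v_y: "\<phi> y \<noteq> 0" "v (\<phi> y) = 0"
proof -
  have "y * emb b ^ (k - 1) = x\<^sub>0 ^ k * (b_inv ^ (k - 1) * emb b ^ (k - 1))"
    using k_pos power_add[of x\<^sub>0 1 "k - 1"] unfolding y_def power_mult_distrib by (simp add: ac_simps)
  then have "y * emb b ^ (k - 1) = x\<^sub>0 ^ k" using b_inv_pow by simp
  then have eq: "\<phi> y * \<beta> ^ (k - 1) = \<phi> x\<^sub>0 ^ k"
    using phi_hom(2)[OF y_mem C'.power_mem[OF emb_C'], of b "k - 1"] phi_power x0_mem emb_C' by simp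
  then show nz: "\<phi> y \<noteq> 0" using v_x0(1) by auto
  have "v (\<phi> y) + int (k - 1) * int k = int k * (int k - 1)"
    using arg_cong[OF eq, of v] V.v_mult[OF phi_F[OF y_mem] V.power_mem[OF beta_F], of "k - 1"] nz beta_nz v_x0
    by (simp add: V.v_power[OF beta_F beta_nz] V.v_power[OF phi_F[OF x0_mem]] v_beta)
  then show "v (\<phi> y) = 0" using k_pos by (simp add: of_nat_diff mult.commute)
qed

text \<open>As y/b is the k-th power of \<open>x\<^sub>0 / b\<close>, each division by b paid for
  with a factor y uses up k units of value.\<close>

lemma y_divides:
  assumes "c \<in> C'" "\<phi> c \<in> V.level (int (k * l))"
  shows "y ^ l * c * b_inv ^ l \<in> C'"
proof -
  have "y ^ l * c * b_inv ^ l = c * (y * b_inv) ^ l" by (simp add: power_mult_distrib ac_simps)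
  also have "\<dots> = c * (x\<^sub>0 * b_inv) ^ (k * l)" by (simp add: y_eq power_mult)
  finally show ?thesis using divide_step[OF assms] by simp
qed

text \<open>The denominators of y are arbitrary regular elements of \<open>R\<close>, whereas
  Laurent polynomials can absorb only powers of b. The multiple e of y is made to have just such
  denominators and still value 0: it is (D y^(\<delta>+1))^k / b^\<delta>.\<close>

lemma local_unit:
  obtains e e' \<delta> where "e' \<in> C'" "e = y * e'" "e * emb b ^ \<delta> \<in> C" "\<phi> e \<noteq> 0" "v (\<phi> e) = 0"
proof -
  obtain a d where ad: "regular_in UNIV d" "y * emb d = emb a" by (rule tqr_fraction)
  have "emb d ^ 1 * y \<in> C" using ad(2) emb_C[of a] by (simp add: mult.commute)
  then obtain n where n: "\<And>j. emb d ^ n * y ^ j \<in> C"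
    using integral_imp_almost_integral[OF subring_C emb_C, of d 1 y] y_mem C'_iff by blast
  define D where "D = d ^ n"
  have D: "regular_in UNIV D" "\<And>j. emb D * y ^ j \<in> C"
    using regular_power[OF ad(1)] n by (simp_all add: D_def emb_power)
  have Dnz: "\<theta> D \<noteq> 0" by (rule theta_regular_nz[OF D(1)])
  \<comment> \<open>With \<delta> the value of D, the numerator D^k contributes k\<delta>, which
    b^\<delta> cancels exactly.\<close>
  define \<delta> where "\<delta> = nat (v (\<theta> D))"
  have \<delta>: "v (\<theta> D) = int \<delta>" using V.level_v[OF phi_level[OF emb_C'] Dnz] by (simp add: \<delta>_def)
  define g where "g = y ^ \<delta> * emb D ^ k * b_inv ^ \<delta>"
  have "\<phi> (emb D ^ k) \<in> V.level (int (k * \<delta>))"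
    using Dnz \<delta> phi_F[OF emb_C'] by (intro V.levelI) (simp_all add: phi_power emb_C' V.power_mem V.v_power)
  then have g: "g \<in> C'" unfolding g_def by (intro y_divides C'.power_mem emb_C')
  \<comment> \<open>Of the (\<delta>+1)k factors y, \<delta> are spent in g and one is kept to
    exhibit e as a multiple of y; the rest is a nonnegative number because k is positive.\<close>
  define e' where "e' = y ^ ((\<delta> + 1) * k - \<delta> - 1) * g"
  have e': "e' \<in> C'" unfolding e'_def using g y_mem by (intro C'.mems)
  have "(\<delta> + 1) * 1 \<le> (\<delta> + 1) * k" using k_pos by (intro mult_le_mono2) simp
  then have ex: "(\<delta> + 1) * k = Suc (((\<delta> + 1) * k - \<delta> - 1) + \<delta>)" by simp
  have "y * e' = y ^ Suc (((\<delta> + 1) * k - \<delta> - 1) + \<delta>) * emb D ^ k * b_inv ^ \<delta>"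
    by (simp add: e'_def g_def power_add ac_simps)
  also have "\<dots> = (emb D * y ^ (\<delta> + 1)) ^ k * b_inv ^ \<delta>"
    unfolding ex[symmetric] power_mult power_mult_distrib by (simp only: ac_simps)
  finally have e: "y * e' = (emb D * y ^ (\<delta> + 1)) ^ k * b_inv ^ \<delta>" .
  have eb: "y * e' * emb b ^ \<delta> = (emb D * y ^ (\<delta> + 1)) ^ k"
    unfolding e using b_inv_pow by (simp add: mult.assoc)
  have eC: "y * e' \<in> C'" using y_mem e' C'.mult_mem by blast
  have eq: "\<phi> (y * e') * \<beta> ^ \<delta> = (\<theta> D * \<phi> y ^ (\<delta> + 1)) ^ k"
    using arg_cong[OF eb, of \<phi>] eC emb_C' y_mem by (simp add: phi_hom phi_power C'.mems del: power_Suc)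
  have nz: "\<phi> (y * e') \<noteq> 0" using eq Dnz v_y by auto
  have "v (\<phi> (y * e')) + int \<delta> * int k = int k * int \<delta>"
  proof -
    have "v (\<phi> (y * e') * \<beta> ^ \<delta>) = v (\<phi> (y * e')) + int \<delta> * int k"
      using V.v_mult[OF phi_F[OF eC] V.power_mem[OF beta_F] nz] beta_nz V.v_power[OF beta_F beta_nz] v_beta by simp
    moreover have "v ((\<theta> D * \<phi> y ^ (\<delta> + 1)) ^ k) = int k * int \<delta>"
      using v_y Dnz \<delta> phi_F[OF emb_C', of D] phi_F[OF y_mem]
      by (subst V.v_power) (auto simp: V.v_mult V.v_power V.power_mem V.mult_mem simp del: power_Suc)
    ultimately show ?thesis using eq by simp
  qed
  then have v0: "v (\<phi> (y * e')) = 0" by simp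
  have "y * e' * emb b ^ \<delta> \<in> C" unfolding eb by (rule C.power_mem[OF D(2)])
  then show thesis by (rule that[OF e' refl _ nz v0])
qed

text \<open>Both the localization and the denominators in \<open>C'\<close> can be cleared, so F is
  generated by the image of \<open>R\<close>; this lets polynomials over F be lifted to
  R[X].\<close>

lemma F_fraction:
  assumes "c \<in> F" obtains a d where "\<theta> d \<noteq> 0" "c = \<theta> a / \<theta> d"
proof -
  have C'f: "\<exists>a d. \<theta> d \<noteq> 0 \<and> \<phi> x = \<theta> a / \<theta> d" if "x \<in> C'" for x
  proof -
    obtain a d where ad: "regular_in UNIV d" "x * emb d = emb a" by (rule tqr_fraction)
    have "\<phi> x * \<theta> d = \<theta> a" using phi_hom(2)[OF that emb_C', of d] ad(2) by simp
    then have "\<phi> x = \<theta> a / \<theta> d" using theta_regular_nz[OF ad(1)] by (simp add: field_simps)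
    then show ?thesis using theta_regular_nz[OF ad(1)] by blast
  qed
  have Q: "\<exists>a d. \<theta> d \<noteq> 0 \<and> x / y = \<theta> a / \<theta> d"
    if xy: "\<exists>a d. \<theta> d \<noteq> 0 \<and> x = \<theta> a / \<theta> d" "\<exists>a d. \<theta> d \<noteq> 0 \<and> y = \<theta> a / \<theta> d" "y \<noteq> 0" for x y
  proof -
    obtain a d a' d' where *: "\<theta> d \<noteq> 0" "x = \<theta> a / \<theta> d" "\<theta> d' \<noteq> 0" "y = \<theta> a' / \<theta> d'" using xy by blast
    then have "x / y = \<theta> (a * d') / \<theta> (d * a')" "\<theta> (d * a') \<noteq> 0"
      using xy(3) by (auto simp: emb_mult phi_hom emb_C')
    then show ?thesis by blast
  qed
  have V: "\<exists>a d. \<theta> d \<noteq> 0 \<and> x = \<theta> a / \<theta> d" if "x \<in> V.level 0" for x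
  proof -
    obtain y z where yz: "x = \<phi> y / \<phi> z" "y \<in> C'" "z \<in> C'" "z \<notin> p\<^sub>0" using \<open>x \<in> _\<close> unfolding phi_loc by blast
    show ?thesis unfolding yz(1) by (rule Q[OF C'f[OF yz(2)] C'f[OF yz(3)] phi_nz[OF yz(3,4)]])
  qed
  have "c \<in> tot_quot (V.level 0)" using assms V.tot_quot_level by simp
  then have "\<exists>a d. \<theta> d \<noteq> 0 \<and> c = \<theta> a / \<theta> d"
    unfolding tot_quot_eq_fractions[OF V.subring_level] using V Q by force
  then show thesis using that by blast
qed

sublocale \<theta>: unital_hom "\<lambda>r. \<theta> r"
  by unfold_locales (simp_all add: phi_hom emb_add emb_mult emb_C')

lemma theta_I:
  assumes "a \<in> I" shows "\<theta> a \<in> V.level (int k)"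
proof -
  have "Tqr a b \<in> C" unfolding blowup_ring_def using assms by (intro ring_gen_incl) auto
  then have ab: "Tqr a b \<in> C'" using C_C' by blast
  have "\<theta> a = \<phi> (Tqr a b) * \<beta>" using phi_hom(2)[OF ab emb_C', of b] Tqr_mult_emb[OF b_reg] by simp
  moreover have "\<phi> (Tqr a b) * \<beta> \<in> V.level (0 + int k)"
    using phi_level[OF ab] beta_F v_beta by (intro V.level_mult) (auto intro: V.levelI)
  ultimately show ?thesis by simp
qed

end

section \<open>Laurent polynomials in the total quotient ring\<close>

definition laurent_ring :: "'r::comm_ring_1 poly tqr set" where
  "laurent_ring = ring_gen (range tconst \<union> {uroot, troot})"

lemma subring_laurent_ring: "subring_set laurent_ring"
  unfolding laurent_ring_def by (rule subring_set_ring_gen)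

lemma regular_X: "regular_in UNIV [:0, 1 :: 'r::comm_ring_1:]"
  by (auto simp: regular_in_def)

lemma uroot_troot: "uroot * troot = 1" "troot * uroot = 1"
  using Tqr_1_mult_emb[OF regular_X] by (simp_all add: uroot_def troot_def mult.commute)

lemma uroot_troot_pow: "uroot ^ n * troot ^ n = 1" "troot ^ n * uroot ^ n = 1"
  by (simp_all add: uroot_troot flip: power_mult_distrib)

lemma uroot_cancel: "uroot * z = 0 \<Longrightarrow> z = 0"
  using uroot_troot(2) by (metis mult.assoc mult.left_neutral mult_zero_right)

lemma tconst_add: "tconst (a + b) = tconst a + tconst b"
  by (simp add: tconst_def flip: emb_add)

lemma tconst_mult: "tconst (a * b) = tconst a * tconst b"
  by (simp add: tconst_def mult.commute flip: emb_mult)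

lemma tconst_power: "tconst (a ^ n) = tconst a ^ n"
  by (induction n) (simp_all add: tconst_mult, simp add: tconst_def flip: one_pCons)

lemma tconst_0 [simp]: "tconst 0 = 0"
  by (simp add: tconst_def)

lemma const_tqr_tconst: "const_tqr (emb a) = tconst a"
  by (simp add: const_tqr_emb tconst_def)

lemma emb_poly: "emb P = (\<Sum>i\<le>Polynomial.degree P. tconst (Polynomial.coeff P i) * uroot ^ i)"
proof -
  have "emb (Polynomial.monom a i) = tconst a * uroot ^ i" for a :: 'a and i
    by (simp add: monom_altdef tconst_def uroot_def flip: emb_mult emb_power)
  then have "emb (\<Sum>i\<le>Polynomial.degree P. Polynomial.monom (Polynomial.coeff P i) i) =
      (\<Sum>i\<le>Polynomial.degree P. tconst (Polynomial.coeff P i) * uroot ^ i)"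
    by (simp add: emb_sum)
  then show ?thesis by (simp add: poly_as_sum_of_monoms)
qed

lemma laurent_mems:
  "tconst r \<in> laurent_ring" "uroot \<in> laurent_ring" "troot \<in> laurent_ring"
  by (auto simp: laurent_ring_def intro: ring_gen_incl)

lemma laurent_form:
  assumes "G \<in> laurent_ring" obtains P N where "G * uroot ^ N = emb P" "G = emb P * troot ^ N"
proof -
  have "\<exists>P N. G * uroot ^ N = emb P"
    using assms unfolding laurent_ring_def
  proof (induction rule: ring_gen_induct)
    case one
    show ?case by (intro exI[of _ 1] exI[of _ 0]) simp
  next
    case (incl x)
    then consider r where "x = tconst r" | "x = uroot" | "x = troot" by blast
    then show ?case
    proof cases
      case 1
      then show ?thesis by (intro exI[of _ "[:r:]"] exI[of _ 0]) (simp add: tconst_def)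
    next
      case 2
      then show ?thesis by (intro exI[of _ "[:0, 1:]"] exI[of _ 0]) (simp add: uroot_def)
    next
      case 3
      then show ?thesis by (intro exI[of _ 1] exI[of _ 1]) (simp add: uroot_troot)
    qed
  next
    case (uminus x)
    then obtain P N where "x * uroot ^ N = emb P" by blast
    moreover have "emb (- P) + emb P = 0" by (simp flip: emb_add)
    then have "emb (- P) = - emb P" by (simp only: eq_neg_iff_add_eq_0)
    ultimately have "- x * uroot ^ N = emb (- P)" by simp
    then show ?case by blast
  next
    case (add x y)
    then obtain P N Q M where PQ: "x * uroot ^ N = emb P" "y * uroot ^ M = emb Q" by blast
    have "(x + y) * uroot ^ (N + M) = (x * uroot ^ N) * uroot ^ M + (y * uroot ^ M) * uroot ^ N"
      by (simp add: power_add algebra_simps)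
    also have "\<dots> = emb (P * [:0, 1:] ^ M + Q * [:0, 1:] ^ N)"
      unfolding PQ by (simp add: emb_add emb_mult emb_power uroot_def)
    finally show ?case by blast
  next
    case (mult x y)
    then obtain P N Q M where PQ: "x * uroot ^ N = emb P" "y * uroot ^ M = emb Q" by blast
    have "(x * y) * uroot ^ (N + M) = (x * uroot ^ N) * (y * uroot ^ M)"
      by (simp add: power_add ac_simps)
    also have "\<dots> = emb (P * Q)" unfolding PQ by (simp add: emb_mult)
    finally show ?case by blast
  qed
  then obtain P N where PN: "G * uroot ^ N = emb P" by blast
  have "G = G * (uroot ^ N * troot ^ N)" by (simp add: uroot_troot_pow)
  also have "\<dots> = emb P * troot ^ N" unfolding PN[symmetric] by (simp add: mult.assoc)
  finally show thesis using that PN by blast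
qed

section \<open>The ring whose localizations are the Itoh valuation rings\<close>

definition itoh_base :: "'r::comm_ring_1 set \<Rightarrow> nat \<Rightarrow> 'r poly tqr set" where
  "itoh_base I m = ring_gen (range tconst \<union> {uroot ^ m} \<union> (\<lambda>a. troot ^ m * tconst a) ` I \<union> {uroot})"

lemma itoh_ring_eq: "itoh_ring I m = int_closure (itoh_base I m) \<inter> laurent_ring"
  by (simp add: itoh_ring_def itoh_base_def laurent_ring_def)

lemma subring_itoh_base: "subring_set (itoh_base I m)"
  unfolding itoh_base_def by (rule subring_set_ring_gen)

lemma itoh_base_mems:
  "tconst r \<in> itoh_base I m" "uroot \<in> itoh_base I m" "a \<in> I \<Longrightarrow> troot ^ m * tconst a \<in> itoh_base I m"
  unfolding itoh_base_def by (auto intro: ring_gen_incl)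

lemma emb_itoh_base: "emb P \<in> itoh_base I m"
proof -
  interpret A: subring_set "itoh_base I m" by (rule subring_itoh_base)
  show ?thesis unfolding emb_poly by (intro A.sum_mem A.mult_mem A.power_mem itoh_base_mems)
qed

lemma itoh_base_laurent: "itoh_base I m \<subseteq> laurent_ring"
proof -
  interpret L: subring_set laurent_ring by (rule subring_laurent_ring)
  show ?thesis unfolding itoh_base_def
    by (rule ring_gen_least[OF subring_laurent_ring]) (auto intro!: L.mult_mem L.power_mem laurent_mems)
qed

text \<open>A power of X clears the denominators, and X is invertible in the ambient ring.
  Membership in the Itoh ring thus reduces to integrality of Laurent polynomials.\<close>

lemma laurent_tot_quot: assumes "G \<in> laurent_ring" shows "G \<in> tot_quot (itoh_base I m)"
proof -
  interpret A: subring_set "itoh_base I m" by (rule subring_itoh_base)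
  obtain P N where PN: "G * uroot ^ N = emb P" using laurent_form[OF assms] by metis
  have "z = 0" if "z * uroot ^ N = 0" for z :: "'a poly tqr"
  proof -
    have "z = (z * uroot ^ N) * troot ^ N" by (simp add: mult.assoc uroot_troot_pow)
    then show ?thesis using that by simp
  qed
  then have "regular_in (itoh_base I m) (uroot ^ N)"
    unfolding regular_in_def using A.power_mem itoh_base_mems(2) by blast
  then show ?thesis unfolding tot_quot_def using PN emb_itoh_base by blast
qed

lemma itoh_ring_iff: "x \<in> itoh_ring I m \<longleftrightarrow> x \<in> laurent_ring \<and> integral_over (itoh_base I m) x"
  unfolding itoh_ring_eq int_closure_def using laurent_tot_quot by blast

lemma itoh_base_subset: "itoh_base I m \<subseteq> itoh_ring I m"
  using subsetD[OF itoh_base_laurent] integral_over_mem[OF subring_itoh_base] by (auto simp: itoh_ring_iff)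

text \<open>Finitely many generators of I suffice: the elements a for which t^m a lies in the
  generated ring form an ideal of \<open>R\<close>.\<close>

lemma noetherian_itoh_base:
  assumes N: "noetherian_set (UNIV :: 'r::comm_ring_1 set)"
    and fg: "finite S" "I = genideal (ring_of_type_algebra :: 'r ring) S"
  shows "noetherian_set (itoh_base I m)"
proof -
  define G where "G = insert uroot ((\<lambda>a. troot ^ m * tconst a) ` S)"
  have R: "subring_set (range (tconst :: 'r \<Rightarrow> _))"
  proof
    show "1 \<in> range (tconst :: 'r \<Rightarrow> _)" by (rule image_eqI[of _ _ 1]) (simp_all add: tconst_def flip: one_pCons)
    show "x - y \<in> range tconst" "x * y \<in> range tconst" if "x \<in> range tconst" "y \<in> range tconst" for x y :: "'r poly tqr"
    proof -
      obtain a b where ab: "x = tconst a" "y = tconst b" using \<open>x \<in> _\<close> \<open>y \<in> _\<close> by blast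
      have "x - y = tconst (a - b)" using tconst_add[of "a - b" b] ab by simp
      moreover have "x * y = tconst (a * b)" by (simp add: ab tconst_mult)
      ultimately show "x - y \<in> range tconst" "x * y \<in> range tconst" by blast+
    qed
  qed
  interpret H: subring_set "ring_gen (range tconst \<union> G)" by (rule subring_set_ring_gen)
  interpret U: cring "ring_of_type_algebra :: 'r ring" by (rule cring_from_type_algebra)
  have U: "subring_set (UNIV :: 'r set)" by unfold_locales auto
  have tH: "tconst r \<in> ring_gen (range tconst \<union> G)" for r by (auto intro: ring_gen_incl)
  have "ideal {a. troot ^ m * tconst a \<in> ring_gen (range tconst \<union> G)} (ring_on UNIV)"
    unfolding ideal_ring_on_iff[OF U]
  proof (intro conjI ballI)
    fix a x assume x: "x \<in> {a. troot ^ m * tconst a \<in> ring_gen (range tconst \<union> G)}"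
    have "troot ^ m * tconst (a * x) = tconst a * (troot ^ m * tconst x)" by (simp add: tconst_mult ac_simps)
    then show "a * x \<in> {a. troot ^ m * tconst a \<in> ring_gen (range tconst \<union> G)}" using x H.mult_mem[OF tH] by simp
  qed (auto simp: tconst_add distrib_left H.zero_mem H.add_mem)
  then have "I \<subseteq> {a. troot ^ m * tconst a \<in> ring_gen (range tconst \<union> G)}"
    unfolding fg(2) ring_on_UNIV by (rule U.genideal_minimal) (auto simp: G_def intro: ring_gen_incl)
  moreover have uH: "uroot \<in> ring_gen (range tconst \<union> G)" by (auto simp: G_def intro: ring_gen_incl)
  ultimately have "itoh_base I m \<subseteq> ring_gen (range tconst \<union> G)"
    unfolding itoh_base_def using tH H.power_mem
    by (intro ring_gen_least[OF subring_set_ring_gen]) auto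
  moreover have "S \<subseteq> I" unfolding fg(2) using U.genideal_self[of S] by simp
  then have "ring_gen (range tconst \<union> G) \<subseteq> itoh_base I m"
    by (intro ring_gen_least[OF subring_itoh_base]) (auto simp: G_def intro: itoh_base_mems)
  ultimately have "itoh_base I m = ring_gen (range tconst \<union> G)" by blast
  moreover have "noetherian_set (range (tconst :: 'r \<Rightarrow> _))"
    by (rule noetherian_set_image[OF N]) (simp_all add: tconst_add tconst_mult)
  ultimately show ?thesis
    using noetherian_set_adjoin_finite[OF R, of G] fg(1) by (simp add: G_def)
qed

lemma itoh_ring_almost_integral_iff:
  assumes "noetherian_set (itoh_base I m)" "x \<in> laurent_ring"
  shows "x \<in> itoh_ring I m \<longleftrightarrow> (\<exists>e. \<forall>j. uroot ^ e * x ^ j \<in> itoh_base I m)"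
proof
  obtain P N where PN: "x * uroot ^ N = emb P" using laurent_form[OF assms(2)] by metis
  then have "uroot ^ N * x \<in> itoh_base I m" using emb_itoh_base[of P] by (simp add: mult.commute)
  then show "\<exists>e. \<forall>j. uroot ^ e * x ^ j \<in> itoh_base I m" if "x \<in> itoh_ring I m"
    using that by (intro integral_imp_almost_integral[OF subring_itoh_base itoh_base_mems(2)]) (simp_all add: itoh_ring_iff)
  show "x \<in> itoh_ring I m" if "\<exists>e. \<forall>j. uroot ^ e * x ^ j \<in> itoh_base I m"
    using almost_integral_imp_integral[OF subring_itoh_base assms(1) uroot_cancel] that assms(2)
    unfolding itoh_ring_iff by blast
qed

text \<open>For almost integral elements the denominators of x and y add up, and one exponent then
  covers all monomials in x and y, hence the powers of the product and of the difference.\<close>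

lemma subring_itoh_ring:
  assumes N: "noetherian_set (itoh_base I m)" shows "subring_set (itoh_ring I m)"
proof -
  interpret A: subring_set "itoh_base I m" by (rule subring_itoh_base)
  interpret L: subring_set laurent_ring by (rule subring_laurent_ring)
  note iff = itoh_ring_almost_integral_iff[OF N]
  show ?thesis
  proof
    show "1 \<in> itoh_ring I m" using itoh_base_subset A.one_mem by blast
    fix x y :: "'a poly tqr" assume xy: "x \<in> itoh_ring I m" "y \<in> itoh_ring I m"
    have L: "x \<in> laurent_ring" "y \<in> laurent_ring" using xy by (auto simp: itoh_ring_iff)
    obtain e where e: "\<And>j. uroot ^ e * x ^ j \<in> itoh_base I m" using xy(1) iff[OF L(1)] by blast
    obtain f where f: "\<And>j. uroot ^ f * y ^ j \<in> itoh_base I m" using xy(2) iff[OF L(2)] by blast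
    have xyij: "uroot ^ (e + f) * (x ^ i * y ^ j) \<in> itoh_base I m" for i j
    proof -
      have "uroot ^ (e + f) * (x ^ i * y ^ j) = (uroot ^ e * x ^ i) * (uroot ^ f * y ^ j)" by (simp add: power_add ac_simps)
      then show ?thesis using e f A.mult_mem by simp
    qed
    have "uroot ^ (e + f) * (x * y) ^ j \<in> itoh_base I m" for j using xyij by (simp add: power_mult_distrib)
    then show "x * y \<in> itoh_ring I m" using iff[OF L.mult_mem[OF L]] by blast
    have "uroot ^ (e + f) * (x - y) ^ j \<in> itoh_base I m" for j
    proof -
      have "uroot ^ (e + f) * (x - y) ^ j =
          (\<Sum>i\<le>j. (of_nat (j choose i) * (- 1) ^ (j - i)) * (uroot ^ (e + f) * (x ^ i * y ^ (j - i))))"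
        using binomial_ring[of x "- y" j] power_minus[of y]
        by (simp add: sum_distrib_left ac_simps)
      also have "\<dots> \<in> itoh_base I m"
        by (intro A.sum_mem A.mult_mem xyij A.of_nat_mem A.power_mem A.uminus_mem A.one_mem)
      finally show ?thesis .
    qed
    then show "x - y \<in> itoh_ring I m" using iff[OF L.diff_mem[OF L]] by blast
  qed
qed

text \<open>An element \<open>f\<close> of the integral closure of \<open>A\<close> may be adjoined to \<open>A\<close> first.\<close>

lemma itoh_saturation:
  assumes N: "noetherian_set (itoh_base I m)" and f: "f \<in> itoh_ring I m"
  obtains L where "\<And>n x y. x \<in> itoh_ring I m \<Longrightarrow> y \<in> itoh_ring I m \<Longrightarrow> f ^ n * x = uroot * y \<Longrightarrow> f ^ L * x * troot \<in> itoh_ring I m"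
proof -
  let ?A = "itoh_base I m" and ?B = "ring_gen (itoh_base I m \<union> {f})"
  interpret A: subring_set ?A by (rule subring_itoh_base)
  interpret T: subring_set "itoh_ring I m" by (rule subring_itoh_ring[OF N])
  interpret L: subring_set laurent_ring by (rule subring_laurent_ring)
  have B: "subring_set ?B" "noetherian_set ?B" by (rule subring_set_ring_gen, rule noetherian_set_adjoin[OF subring_itoh_base N])
  have AB: "?A \<subseteq> ?B" by (auto intro: ring_gen_incl)
  have fL: "f \<in> laurent_ring" using f by (simp add: itoh_ring_iff)
  obtain e0 where e0: "\<And>j. uroot ^ e0 * f ^ j \<in> ?A" using f itoh_ring_almost_integral_iff[OF N fL] by blast
  \<comment> \<open>All powers of f share the denominator X^e0, hence so does A[f]. Passing from A
    to A[f] therefore creates no new almost integral Laurent polynomials.\<close>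
  have BA: "uroot ^ e0 * x \<in> ?A" if x: "x \<in> ?B" for x
  proof -
    obtain P where P: "P \<in> polys_over ?A" "x = poly P f" using x unfolding ring_gen_adjoin[OF subring_itoh_base] by blast
    have "uroot ^ e0 * x = (\<Sum>i\<le>Polynomial.degree P. Polynomial.coeff P i * (uroot ^ e0 * f ^ i))"
      unfolding P(2) poly_altdef sum_distrib_left by (simp add: ac_simps)
    also have "\<dots> \<in> ?A" by (intro A.sum_mem A.mult_mem[OF A.polys_over_coeff[OF P(1)] e0])
    finally show ?thesis .
  qed
  have BT: "x \<in> itoh_ring I m" if x: "x \<in> laurent_ring" "integral_over ?B x" for x
  proof -
    obtain P M where "x * uroot ^ M = emb P" using laurent_form[OF x(1)] by metis
    then have "uroot ^ M * x \<in> ?B" using emb_itoh_base[of P] AB by (auto simp: mult.commute)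
    then obtain e where e: "\<And>j. uroot ^ e * x ^ j \<in> ?B"
      using integral_imp_almost_integral[OF B(1) _ _ x(2), of uroot M] itoh_base_mems(2) AB by blast
    have "uroot ^ (e0 + e) * x ^ j \<in> ?A" for j using BA[OF e[of j]] by (simp add: power_add mult.assoc)
    then show ?thesis using itoh_ring_almost_integral_iff[OF N x(1)] by blast
  qed
  have fB: "f \<in> ?B" and uB: "uroot \<in> ?B" using itoh_base_mems(2) AB by (auto intro: ring_gen_incl)
  obtain L where L: "\<And>n e y y' \<zeta>. integral_over ?B y \<Longrightarrow> integral_over ?B y' \<Longrightarrow> uroot ^ e * y \<in> ?B \<Longrightarrow> uroot ^ e * y' \<in> ?B \<Longrightarrow>
    f ^ n * y = uroot * y' \<Longrightarrow> f ^ L * y = uroot * \<zeta> \<Longrightarrow> integral_over ?B \<zeta>"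
    using saturation_bound_integral_closure[OF B fB uB uroot_cancel] by blast
  show thesis
  proof (rule that[of L])
    fix n x y assume xy: "x \<in> itoh_ring I m" "y \<in> itoh_ring I m" "f ^ n * x = uroot * y"
    have xyL: "x \<in> laurent_ring" "y \<in> laurent_ring" using xy by (auto simp: itoh_ring_iff)
    obtain P M where P: "x * uroot ^ M = emb P" using laurent_form[OF xyL(1)] by metis
    obtain Q M' where Q: "y * uroot ^ M' = emb Q" using laurent_form[OF xyL(2)] by metis
    have "uroot ^ (M + M') * x = uroot ^ M' * emb P" "uroot ^ (M + M') * y = uroot ^ M * emb Q"
      by (simp_all add: P[symmetric] Q[symmetric] power_add ac_simps)
    then have mem: "uroot ^ (M + M') * x \<in> ?B" "uroot ^ (M + M') * y \<in> ?B"
      using AB A.mult_mem[OF A.power_mem[OF itoh_base_mems(2)] emb_itoh_base] by (auto simp: subset_iff)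
    have int: "integral_over ?B x" "integral_over ?B y"
      using xy(1,2) integral_over_mono[OF AB] by (auto simp: itoh_ring_iff)
    have "uroot * (f ^ L * x * troot) = f ^ L * x * (uroot * troot)" by (simp only: ac_simps)
    then have "f ^ L * x = uroot * (f ^ L * x * troot)" by (simp add: uroot_troot)
    then have "integral_over ?B (f ^ L * x * troot)" using L[OF int mem xy(3)] by blast
    moreover have "f ^ L * x * troot \<in> laurent_ring"
      using fL xyL laurent_mems(3) by (intro L.mult_mem L.power_mem)
    ultimately show "f ^ L * x * troot \<in> itoh_ring I m" using BT by blast
  qed
qed

section \<open>Itoh valuation rings at a Rees valuation\<close>

text \<open>Exponent bookkeeping for \<open>localizing_element\<close>, where e, t, r, q are the
  constant fraction e, \<tau> = b/u, a constant of \<open>R\<close> and 1/X.\<close>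

lemma monomial_power:
  fixes e t r q :: "'a::comm_monoid_mult"
  shows "(e ^ j * (t ^ l) ^ j * t ^ L * (r * q ^ j)) ^ n = e ^ (j * n) * r ^ n * t ^ (l * (j * n) + L * n) * (q ^ n) ^ j"
  by (simp add: power_mult_distrib power_add ac_simps flip: power_mult)

lemma monomial_collect:
  fixes e r c t :: "'a::comm_monoid_mult"
  shows "e * r * t ^ i * (c * t ^ j) = e * r * c * t ^ (i + j)"
  by (simp add: power_add ac_simps)

text \<open>Both h and s are parameters because the locale is used for D and, with h = 1, for
  U.\<close>

locale itoh_point = rees_point I b \<phi> p\<^sub>0 z\<^sub>0 F v \<pi> k x\<^sub>0
  for I :: "'r::comm_ring_1 set" and b :: 'r and \<phi> :: "'r tqr \<Rightarrow> 'l::field"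
    and p\<^sub>0 z\<^sub>0 :: "'r tqr set" and F :: "'l set" and v :: "'l \<Rightarrow> int" and \<pi> :: 'l and k :: nat and x\<^sub>0 :: "'r tqr" +
  fixes s :: 'l and h :: nat
  assumes h_pos: "0 < h" and trans_s: "transcendental_over F s"
    and noeth: "noetherian_set (UNIV :: 'r set)"
    and fin_gen: "\<exists>S. finite S \<and> I = genideal (ring_of_type_algebra :: 'r ring) S"
begin

sublocale M: monomial_tower F v \<pi> s h
  by unfold_locales (rule h_pos, rule trans_s)

abbreviation "m \<equiv> h * k"
abbreviation "A \<equiv> itoh_base I (h * k)"
abbreviation "T \<equiv> itoh_ring I (h * k)"
abbreviation "lev \<equiv> M.X.W.level"
abbreviation "w \<equiv> M.X.w"

lemma m_pos: "0 < m"
  using h_pos k_pos by simp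

lemma noeth_A: "noetherian_set A"
  using fin_gen noetherian_itoh_base[OF noeth] by blast

sublocale A: subring_set A by (rule subring_itoh_base)
sublocale T: subring_set T by (rule subring_itoh_ring[OF noeth_A])
sublocale L: subring_set laurent_ring by (rule subring_laurent_ring)

lemma A_T: "A \<subseteq> T" and T_L: "T \<subseteq> laurent_ring"
  using itoh_base_subset by (auto simp: itoh_ring_iff)

section \<open>The evaluation X = s and its values on the Itoh ring\<close>

definition \<Theta> :: "'r poly \<Rightarrow> 'l" where
  "\<Theta> P = poly (map_poly (\<lambda>r. \<theta> r) P) s"

lemma phi_0: "\<phi> 0 = 0"
  using \<theta>.hom_0 by simp

lemma coeff_map_theta: "Polynomial.coeff (map_poly (\<lambda>r. \<theta> r) P) i = \<theta> (Polynomial.coeff P i)"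
  by (rule coeff_map_poly) (rule \<theta>.hom_0)

sublocale \<Theta>: unital_hom \<Theta>
proof
  have th_sum: "\<theta> (sum f S) = (\<Sum>i\<in>S. \<theta> (f i))" for f :: "nat \<Rightarrow> 'r" and S
    by (induction S rule: infinite_finite_induct) (simp_all add: phi_0 \<theta>.hom_add)
  show "\<Theta> 1 = 1" by (simp add: \<Theta>_def map_poly_1' phi_hom(3))
  have "map_poly (\<lambda>r. \<theta> r) (P + Q) = map_poly (\<lambda>r. \<theta> r) P + map_poly (\<lambda>r. \<theta> r) Q" for P Q
    by (rule poly_eqI) (simp add: coeff_map_theta \<theta>.hom_add)
  then show "\<Theta> (P + Q) = \<Theta> P + \<Theta> Q" for P Q by (simp add: \<Theta>_def)
  have "map_poly (\<lambda>r. \<theta> r) (P * Q) = map_poly (\<lambda>r. \<theta> r) P * map_poly (\<lambda>r. \<theta> r) Q" for P Q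
    by (rule poly_eqI) (simp add: coeff_map_theta Polynomial.coeff_mult th_sum \<theta>.hom_mult)
  then show "\<Theta> (P * Q) = \<Theta> P * \<Theta> Q" for P Q by (simp add: \<Theta>_def)
qed

abbreviation "\<psi> \<equiv> \<Theta>.ext"

lemma theta_F: "\<theta> r \<in> F"
  by (rule phi_F[OF emb_C'])

lemma map_theta_polys: "map_poly (\<lambda>r. \<theta> r) P \<in> polys_over F"
  using theta_F by (simp add: polys_over_def coeff_map_theta)

lemma Theta_const: "\<Theta> [:r:] = \<theta> r"
proof -
  have "map_poly (\<lambda>r. \<theta> r) [:r:] = [:\<theta> r:]"
    by (rule poly_eqI) (simp add: coeff_map_theta coeff_pCons phi_0 split: nat.split)
  then show ?thesis by (simp add: \<Theta>_def)
qed

lemma Theta_X: "\<Theta> [:0, 1:] = s"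
proof -
  have "map_poly (\<lambda>r. \<theta> r) [:0, 1:] = [:0, 1:]"
    by (rule poly_eqI) (simp add: coeff_map_theta coeff_pCons phi_0 phi_hom(3) split: nat.split)
  then show ?thesis by (simp add: \<Theta>_def)
qed

lemma psi_emb: "emb P \<in> \<Theta>.ext_dom" "\<psi> (emb P) = \<Theta> P"
  by (rule \<Theta>.ext_emb)+

lemma psi_tconst: "tconst r \<in> \<Theta>.ext_dom" "\<psi> (tconst r) = \<theta> r"
  using psi_emb[of "[:r:]"] by (simp_all add: tconst_def Theta_const)

lemma psi_uroot: "uroot \<in> \<Theta>.ext_dom" "\<psi> uroot = s"
  using psi_emb[of "[:0, 1:]"] by (simp_all add: uroot_def Theta_X)

lemma s_nz: "s \<noteq> 0"
  by (rule M.X.s_nz)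

lemma psi_troot: "troot \<in> \<Theta>.ext_dom" "\<psi> troot = inverse s"
proof -
  have eq: "troot * emb [:0, 1:] = emb 1" using uroot_troot(2) by (simp add: uroot_def)
  have nz: "\<Theta> [:0, 1:] \<noteq> 0" using Theta_X s_nz by simp
  show "troot \<in> \<Theta>.ext_dom" by (rule \<Theta>.ext_domI[OF eq nz])
  show "\<psi> troot = inverse s" unfolding \<Theta>.ext_eq[OF eq nz] Theta_X \<Theta>.hom_1 by (simp add: inverse_eq_divide)
qed

sublocale E: subring_set \<Theta>.ext_dom by (rule \<Theta>.subring_ext_dom)

lemma laurent_dom: "laurent_ring \<subseteq> \<Theta>.ext_dom"
  unfolding laurent_ring_def
  by (rule ring_gen_least[OF \<Theta>.subring_ext_dom]) (auto intro: psi_tconst psi_uroot psi_troot)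

lemma T_dom: "T \<subseteq> \<Theta>.ext_dom"
  using T_L laurent_dom by blast

lemmas psi_add = \<Theta>.ext_add_mult(4) and psi_mult = \<Theta>.ext_add_mult(5) and psi_power = \<Theta>.ext_power

lemma psi_const_tqr:
  assumes "x \<in> C'" shows "const_tqr x \<in> \<Theta>.ext_dom" "\<psi> (const_tqr x) = \<phi> x"
proof -
  obtain a d where ad: "regular_in UNIV d" "x * emb d = emb a" by (rule tqr_fraction)
  have nz: "\<theta> d \<noteq> 0" by (rule theta_regular_nz[OF ad(1)])
  have eq: "const_tqr x * emb [:d:] = emb [:a:]" using arg_cong[OF ad(2), of const_tqr] by (simp add: const_tqr_mult const_tqr_emb)
  show "const_tqr x \<in> \<Theta>.ext_dom" using \<Theta>.ext_domI[OF eq] nz by (simp add: Theta_const)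
  have "\<phi> x * \<theta> d = \<theta> a" using phi_hom(2)[OF assms emb_C', of d] ad(2) by simp
  then have "\<theta> a / \<theta> d = \<phi> x" using nz by (simp add: field_simps)
  then show "\<psi> (const_tqr x) = \<phi> x" using \<Theta>.ext_eq[OF eq] nz by (simp add: Theta_const)
qed

lemma s_E: "s \<in> M.E"
  by (rule V.frac_field_incl(2))

lemma inv_s_level: "inverse s ^ n \<in> lev (- int n)"
proof -
  have "inverse s \<in> lev (- 1)"
    using s_E s_nz M.X.w_s by (intro M.X.W.levelI M.X.W.inverse_mem) (simp_all add: M.X.W.v_inverse)
  then show ?thesis using M.X.W.level_power[of "inverse s" "- 1" n] by simp
qed

lemma s_level: "s ^ n \<in> lev (int n)"
  using M.X.W.level_power[of s 1 n] s_E M.X.w_s by (simp add: M.X.W.levelI)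

lemma F_lev: "c \<in> V.level j \<Longrightarrow> c \<in> lev (int h * j)"
  using M.const_lev V.level_mem by blast

lemma theta_lev: "\<theta> r \<in> lev 0"
  using F_lev[OF phi_level[OF emb_C']] by simp

lemma Theta_E: "\<Theta> P \<in> M.E"
  unfolding \<Theta>_def by (rule M.X.poly_s_mem[OF map_theta_polys])

lemma psi_E: "x \<in> laurent_ring \<Longrightarrow> \<psi> x \<in> M.E"
proof -
  assume "x \<in> laurent_ring"
  then obtain P N where "x = emb P * troot ^ N" by (metis laurent_form)
  then have "\<psi> x = \<Theta> P * inverse s ^ N"
    using psi_emb psi_troot E.power_mem by (simp add: psi_mult psi_power)
  then show ?thesis using Theta_E s_E by (simp add: M.X.W.mems M.X.W.inverse_mem)
qed

text \<open>The critical generators are a/u with a in I: a has w-value at least hk and u has value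
  hk.\<close>

lemma psi_A: "x \<in> A \<Longrightarrow> \<psi> x \<in> lev 0"
  unfolding itoh_base_def
proof (induction rule: ring_gen_induct)
  case one
  show ?case using M.X.W.O.one_mem by (simp add: \<Theta>.ext_1)
next
  case (incl x)
  have "\<psi> (troot ^ m * tconst a) \<in> lev 0" if "a \<in> I" for a
  proof -
    have "\<psi> (troot ^ m * tconst a) = inverse s ^ m * \<theta> a"
      using psi_tconst psi_troot E.power_mem by (simp add: psi_mult psi_power)
    moreover have "inverse s ^ m * \<theta> a \<in> lev (- int m + int h * int k)"
      by (rule M.X.W.level_mult[OF inv_s_level F_lev[OF theta_I[OF that]]])
    ultimately show ?thesis by simp
  qed
  moreover have "\<psi> uroot \<in> lev 0" "\<psi> (uroot ^ m) \<in> lev 0"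
    using psi_uroot s_level[of 1] s_level[of m] subsetD[OF M.X.W.level_antimono[of 0 1]]
      subsetD[OF M.X.W.level_antimono[of 0 "int m"]] by (simp_all add: psi_power)
  ultimately show ?case using incl psi_tconst theta_lev by auto
next
  case (uminus x)
  then have "x \<in> A" by (simp add: itoh_base_def)
  then have "x \<in> \<Theta>.ext_dom" using A_T T_dom by blast
  then show ?case using uminus \<Theta>.ext_add_mult(6) M.X.W.O.uminus_mem by simp
next
  case (add x y)
  then have "x \<in> A" "y \<in> A" by (simp_all add: itoh_base_def)
  then have "x \<in> \<Theta>.ext_dom" "y \<in> \<Theta>.ext_dom" using A_T T_dom by blast+
  then show ?case using add psi_add M.X.W.O.add_mem by simp
next
  case (mult x y)
  then have "x \<in> A" "y \<in> A" by (simp_all add: itoh_base_def)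
  then have "x \<in> \<Theta>.ext_dom" "y \<in> \<Theta>.ext_dom" using A_T T_dom by blast+
  then show ?case using mult psi_mult M.X.W.O.mult_mem by simp
qed

lemma psi_T: assumes "x \<in> T" shows "\<psi> x \<in> lev 0"
proof -
  have "integral_over (lev 0) (\<psi> x)"
    using assms A_T T_dom psi_A
    by (intro \<Theta>.ext_integral[OF subring_itoh_base _ _ M.X.W.subring_level, of I m]) (auto simp: itoh_ring_iff)
  then show ?thesis
    using M.X.W.integral_over_level[OF M.X.W.subring_level] psi_E assms T_L by blast
qed

text \<open>This is b/u, an element of the base ring with value 0. Since (a/b)(b/u) = a/u,
  multiplying by it carries R[I/b] into the base ring.\<close>

abbreviation "\<tau> \<equiv> troot ^ m * tconst b"

lemma tau_A: "\<tau> \<in> A"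
  by (rule itoh_base_mems(3)[OF b_mem])

lemma psi_tau: "\<psi> \<tau> = inverse s ^ m * \<beta>"
  using psi_tconst psi_troot E.power_mem by (simp add: psi_mult psi_power)

lemma tau_dom: "\<tau> \<in> \<Theta>.ext_dom"
  using tau_A A_T T_dom by blast

lemma E_of_F: "c \<in> F \<Longrightarrow> c \<in> M.E"
  using V.frac_field_incl(1) by blast

lemma w_tau: "\<psi> \<tau> \<noteq> 0" "w (\<psi> \<tau>) = 0"
proof -
  show "\<psi> \<tau> \<noteq> 0" unfolding psi_tau using s_nz beta_nz by simp
  have "w (inverse s ^ m * \<beta>) = w (inverse s ^ m) + w \<beta>"
    using s_nz beta_nz s_E E_of_F[OF beta_F] by (intro M.X.W.v_mult M.X.W.power_mem M.X.W.inverse_mem) auto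
  moreover have "w (inverse s ^ m) = - int m"
    using s_nz s_E M.X.w_s by (simp add: M.X.W.v_power M.X.W.v_inverse M.X.W.inverse_mem)
  moreover have "w \<beta> = int m" using M.X.w_const[OF beta_F beta_nz] v_beta by simp
  ultimately show "w (\<psi> \<tau>) = 0" unfolding psi_tau by simp
qed

text \<open>The bound is stated for all large exponents so that two of them can be merged for sums
  and split for products.\<close>

lemma C_tau:
  assumes "c \<in> C" shows "\<exists>L. \<forall>L'\<ge>L. const_tqr c * \<tau> ^ L' \<in> A"
  using assms unfolding blowup_ring_def
proof (induction rule: ring_gen_induct)
  case one
  show ?case using A.power_mem[OF tau_A] by (simp add: const_tqr_1)
next
  case (incl x)
  then consider r where "x = emb r" | a where "x = Tqr a b" "a \<in> I" by blast
  then show ?case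
  proof cases
    case 1
    then show ?thesis using A.mult_mem[OF itoh_base_mems(1) A.power_mem[OF tau_A]] by (auto simp: const_tqr_tconst)
  next
    case 2
    have "const_tqr x * \<tau> ^ L' \<in> A" if "L' \<ge> 1" for L'
    proof -
      have "const_tqr x * tconst b = tconst a"
        using arg_cong[OF Tqr_mult_emb[OF b_reg, of a], of const_tqr] 2(1) by (simp add: const_tqr_mult const_tqr_tconst)
      moreover have "const_tqr x * \<tau> = troot ^ m * (const_tqr x * tconst b)" by (simp only: ac_simps)
      ultimately have "const_tqr x * \<tau> = troot ^ m * tconst a" by simp
      moreover have "const_tqr x * \<tau> ^ L' = (const_tqr x * \<tau>) * \<tau> ^ (L' - 1)"
        using that by (cases L') (simp_all add: ac_simps)
      ultimately show ?thesis using A.mult_mem[OF itoh_base_mems(3)[OF 2(2)] A.power_mem[OF tau_A]] by simp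
    qed
    then show ?thesis by blast
  qed
next
  case (uminus x)
  then obtain L where "\<forall>L'\<ge>L. const_tqr x * \<tau> ^ L' \<in> A" by blast
  then have "\<forall>L'\<ge>L. const_tqr (- x) * \<tau> ^ L' \<in> A" using A.uminus_mem by (simp add: const_tqr_uminus)
  then show ?case by blast
next
  case (add x y)
  then obtain L M where "\<forall>L'\<ge>L. const_tqr x * \<tau> ^ L' \<in> A" "\<forall>L'\<ge>M. const_tqr y * \<tau> ^ L' \<in> A" by blast
  then have "\<forall>L'\<ge>max L M. const_tqr (x + y) * \<tau> ^ L' \<in> A" using A.add_mem by (simp add: const_tqr_add distrib_right)
  then show ?case by blast
next
  case (mult x y)
  then obtain L M where LM: "\<forall>L'\<ge>L. const_tqr x * \<tau> ^ L' \<in> A" "\<forall>L'\<ge>M. const_tqr y * \<tau> ^ L' \<in> A" by blast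
  have "const_tqr (x * y) * \<tau> ^ L' \<in> A" if "L' \<ge> L + M" for L'
  proof -
    have "L' = L + (L' - L)" using that by simp
    then have "\<tau> ^ L' = \<tau> ^ L * \<tau> ^ (L' - L)" by (metis power_add)
    then have "const_tqr (x * y) * \<tau> ^ L' = (const_tqr x * \<tau> ^ L) * (const_tqr y * \<tau> ^ (L' - L))"
      by (simp only: const_tqr_mult ac_simps)
    moreover have "const_tqr x * \<tau> ^ L \<in> A" "const_tqr y * \<tau> ^ (L' - L) \<in> A" using LM that by auto
    ultimately show ?thesis using A.mult_mem by metis
  qed
  then show ?case by blast
qed

text \<open>Multiplying the equation of x by \<tau>^(L'n) gives one for x\<tau>^L' with coefficients
  c_i \<tau>^(L'(n-i)). As i < n, at least one factor \<tau>^L' is left to carry c_i into A.\<close>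

lemma C'_tau:
  assumes "x \<in> C'" shows "\<exists>L. \<forall>L'\<ge>L. integral_over A (const_tqr x * \<tau> ^ L')"
proof -
  obtain n c where c: "\<forall>i<n. c i \<in> C" "x ^ n = (\<Sum>i<n. c i * x ^ i)"
    using assms C'_iff unfolding integral_over_iff[OF subring_C] by blast
  have "\<exists>L. \<forall>i<n. \<forall>L'\<ge>L. const_tqr (c i) * \<tau> ^ L' \<in> A"
    using c(1)
  proof (induction n)
    case (Suc n)
    then obtain L M where "\<forall>i<n. \<forall>L'\<ge>L. const_tqr (c i) * \<tau> ^ L' \<in> A" "\<forall>L'\<ge>M. const_tqr (c n) * \<tau> ^ L' \<in> A"
      using C_tau[of "c n"] by (meson less_SucI lessI)
    then have "\<forall>i<Suc n. \<forall>L'\<ge>max L M. const_tqr (c i) * \<tau> ^ L' \<in> A" by (auto simp: less_Suc_eq)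
    then show ?case by blast
  qed simp
  then obtain L where L: "\<And>i L'. i < n \<Longrightarrow> L' \<ge> L \<Longrightarrow> const_tqr (c i) * \<tau> ^ L' \<in> A" by blast
  have "integral_over A (const_tqr x * \<tau> ^ L')" if L': "L' \<ge> L" for L'
  proof -
    define d where "d i = (const_tqr (c i) * \<tau> ^ L') * (\<tau> ^ L') ^ (n - i - 1)" for i
    have "d i \<in> A" if "i < n" for i
      unfolding d_def by (intro A.mult_mem L[OF that L'] A.power_mem tau_A)
    moreover have "(const_tqr x * \<tau> ^ L') ^ n = (\<Sum>i<n. d i * (const_tqr x * \<tau> ^ L') ^ i)"
    proof -
      have "(const_tqr x * \<tau> ^ L') ^ n = const_tqr (x ^ n) * (\<tau> ^ L') ^ n"
        by (simp add: power_mult_distrib const_tqr_power)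
      also have "\<dots> = (\<Sum>i<n. const_tqr (c i) * const_tqr x ^ i * (\<tau> ^ L') ^ n)"
        unfolding c(2) by (simp add: const_tqr_sum const_tqr_mult const_tqr_power sum_distrib_right)
      also have "\<dots> = (\<Sum>i<n. d i * (const_tqr x * \<tau> ^ L') ^ i)"
      proof (rule sum.cong[OF refl])
        fix i assume "i \<in> {..<n}"
        then have "n = 1 + (n - i - 1) + i" by simp
        then have "(\<tau> ^ L') ^ n = \<tau> ^ L' * (\<tau> ^ L') ^ (n - i - 1) * (\<tau> ^ L') ^ i"
          by (metis power_add power_one_right)
        then show "const_tqr (c i) * const_tqr x ^ i * (\<tau> ^ L') ^ n = d i * (const_tqr x * \<tau> ^ L') ^ i"
          unfolding d_def power_mult_distrib[of "const_tqr x"] by (simp only: ac_simps)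
      qed
      finally show ?thesis .
    qed
    ultimately show ?thesis unfolding integral_over_iff[OF subring_itoh_base] by blast
  qed
  then show ?thesis by blast
qed

text \<open>It is enough to treat monomials; raising these to the power \<open>m\<close> leads back to \<open>y_divides\<close>.\<close>

lemma localizing_element:
  obtains f where "f \<in> T" "\<psi> f \<noteq> 0" "w (\<psi> f) = 0"
    "\<And>G. G \<in> laurent_ring \<Longrightarrow> \<psi> G \<in> lev 0 \<Longrightarrow> \<exists>N. f ^ N * G \<in> T"
proof -
  obtain e e' \<delta> where e: "e' \<in> C'" "e = y * e'" "e * emb b ^ \<delta> \<in> C" "\<phi> e \<noteq> 0" "v (\<phi> e) = 0"
    by (rule local_unit)
  have eC: "e \<in> C'" unfolding e(2) using y_mem e(1) C'.mult_mem by blast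
  obtain L1 where L1: "\<And>L'. L' \<ge> L1 \<Longrightarrow> integral_over A (const_tqr e * \<tau> ^ L')" using C'_tau[OF eC] by blast
  obtain L2 where L2: "\<And>L'. L' \<ge> L2 \<Longrightarrow> const_tqr (e * emb b ^ \<delta>) * \<tau> ^ L' \<in> A" using C_tau[OF e(3)] by blast
  \<comment> \<open>The exponent has to make g integral (L1), carry e b^\<delta> into A (L2), and
    supply the factor b^\<delta> needed for g to be a Laurent polynomial.\<close>
  define l where "l = L1 + L2 + \<delta>"
  define g where "g = const_tqr e * \<tau> ^ l"
  have "g \<in> laurent_ring"
  proof -
    have "g = (const_tqr (e * emb b ^ \<delta>) * \<tau> ^ (L1 + L2)) * (troot ^ m) ^ \<delta>"
      unfolding g_def l_def power_add
      by (simp add: const_tqr_mult const_tqr_power const_tqr_tconst power_mult_distrib ac_simps)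
    moreover have "const_tqr (e * emb b ^ \<delta>) * \<tau> ^ (L1 + L2) \<in> laurent_ring"
      by (rule subsetD[OF itoh_base_laurent L2]) simp
    ultimately show ?thesis using laurent_mems(3) by (auto intro!: L.mult_mem L.power_mem)
  qed
  then have gT: "g \<in> T" using L1[of l] by (simp add: itoh_ring_iff g_def l_def)
  have psig: "\<psi> g = \<phi> e * \<psi> \<tau> ^ l"
    unfolding g_def using psi_const_tqr[OF eC] tau_dom E.power_mem by (simp add: psi_mult psi_power)
  have we: "w (\<phi> e) = 0" using M.X.w_const[OF phi_F[OF eC] e(4)] e(5) by simp
  have tauE: "\<psi> \<tau> \<in> M.E" using psi_E tau_A itoh_base_laurent by blast
  have gnz: "\<psi> g \<noteq> 0" unfolding psig using e(4) w_tau(1) by simp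
  have wg: "w (\<psi> g) = 0"
    unfolding psig using M.X.W.v_mult[OF E_of_F[OF phi_F[OF eC]] M.X.W.power_mem[OF tauE] e(4)] w_tau
      M.X.W.v_power[OF tauE w_tau(1)] we by simp
  \<comment> \<open>Both g and \<tau> will be needed to different powers. With their product,
    missing factors of either kind can be supplied afterwards.\<close>
  define f where "f = g * \<tau>"
  have tauT: "\<tau> \<in> T" using tau_A A_T by blast
  have fT: "f \<in> T" unfolding f_def using gT tauT T.mult_mem by blast
  have psif: "\<psi> f = \<psi> g * \<psi> \<tau>" unfolding f_def using gT tauT T_dom by (intro psi_mult) auto
  have gE: "\<psi> g \<in> M.E" using psi_E gT T_L by blast
  have f0: "\<psi> f \<noteq> 0" "w (\<psi> f) = 0"
    unfolding psif using gnz w_tau wg M.X.W.v_mult[OF gE tauE] by auto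
  have monomial: "\<exists>N. f ^ N * (tconst r * uroot ^ i * troot ^ M) \<in> T"
    if r: "\<theta> r \<in> M.X.level (int M - int i)" for r i M
  proof (cases "M \<le> i")
    case True
    then have ui: "uroot ^ i = uroot ^ (i - M) * uroot ^ M" by (simp flip: power_add)
    have "tconst r * uroot ^ i * troot ^ M = tconst r * uroot ^ (i - M) * (uroot ^ M * troot ^ M)"
      unfolding ui by (simp only: ac_simps)
    also have "\<dots> = tconst r * uroot ^ (i - M)" by (simp add: uroot_troot_pow)
    also have "\<dots> \<in> A" by (intro A.mult_mem A.power_mem itoh_base_mems)
    finally show ?thesis using A_T by (intro exI[of _ 0]) auto
  next
    case False
    define j where "j = M - i"
    have "M = i + j" using False by (simp add: j_def)
    then have mon: "tconst r * uroot ^ i * troot ^ M = tconst r * troot ^ j"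
    proof -
      have "tconst r * uroot ^ i * troot ^ M = tconst r * (uroot ^ i * troot ^ i) * troot ^ j"
        unfolding \<open>M = i + j\<close> power_add by (simp only: ac_simps)
      then show ?thesis by (simp add: uroot_troot_pow)
    qed
    have rj: "\<theta> r \<noteq> 0 \<Longrightarrow> int j \<le> int h * v (\<theta> r)" using r False by (simp add: M.level_scaled_iff j_def of_nat_diff)
    \<comment> \<open>The m-th power of r has value hk v(r), and h v(r) is at least j; this is
      exactly what \<open>y_divides\<close> asks for j divisions by b.\<close>
    have "\<theta> (r ^ m) \<in> V.level (int (k * j))"
    proof (cases "\<theta> r = 0")
      case True
      then show ?thesis using V.zero_level by (simp add: \<theta>.hom_power zero_power[OF m_pos])
    next
      case nz: False
      have "int k * int j \<le> int k * (int h * v (\<theta> r))" using rj[OF nz] by (intro mult_left_mono) auto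
      then show ?thesis using nz theta_F
        by (intro V.levelI) (simp_all add: \<theta>.hom_power V.v_power V.power_mem ac_simps)
    qed
    then have "y ^ j * emb (r ^ m) * b_inv ^ j \<in> C'" by (intro y_divides emb_C')
    then have "y ^ (j * m - j) * e' ^ (j * m) * (y ^ j * emb (r ^ m) * b_inv ^ j) \<in> C'"
      by (rule C'.mult_mem[OF C'.mult_mem[OF C'.power_mem[OF y_mem] C'.power_mem[OF e(1)]]])
    also have "y ^ (j * m - j) * e' ^ (j * m) * (y ^ j * emb (r ^ m) * b_inv ^ j) = e ^ (j * m) * emb (r ^ m) * b_inv ^ j"
    proof -
      have "j * 1 \<le> j * m" using m_pos by (intro mult_le_mono2) simp
      then have "j * m = (j * m - j) + j" by simp
      then have "y ^ (j * m) = y ^ (j * m - j) * y ^ j" by (metis power_add)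
      then show ?thesis unfolding e(2) power_mult_distrib by (simp only: ac_simps)
    qed
    finally have x1: "e ^ (j * m) * emb (r ^ m) * b_inv ^ j \<in> C'" (is "?x \<in> C'") .
    obtain L where L: "\<And>L'. L' \<ge> L \<Longrightarrow> integral_over A (const_tqr ?x * \<tau> ^ L')" using C'_tau[OF x1] by blast
    \<comment> \<open>In the m-th power, t^j becomes u^(-j), that is (\<tau>/b)^j. So the fractional
      exponents disappear and an element of \<open>C'\<close> times a power of \<tau>
      remains.\<close>
    let ?G = "g ^ j * \<tau> ^ L * (tconst r * troot ^ j)"
    have bt: "const_tqr b_inv * \<tau> = troot ^ m"
    proof -
      have "const_tqr b_inv * tconst b = 1"
        using arg_cong[OF b_inv(1), of const_tqr] by (simp add: const_tqr_mult const_tqr_tconst const_tqr_1)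
      moreover have "const_tqr b_inv * \<tau> = troot ^ m * (const_tqr b_inv * tconst b)" by (simp only: ac_simps)
      ultimately show ?thesis by simp
    qed
    have "?G ^ m = const_tqr ?x * \<tau> ^ (l * (j * m) + L * m + j)"
    proof -
      have "?G ^ m = (const_tqr e ^ j * (\<tau> ^ l) ^ j * \<tau> ^ L * (tconst r * troot ^ j)) ^ m"
        by (simp only: g_def power_mult_distrib[of "const_tqr e"])
      also have "\<dots> = const_tqr e ^ (j * m) * tconst r ^ m * \<tau> ^ (l * (j * m) + L * m) * (troot ^ m) ^ j"
        by (rule monomial_power)
      also have "\<dots> = const_tqr e ^ (j * m) * tconst r ^ m * \<tau> ^ (l * (j * m) + L * m) * (const_tqr b_inv ^ j * \<tau> ^ j)"
        by (rule arg_cong[OF trans[OF arg_cong[OF bt[symmetric], of "\<lambda>y. y ^ j"] power_mult_distrib]])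
      also have "\<dots> = const_tqr e ^ (j * m) * tconst r ^ m * const_tqr b_inv ^ j * \<tau> ^ (l * (j * m) + L * m + j)"
        by (rule monomial_collect)
      also have "\<dots> = const_tqr ?x * \<tau> ^ (l * (j * m) + L * m + j)"
        by (rule arg_cong[of _ _ "\<lambda>y. y * \<tau> ^ (l * (j * m) + L * m + j)"],
            simp only: const_tqr_mult const_tqr_power const_tqr_tconst tconst_power)
      finally show ?thesis .
    qed
    moreover have "L \<le> l * (j * m) + L * m + j"
      using mult_le_mono2[of 1 m L] m_pos by linarith
    ultimately have "integral_over A (?G ^ m)" using L by presburger
    then have "integral_over A ?G" by (rule integral_over_of_power[OF subring_itoh_base _ m_pos])
    moreover have "?G \<in> laurent_ring"
      using gT tauT T_L laurent_mems by (intro L.mult_mem[OF L.mult_mem[OF L.power_mem L.power_mem] L.mult_mem[OF _ L.power_mem]]) auto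
    ultimately have "?G \<in> T" by (simp add: itoh_ring_iff)
    then have "(g ^ L * \<tau> ^ j) * ?G \<in> T" by (rule T.mult_mem[OF T.mult_mem[OF T.power_mem[OF gT] T.power_mem[OF tauT]]])
    also have "(g ^ L * \<tau> ^ j) * ?G = f ^ (L + j) * (tconst r * uroot ^ i * troot ^ M)"
      unfolding mon f_def power_add power_mult_distrib[of g] by (simp only: ac_simps)
    finally show ?thesis by blast
  qed
  have sums: "\<exists>N. f ^ N * sum H S \<in> T" if "finite S" "\<And>i. i \<in> S \<Longrightarrow> \<exists>N. f ^ N * H i \<in> T" for H :: "nat \<Rightarrow> _" and S
    using that
  proof (induction S rule: finite_induct)
    case empty
    show ?case using T.zero_mem by simp
  next
    case (insert i S)
    then obtain N1 N2 where N: "f ^ N1 * H i \<in> T" "f ^ N2 * sum H S \<in> T" by (metis insertI1 insertI2)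
    have "f ^ (N1 + N2) * sum H (insert i S) = f ^ N2 * (f ^ N1 * H i) + f ^ N1 * (f ^ N2 * sum H S)"
      using insert(1,2) by (simp add: power_add distrib_left ac_simps)
    also have "\<dots> \<in> T" using T.add_mem[OF T.mult_mem[OF T.power_mem[OF fT] N(1)] T.mult_mem[OF T.power_mem[OF fT] N(2)]] .
    finally show ?case by blast
  qed
  have "\<exists>N. f ^ N * G \<in> T" if G: "G \<in> laurent_ring" "\<psi> G \<in> lev 0" for G
  proof -
    obtain P M where PM: "G * uroot ^ M = emb P" "G = emb P * troot ^ M" by (rule laurent_form[OF G(1)])
    have "\<psi> G * s ^ M = \<Theta> P"
      using arg_cong[OF PM(1), of \<psi>] psi_emb psi_uroot G(1) laurent_dom E.power_mem by (auto simp: psi_mult psi_power subset_iff)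
    then have "\<Theta> P \<in> lev (0 + int M)" using M.X.W.level_mult[OF G(2) s_level[of M]] by simp
    then have lv: "\<theta> (Polynomial.coeff P i) \<in> M.X.level (int M - int i)" for i
      unfolding \<Theta>_def M.X.poly_level_iff[OF map_theta_polys] by (simp add: coeff_map_theta)
    have "G = (\<Sum>i\<le>Polynomial.degree P. tconst (Polynomial.coeff P i) * uroot ^ i * troot ^ M)"
      unfolding PM(2) emb_poly by (simp add: sum_distrib_right)
    then show ?thesis using sums[of "{..Polynomial.degree P}" "\<lambda>i. tconst (Polynomial.coeff P i) * uroot ^ i * troot ^ M"] monomial[OF lv]
      by simp
  qed
  then show thesis using that fT f0 by blast
qed

section \<open>Localization of the Itoh ring at the centre of the valuation\<close>

lemma clear_denominators:
  assumes "P \<in> polys_over F"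
  shows "\<exists>R d. \<theta> d \<noteq> 0 \<and> map_poly (\<lambda>r. \<theta> r) R = Polynomial.smult (\<theta> d) P"
  using assms
proof (induction P rule: pCons_induct)
  case 0
  show ?case using phi_hom(3) by (intro exI[of _ 0] exI[of _ 1]) simp
next
  case (pCons c P)
  have "Polynomial.coeff (pCons c P) 0 \<in> F" "\<And>i. Polynomial.coeff (pCons c P) (Suc i) \<in> F"
    using pCons.prems V.polys_over_coeff by blast+
  then have c: "c \<in> F" and P: "P \<in> polys_over F" by (auto simp: polys_over_def)
  obtain R d where Rd: "\<theta> d \<noteq> 0" "map_poly (\<lambda>r. \<theta> r) R = Polynomial.smult (\<theta> d) P" using pCons.IH[OF P] by blast
  obtain a d' where ad: "\<theta> d' \<noteq> 0" "c = \<theta> a / \<theta> d'" using F_fraction[OF c] .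
  have "map_poly (\<lambda>r. \<theta> r) (pCons (a * d) (Polynomial.smult d' R)) = Polynomial.smult (\<theta> (d * d')) (pCons c P)"
  proof (rule poly_eqI)
    fix n
    have "\<theta> (Polynomial.coeff R i) = \<theta> d * Polynomial.coeff P i" for i
      using arg_cong[OF Rd(2), of "\<lambda>P. Polynomial.coeff P i"] by (simp add: coeff_map_theta)
    then show "Polynomial.coeff (map_poly (\<lambda>r. \<theta> r) (pCons (a * d) (Polynomial.smult d' R))) n =
        Polynomial.coeff (Polynomial.smult (\<theta> (d * d')) (pCons c P)) n"
      using ad unfolding coeff_map_theta by (cases n) (simp_all add: \<theta>.hom_mult)
  qed
  moreover have "\<theta> (d * d') \<noteq> 0" using Rd ad by (simp add: \<theta>.hom_mult)
  ultimately show ?case by blast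
qed

lemma E_fraction:
  assumes "c \<in> M.E" obtains P Q where "\<Theta> Q \<noteq> 0" "c = \<Theta> P / \<Theta> Q"
proof -
  obtain P Q where PQ: "P \<in> polys_over F" "Q \<in> polys_over F" "poly Q s \<noteq> 0" "c = poly P s / poly Q s"
    using assms unfolding frac_field_def by blast
  obtain R d where R: "\<theta> d \<noteq> 0" "map_poly (\<lambda>r. \<theta> r) R = Polynomial.smult (\<theta> d) P" using clear_denominators[OF PQ(1)] by blast
  obtain S d' where S: "\<theta> d' \<noteq> 0" "map_poly (\<lambda>r. \<theta> r) S = Polynomial.smult (\<theta> d') Q" using clear_denominators[OF PQ(2)] by blast
  have "\<Theta> ([:d':] * R) = \<theta> d' * \<theta> d * poly P s" "\<Theta> ([:d:] * S) = \<theta> d' * \<theta> d * poly Q s"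
    unfolding \<Theta>.hom_mult Theta_const by (simp_all add: \<Theta>_def R S)
  then show thesis using that[of "[:d:] * S" "[:d':] * R"] PQ R S by simp
qed

definition centre :: "'r poly tqr set" where
  "centre = {x \<in> T. \<psi> x \<in> lev 1}"

definition kernel :: "'r poly tqr set" where
  "kernel = {x \<in> T. \<psi> x = 0}"

lemma psi_T_hom: "x \<in> T \<Longrightarrow> x' \<in> T \<Longrightarrow> \<psi> (x + x') = \<psi> x + \<psi> x'" "x \<in> T \<Longrightarrow> x' \<in> T \<Longrightarrow> \<psi> (x * x') = \<psi> x * \<psi> x'"
  using T_dom psi_add psi_mult by blast+

lemma unit_level: "x \<in> T \<Longrightarrow> x \<notin> centre \<longleftrightarrow> \<psi> x \<noteq> 0 \<and> w (\<psi> x) = 0"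
proof -
  assume x: "x \<in> T"
  have E: "\<psi> x \<in> M.E" using psi_E T_L x by blast
  show ?thesis
  proof
    assume "x \<notin> centre"
    then have n: "\<psi> x \<notin> lev 1" using x by (simp add: centre_def)
    then have nz: "\<psi> x \<noteq> 0" using M.X.W.zero_level by metis
    moreover have "0 \<le> w (\<psi> x)" using M.X.W.level_v[OF psi_T[OF x] nz] .
    moreover have "\<not> 1 \<le> w (\<psi> x)" using n M.X.W.levelI[OF E] by blast
    ultimately show "\<psi> x \<noteq> 0 \<and> w (\<psi> x) = 0" by linarith
  next
    assume "\<psi> x \<noteq> 0 \<and> w (\<psi> x) = 0"
    then show "x \<notin> centre" using M.X.W.level_v[of "\<psi> x" 1] by (auto simp: centre_def)
  qed
qed

lemma prime_centre: "primeideal centre (ring_on T)"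
  unfolding primeideal_ring_on_iff[OF T.subring_set_axioms]
proof (intro conjI ballI impI)
  show "ideal centre (ring_on T)"
    unfolding ideal_ring_on_iff[OF T.subring_set_axioms]
  proof (intro conjI ballI)
    show "0 \<in> centre" using T.zero_mem M.X.W.zero_level by (simp add: centre_def \<Theta>.ext_0)
    fix x assume x: "x \<in> centre"
    show "x + y \<in> centre" if "y \<in> centre" for y
      using x that T.add_mem M.X.W.level_add by (simp add: centre_def psi_T_hom)
    show "a * x \<in> centre" if "a \<in> T" for a
      using x that T.mult_mem M.X.W.level_mult[OF psi_T, of a "\<psi> x" 1] by (simp add: centre_def psi_T_hom)
  qed (auto simp: centre_def)
  show "1 \<notin> centre" using M.X.W.v_one M.X.W.level_v[of 1 1] by (auto simp: centre_def \<Theta>.ext_1)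
  fix x y assume xy: "x \<in> T" "y \<in> T" "x * y \<in> centre"
  show "x \<in> centre \<or> y \<in> centre"
  proof (rule ccontr)
    assume "\<not> ?thesis"
    then have "\<psi> x \<noteq> 0 \<and> w (\<psi> x) = 0" "\<psi> y \<noteq> 0 \<and> w (\<psi> y) = 0" using unit_level xy by blast+
    then have "\<psi> (x * y) \<noteq> 0 \<and> w (\<psi> (x * y)) = 0"
      using xy psi_E T_L M.X.W.v_mult[of "\<psi> x" "\<psi> y"] by (auto simp: psi_T_hom)
    then show False using unit_level[OF T.mult_mem[OF xy(1,2)]] xy(3) by blast
  qed
qed

lemma prime_kernel: "primeideal kernel (ring_on T)"
  unfolding primeideal_ring_on_iff[OF T.subring_set_axioms] ideal_ring_on_iff[OF T.subring_set_axioms]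
  by (auto simp: kernel_def psi_T_hom \<Theta>.ext_0 \<Theta>.ext_1 T.zero_mem T.add_mem T.mult_mem)

lemma kernel_centre: "kernel \<subseteq> centre"
  using M.X.W.zero_level by (auto simp: kernel_def centre_def)

text \<open>All coefficients of x have image 0 in V and are therefore killed, up to powers, by
  factors of nonzero image; these are normalized to elements of T outside the centre.
  \<open>Z\<close> collects what can be killed in this way and is closed under sums and multiples,
  so it contains x.\<close>

lemma kernel_annihilator:
  assumes "x \<in> kernel"
  obtains t n where "t \<in> T" "t \<notin> centre" "t * x ^ n = 0"
proof -
  obtain f where f: "f \<in> T" "\<psi> f \<noteq> 0" "w (\<psi> f) = 0"
    "\<And>G. G \<in> laurent_ring \<Longrightarrow> \<psi> G \<in> lev 0 \<Longrightarrow> \<exists>N. f ^ N * G \<in> T" by (rule localizing_element) blast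
  have fc: "f \<notin> centre" using unit_level f by blast
  define Z where "Z = {g. \<exists>t\<in>T - centre. \<exists>n. t * g ^ n = 0}"
  have one: "1 \<in> T - centre" using T.one_mem primeidealD_ring_on(2)[OF prime_centre] by blast
  have prod: "t * t' \<in> T - centre" if "t \<in> T - centre" "t' \<in> T - centre" for t t'
    using that T.mult_mem primeidealD_ring_on(3)[OF prime_centre] by blast
  have Z0: "0 \<in> Z" unfolding Z_def using one by (auto intro!: bexI[of _ 1] exI[of _ 1])
  have Zadd: "g + g' \<in> Z" if gg: "g \<in> Z" "g' \<in> Z" for g g'
  proof -
    obtain t n t' n' where "t \<in> T - centre" "t * g ^ n = 0" "t' \<in> T - centre" "t' * g' ^ n' = 0" using gg unfolding Z_def by blast
    then show ?thesis using power_sum_annihilated[of t g n t' g' n'] prod unfolding Z_def by blast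
  qed
  have Zmult: "g * a \<in> Z" if gg: "g \<in> Z" for g a
  proof -
    obtain t n where t: "t \<in> T - centre" "t * g ^ n = 0" using gg unfolding Z_def by blast
    have "t * (g * a) ^ n = (t * g ^ n) * a ^ n" by (simp add: power_mult_distrib ac_simps)
    then show ?thesis using t unfolding Z_def by auto
  qed
  have Zsum: "sum H S \<in> Z" if "\<And>i. i \<in> S \<Longrightarrow> H i \<in> Z" for H :: "nat \<Rightarrow> _" and S
    using that by (induction S rule: infinite_finite_induct) (auto intro: Z0 Zadd)
  have const: "tconst a \<in> Z" if a: "\<theta> a = 0" for a
  proof -
    obtain s0 n where s0: "s0 \<in> C'" "s0 \<notin> p\<^sub>0" "s0 * emb a ^ n = 0" using annihilator[OF emb_C' a] .
    obtain c d where cd: "regular_in UNIV d" "s0 * emb d = emb c" by (rule tqr_fraction)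
    have "emb (c * a ^ n) = (s0 * emb a ^ n) * emb d" by (simp add: emb_mult emb_power cd(2)[symmetric] ac_simps)
    then have ca: "c * a ^ n = 0" using s0(3) emb_eq_iff[of "c * a ^ n" 0] by simp
    have "\<theta> c = \<phi> s0 * \<theta> d" using phi_hom(2)[OF s0(1) emb_C', of d] cd(2) by simp
    then have cnz: "\<theta> c \<noteq> 0" using phi_nz[OF s0(1,2)] theta_regular_nz[OF cd(1)] by simp
    have cE: "\<theta> c \<in> M.E" by (rule E_of_F[OF theta_F])
    \<comment> \<open>The annihilating c has nonzero image of some value \<epsilon>. Dividing by
      X^\<epsilon> gives value 0, and a power of f brings the quotient into T, outside the
      centre.\<close>
    define \<epsilon> where "\<epsilon> = nat (w (\<theta> c))"
    have \<epsilon>: "w (\<theta> c) = int \<epsilon>" using M.X.W.level_v[OF theta_lev cnz] by (simp add: \<epsilon>_def)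
    define G where "G = tconst c * troot ^ \<epsilon>"
    have GL: "G \<in> laurent_ring" unfolding G_def by (intro L.mult_mem L.power_mem laurent_mems)
    have psiG: "\<psi> G = \<theta> c * inverse s ^ \<epsilon>"
      unfolding G_def using psi_tconst psi_troot E.power_mem by (simp add: psi_mult psi_power)
    have Gnz: "\<psi> G \<noteq> 0" unfolding psiG using cnz s_nz by simp
    have wG: "w (\<psi> G) = 0"
      unfolding psiG using cE cnz s_E s_nz \<epsilon> M.X.w_s
      by (simp add: M.X.W.v_mult M.X.W.v_power M.X.W.v_inverse M.X.W.inverse_mem M.X.W.power_mem)
    then have "\<psi> G \<in> lev 0" using psi_E[OF GL] by (intro M.X.W.levelI) auto
    then obtain N where N: "f ^ N * G \<in> T" using f(4)[OF GL] by blast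
    have "\<psi> (f ^ N * G) = \<psi> f ^ N * \<psi> G"
      using f(1) T_dom GL laurent_dom E.power_mem by (auto simp: psi_mult psi_power subset_iff)
    moreover have fE: "\<psi> f \<in> M.E" using psi_E T_L f(1) by blast
    ultimately have "\<psi> (f ^ N * G) \<noteq> 0 \<and> w (\<psi> (f ^ N * G)) = 0"
      using f(2,3) Gnz wG psi_E[OF GL] by (simp add: M.X.W.v_mult M.X.W.v_power M.X.W.power_mem)
    then have "f ^ N * G \<notin> centre" using unit_level[OF N] by blast
    moreover have "f ^ N * G * tconst a ^ n = f ^ N * troot ^ \<epsilon> * tconst (c * a ^ n)"
      unfolding G_def by (simp add: tconst_mult tconst_power ac_simps)
    then have "f ^ N * G * tconst a ^ n = 0" by (simp add: ca)
    ultimately show ?thesis using N unfolding Z_def by blast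
  qed
  have x: "x \<in> laurent_ring" "\<psi> x = 0" using assms T_L by (auto simp: kernel_def)
  obtain P M where PM: "x * uroot ^ M = emb P" "x = emb P * troot ^ M" by (rule laurent_form[OF x(1)])
  have "\<psi> x * s ^ M = \<Theta> P"
    using arg_cong[OF PM(1), of \<psi>] psi_emb psi_uroot x(1) laurent_dom E.power_mem by (auto simp: psi_mult psi_power subset_iff)
  then have "\<Theta> P = 0" using x(2) by simp
  then have "map_poly (\<lambda>r. \<theta> r) P = 0" using M.X.poly_s_eq_0[OF map_theta_polys] by (simp add: \<Theta>_def)
  then have "\<theta> (Polynomial.coeff P i) = 0" for i using coeff_map_theta[of P i] by simp
  then have "emb P \<in> Z" unfolding emb_poly by (intro Zsum Zmult const)
  then have "x \<in> Z" unfolding PM(2) by (rule Zmult)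
  then show thesis using that unfolding Z_def by blast
qed

lemma kernel_minimal:
  assumes q: "primeideal q (ring_on T)" "q \<subseteq> centre" shows "kernel \<subseteq> q"
proof
  fix x assume x: "x \<in> kernel"
  obtain t n where t: "t \<in> T" "t \<notin> centre" "t * x ^ n = 0" by (rule kernel_annihilator[OF x])
  have xT: "x \<in> T" using x by (simp add: kernel_def)
  have "t * x ^ n \<in> q" using t(3) idealD_ring_on(2)[OF primeidealD_ring_on(1)[OF q(1)]] by simp
  then have "t \<in> q \<or> x ^ n \<in> q" using primeidealD_ring_on(3)[OF q(1) t(1) T.power_mem[OF xT]] by blast
  then show "x \<in> q" using t(2) q(2) primeidealD_ring_on(4)[OF q(1) xT] by blast
qed

lemma unique_minimal_kernel: "unique_minimal_prime_in T centre kernel"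
proof -
  have "minimal_prime T kernel"
    unfolding minimal_prime_def using prime_kernel kernel_minimal kernel_centre by blast
  moreover have "z' = kernel" if "minimal_prime T z'" "z' \<subseteq> centre" for z'
    using that kernel_minimal[of z'] prime_kernel unfolding minimal_prime_def by blast
  ultimately show ?thesis unfolding unique_minimal_prime_in_def using kernel_centre by blast
qed

text \<open>For y in the centre, y/X has nonnegative value and is carried into T by a power of f
  depending on y; \<open>itoh_saturation\<close> replaces it by one exponent L. Conversely X lies in
  the centre and f^L does not.\<close>

lemma associated_centre: "associated_prime T (cgenideal (ring_on T) uroot) centre"
proof -
  obtain f where f: "f \<in> T" "\<psi> f \<noteq> 0" "w (\<psi> f) = 0"
    "\<And>G. G \<in> laurent_ring \<Longrightarrow> \<psi> G \<in> lev 0 \<Longrightarrow> \<exists>N. f ^ N * G \<in> T" by (rule localizing_element) blast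
  obtain L where L: "\<And>n x y. x \<in> T \<Longrightarrow> y \<in> T \<Longrightarrow> f ^ n * x = uroot * y \<Longrightarrow> f ^ L * x * troot \<in> T"
    using itoh_saturation[OF noeth_A f(1)] by blast
  have fc: "f ^ L \<notin> centre" using primeidealD_ring_on(4)[OF prime_centre f(1)] unit_level[OF f(1)] f by blast
  have uT: "uroot \<in> T" using itoh_base_mems(2) A_T by blast
  have uc: "uroot \<in> centre" using uT psi_uroot s_level[of 1] by (simp add: centre_def)
  have "centre = {y \<in> T. y * f ^ L \<in> cgenideal (ring_on T) uroot}"
  proof (intro Set.equalityI subsetI CollectI conjI)
    fix y assume y: "y \<in> centre"
    then show yT: "y \<in> T" by (simp add: centre_def)
    have yL: "y * troot \<in> laurent_ring" using yT T_L laurent_mems(3) L.mult_mem by blast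
    have "\<psi> (y * troot) = \<psi> y * inverse s ^ 1"
      using yT T_dom psi_troot by (simp add: psi_mult subset_iff)
    moreover have "\<psi> y * inverse s ^ 1 \<in> lev (1 + - int 1)"
      using y by (intro M.X.W.level_mult inv_s_level) (simp add: centre_def)
    ultimately have "\<psi> (y * troot) \<in> lev 0" by simp
    then obtain N where N: "f ^ N * (y * troot) \<in> T" using f(4)[OF yL] by blast
    have "uroot * (f ^ N * (y * troot)) = f ^ N * y * (uroot * troot)" by (simp only: ac_simps)
    then have "f ^ N * y = uroot * (f ^ N * (y * troot))" by (simp add: uroot_troot)
    then have "f ^ L * y * troot \<in> T" by (rule L[OF yT N])
    moreover have "(f ^ L * y * troot) * uroot = y * f ^ L * (troot * uroot)" by (simp only: ac_simps)
    then have "y * f ^ L = (f ^ L * y * troot) * uroot" by (simp add: uroot_troot)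
    ultimately show "y * f ^ L \<in> cgenideal (ring_on T) uroot" unfolding cgenideal_ring_on by blast
  next
    fix y assume y: "y \<in> {y \<in> T. y * f ^ L \<in> cgenideal (ring_on T) uroot}"
    then obtain t where "t \<in> T" "y * f ^ L = t * uroot" by (auto simp: cgenideal_ring_on)
    then have "y * f ^ L \<in> centre" using idealD_ring_on(4)[OF primeidealD_ring_on(1)[OF prime_centre] _ uc] by simp
    then show "y \<in> centre" using primeidealD_ring_on(3)[OF prime_centre _ T.power_mem[OF f(1)]] y fc by blast
  qed
  then show ?thesis unfolding associated_prime_def using prime_centre T.power_mem[OF f(1)] by blast
qed

lemma localization_centre: "lev 0 = {\<psi> x / \<psi> y | x y. x \<in> T \<and> y \<in> T - centre}"
proof (intro Set.equalityI subsetI)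
  fix c assume "c \<in> {\<psi> x / \<psi> y | x y. x \<in> T \<and> y \<in> T - centre}"
  then obtain x y where xy: "c = \<psi> x / \<psi> y" "x \<in> T" "y \<in> T" "\<psi> y \<noteq> 0" "w (\<psi> y) = 0" using unit_level by blast
  have "\<psi> y \<in> M.E" using psi_E T_L xy by blast
  then have "inverse (\<psi> y) \<in> lev 0" using xy by (intro M.X.W.levelI) (simp_all add: M.X.W.inverse_mem M.X.W.v_inverse)
  then show "c \<in> lev 0" unfolding xy(1) divide_inverse using psi_T[OF xy(2)] M.X.W.O.mult_mem by blast
next
  fix c assume c: "c \<in> lev 0"
  obtain P Q where PQ: "\<Theta> Q \<noteq> 0" "c = \<Theta> P / \<Theta> Q" using E_fraction[OF M.X.W.level_mem[OF c]] .
  obtain f where f: "f \<in> T" "\<psi> f \<noteq> 0" "w (\<psi> f) = 0"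
    "\<And>G. G \<in> laurent_ring \<Longrightarrow> \<psi> G \<in> lev 0 \<Longrightarrow> \<exists>N. f ^ N * G \<in> T" by (rule localizing_element) blast
  have "\<Theta> Q \<in> lev 0" using psi_A[OF emb_itoh_base] psi_emb by metis
  \<comment> \<open>X has value 1, so dividing numerator and denominator by X^n gives the
    denominator value 0; powers of f then bring both into T.\<close>
  define n where "n = nat (w (\<Theta> Q))"
  have n: "w (\<Theta> Q) = int n" using M.X.W.level_v[OF \<open>\<Theta> Q \<in> lev 0\<close> PQ(1)] by (simp add: n_def)
  define G where "G R = emb R * troot ^ n" for R :: "'r poly"
  have GL: "G R \<in> laurent_ring" for R
    unfolding G_def using emb_itoh_base[of R I m] itoh_base_laurent[of I m] laurent_mems(3) L.mult_mem L.power_mem by blast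
  have psiG: "\<psi> (G R) = \<Theta> R * inverse s ^ n" for R
    unfolding G_def using psi_emb psi_troot E.power_mem by (simp add: psi_mult psi_power)
  have GQ: "\<psi> (G Q) \<noteq> 0" "w (\<psi> (G Q)) = 0"
    unfolding psiG using PQ(1) s_nz s_E Theta_E[of Q] n M.X.w_s
    by (simp_all add: M.X.W.v_mult M.X.W.v_power M.X.W.v_inverse M.X.W.inverse_mem M.X.W.power_mem)
  have GQ0: "\<psi> (G Q) \<in> lev 0" using psi_E[OF GL] GQ by (intro M.X.W.levelI) auto
  have "\<psi> (G P) = c * \<psi> (G Q)" unfolding psiG PQ(2) using PQ(1) by simp
  then have "\<psi> (G P) \<in> lev 0" using c GQ0 M.X.W.O.mult_mem by simp
  then obtain N1 where N1: "f ^ N1 * G P \<in> T" using f(4)[OF GL] by blast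
  obtain N2 where N2: "f ^ N2 * G Q \<in> T" using f(4)[OF GL GQ0] by blast
  let ?x = "f ^ N2 * (f ^ N1 * G P)" and ?y = "f ^ N1 * (f ^ N2 * G Q)"
  have xyT: "?x \<in> T" "?y \<in> T" using N1 N2 f(1) by (auto intro: T.mult_mem T.power_mem)
  have fd: "f ^ N \<in> \<Theta>.ext_dom" "G R \<in> \<Theta>.ext_dom" "f \<in> \<Theta>.ext_dom" for N R
    using f(1) T_dom E.power_mem GL laurent_dom by blast+
  have psixy: "\<psi> ?x = \<psi> f ^ (N1 + N2) * \<psi> (G P)" "\<psi> ?y = \<psi> f ^ (N1 + N2) * \<psi> (G Q)"
    using fd by (simp_all add: psi_mult psi_power E.mult_mem power_add ac_simps)
  have "c = \<psi> ?x / \<psi> ?y" unfolding psixy psiG PQ(2) using f(2) PQ(1) s_nz by simp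
  moreover have "\<psi> f \<in> M.E" using psi_E T_L f(1) by blast
  then have "\<psi> ?y \<noteq> 0 \<and> w (\<psi> ?y) = 0"
    unfolding psixy using f(2,3) GQ psi_E[OF GL] by (simp add: M.X.W.v_mult M.X.W.v_power M.X.W.power_mem)
  then have "?y \<notin> centre" using unit_level[OF xyT(2)] by blast
  ultimately show "c \<in> {\<psi> x / \<psi> y | x y. x \<in> T \<and> y \<in> T - centre}" using xyT by blast
qed

theorem itoh_valuation_ring_level: "itoh_valuation_ring I (h * k) (\<lambda>r. \<theta> r) s (lev 0)"
proof -
  have "residue_localization T centre kernel \<psi> (lev 0)"
    unfolding residue_localization_def
  proof (intro conjI)
    show "\<psi> \<in> ring_hom (ring_on T) ring_of_type_algebra"
      by (rule ring_hom_memI) (simp_all add: psi_T_hom \<Theta>.ext_1)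
    show "a_kernel (ring_on T) ring_of_type_algebra \<psi> = kernel"
      by (auto simp: a_kernel_def' kernel_def)
    show "lev 0 = {\<psi> x / \<psi> y | x y. x \<in> T \<and> y \<in> T - centre}" by (rule localization_centre)
  qed
  then show ?thesis
    unfolding itoh_valuation_ring_def
    using associated_centre unique_minimal_kernel psi_tconst(2) psi_uroot(2) M.X.W.dvr_level by blast
qed

end

section \<open>Assembly from the given data\<close>

theorem mainTheorem5:
  fixes I :: "'r::comm_ring_1 set"
    and b :: 'r
    and \<phi> :: "'r tqr \<Rightarrow> 'l::field"
    and V N W Q U P D M :: "'l set"
    and u :: 'l
    and \<omega> :: "nat \<Rightarrow> 'l"
    and k h :: nat
  assumes noetherian: "noetherian_ring (ring_of_type_algebra :: 'r ring)"
    and I_ideal: "ideal I (ring_of_type_algebra :: 'r ring)"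
    and I_proper: "I \<noteq> UNIV"
    and I_regular: "\<exists>a\<in>I. regular_in UNIV a"
    and V_rees: "rees_valuation_ring I b \<phi> V N"
    and IV: "genideal (ring_on V) ((\<lambda>a. \<phi> (Tqr a 1)) ` I) = N [^]\<^bsub>ideals_set (ring_on V)\<^esub> k"
    and u_indeterminate: "ring.transcendental ring_of_type_algebra (tot_quot V) u"
    and W_def: "W = rees_extension V N (\<phi> (Tqr b 1)) u"
    and Q_def: "Q = genideal (ring_on W) N"
    and closure: "algebraic_closure (ring_of_type_algebra :: 'l ring) (tot_quot W)"
    and omega_1: "\<omega> 1 = u"
    and omega_compatible: "\<And>i m. 0 < i \<Longrightarrow> 0 < m \<Longrightarrow> \<omega> (i * m) ^ i = \<omega> m"
    and h_pos: "0 < h"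
    and U_def: "U = int_closure (ring_gen (W \<union> {\<omega> k}))"
    and D_def: "D = int_closure (ring_gen (W \<union> {\<omega> (h * k)}))"
    and P_def: "P = cgenideal (ring_on U) (\<omega> k)"
    and M_def: "M = cgenideal (ring_on D) (\<omega> (h * k))"
  shows "D = int_closure (ring_gen (U \<union> {\<omega> (h * k)}))
    \<and> dvr U P \<and> dvr D M
    \<and> finite_free_extension W U \<and> integral_extension_domain W U
    \<and> finite_free_extension W D \<and> integral_extension_domain W D
    \<and> has_ramification_index P D M h \<and> has_ramification_index Q U P 1
    \<and> has_degree U D h \<and> has_degree W U k
    \<and> (ring_on D Quot M) \<simeq> (ring_on U Quot P)
    \<and> has_residue_degree W Q U P k
    \<and> fundamental_equality_no_splitting W Q U P
    \<and> fundamental_equality_no_splitting W Q D M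
    \<and> fundamental_equality_no_splitting U P D M
    \<and> itoh_valuation_ring I k (\<lambda>r. \<phi> (Tqr r 1)) (\<omega> k) U
    \<and> itoh_valuation_ring I (h * k) (\<lambda>r. \<phi> (Tqr r 1)) (\<omega> (h * k)) D"
proof -
  obtain B where B: "finite B" "b \<in> B" "\<And>c. c \<in> B \<Longrightarrow> regular_in UNIV c"
      "I = genideal (ring_of_type_algebra :: 'r ring) B"
    using V_rees unfolding rees_valuation_ring_def by blast
  obtain p z where pz: "associated_prime (int_closure (blowup_ring I b))
      (cgenideal (ring_on (int_closure (blowup_ring I b))) (emb b)) p"
      "unique_minimal_prime_in (int_closure (blowup_ring I b)) p z"
      "residue_localization (int_closure (blowup_ring I b)) p z \<phi> V"
    using V_rees unfolding rees_valuation_ring_def by blast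
  obtain x\<^sub>0 where p: "primeideal p (ring_on (int_closure (blowup_ring I b)))" "x\<^sub>0 \<in> int_closure (blowup_ring I b)"
      "p = {y \<in> int_closure (blowup_ring I b). y * x\<^sub>0 \<in> cgenideal (ring_on (int_closure (blowup_ring I b))) (emb b)}"
    using pz(1) unfolding associated_prime_def by blast
  have dvr_V: "dvr V N" using V_rees by (simp add: rees_valuation_ring_def)
  define F where "F = tot_quot V"
  obtain v \<pi> where v: "disc_val F v \<pi>" "V = valued_field.level F v 0" "N = valued_field.level F v 1"
    using dvr_disc_val[OF dvr_V] unfolding F_def by blast
  interpret R: cring "ring_of_type_algebra :: 'r ring" by (rule cring_from_type_algebra)
  have bI: "b \<in> I" unfolding B(4) using R.genideal_self[of B] B(2) by auto
  interpret rees_residue I b \<phi> p z F v \<pi>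
    using B(3)[OF B(2)] bI I_ideal p(1) pz(2,3) v by (intro rees_residue.intro) simp_all
  \<comment> \<open>The assumption IV = N^k becomes an equality of levels, and different values give
    different levels.\<close>
  have "V.level (v \<beta>) = V.level (int k)"
    using IV genideal_theta V.level_ideal_pow[of k] unfolding v(2,3) by simp
  then have v_beta: "v \<beta> = int k"
    using V.level_eq_iff[of "v \<beta>" "int k"] V.level_eq_iff[of "int k" "v \<beta>"] by simp
  interpret rees_point I b \<phi> p z F v \<pi> k x\<^sub>0
    using p(2,3) v_beta by (intro rees_point.intro rees_residue_axioms rees_point_axioms.intro)
  have hk: "0 < h * k" using h_pos k_pos by simp
  \<comment> \<open>The factor 1 fits the pattern of the tower with h = 1 and top generator the k-th
    root of u.\<close>
  have u1: "\<omega> k ^ (1 * k) = u" using omega_compatible[of k 1] omega_1 k_pos by simp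
  have u2: "\<omega> (h * k) ^ (h * k) = u" using omega_compatible[of "h * k" 1] omega_1 hk by simp
  have u3: "\<omega> (h * k) ^ h = \<omega> k" by (rule omega_compatible[OF h_pos k_pos])
  have trans_u: "transcendental_over F u"
    using u_indeterminate V.transcendental_over_iff unfolding F_def by blast
  have trans: "transcendental_over F (\<omega> k)" "transcendental_over F (\<omega> (h * k))"
    by (rule V.transcendental_root[OF trans_u[folded u1]], rule V.transcendental_root[OF trans_u[folded u2]])
  have noeth: "noetherian_set (UNIV :: 'r set)" by (rule noetherian_set_UNIV[OF noetherian])
  have fin_gen: "\<exists>S. finite S \<and> I = genideal (ring_of_type_algebra :: 'r ring) S" using B(1,4) by blast
  interpret D: itoh_point I b \<phi> p z F v \<pi> k x\<^sub>0 "\<omega> (h * k)" h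
    using h_pos trans(2) noeth fin_gen by (intro itoh_point.intro rees_point_axioms itoh_point_axioms.intro)
  interpret U: itoh_point I b \<phi> p z F v \<pi> k x\<^sub>0 "\<omega> k" 1
    using trans(1) noeth fin_gen by (intro itoh_point.intro rees_point_axioms itoh_point_axioms.intro zero_less_one)
  have beta: "\<beta> \<in> F" by (rule phi_F[OF emb_C'])
  have WD: "W = rees_extension (V.level 0) (V.level 1) \<beta> (\<omega> (h * k) ^ (h * k))"
    unfolding W_def u2 v(2,3) ..
  have WU: "W = rees_extension (V.level 0) (V.level 1) \<beta> (\<omega> k ^ (1 * k))"
    unfolding W_def u1 v(2,3) ..
  note tower_D = D.M.tower[OF k_pos beta beta_nz v_beta WD Q_def[unfolded v(3)] U_def[folded u3] D_def
      P_def[folded u3] M_def]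
  \<comment> \<open>In the large tower U is an intermediate ring; in the tower with h = 1 it is the
    top ring, which is the form needed for its Itoh property.\<close>
  have "U = U.M.lev 0"
    by (rule U.M.tower(2)[OF k_pos beta beta_nz v_beta WU refl refl U_def refl refl])
  then have "itoh_valuation_ring I k (\<lambda>r. \<theta> r) (\<omega> k) U"
    using U.itoh_valuation_ring_level by simp
  moreover have "itoh_valuation_ring I (h * k) (\<lambda>r. \<theta> r) (\<omega> (h * k)) D"
    using D.itoh_valuation_ring_level tower_D(2) by simp
  ultimately show ?thesis using tower_D(1) unfolding u3 by blast
qed

end
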